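(* For every integer $k \geq 2$ and every $\theta>0$, there exist $c,\gamma \in (0,1)$ such that the following holds for every sufficiently large $N$ and every red/blue coloring of the edges of $K_N$. Either one can recolor at most $\theta N^2$ edges so that the red graph becomes a balanced complete $k$-partite graph, or else the coloring contains one of the following: (i) at least $\gamma N^k$ red copies of $K_k$, each with at least $(\frac ck+\gamma)N$ extensions to a red $K_{k+1}$; or (ii) at least $\gamma N^k$ blue copies of $K_k$, each with at least $(\frac 1k+\gamma)N$ extensions to a blue $K_{k+1}$.
   Context: A red (resp. blue) copy $Q$ of $K_k$ is a set of $k$ vertices all of whose pairs are red (resp. blue) edges. An extension of $Q$ to a red (resp. blue) $K_{k+1}$ is a vertex $u \notin Q$ such that all edges from $u$ to $Q$ are red (resp. blue); the number of extensions is the number of such vertices $u$. A complete $k$-partite graph is balanced if its $k$ parts have sizes differing by at most one. *)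

theory Defs
  imports Complex_Main "HOL-Library.Ramsey" "HOL-Library.Disjoint_Sets"
begin

datatype color = Red | Blue

text \<open>A red/blue coloring of the edges of \<open>K_N\<close> is a function \<open>\<chi> :: nat set \<Rightarrow> color\<close>; only its
  values on \<open>[{..<N}]\<^bsup>2\<^esup>\<close>, the edge set of the complete graph on \<open>{..<N}\<close>, matter.\<close>

definition color_graph :: "nat \<Rightarrow> (nat set \<Rightarrow> color) \<Rightarrow> color \<Rightarrow> nat set set" where
  "color_graph N \<chi> a = {e \<in> [{..<N}]\<^bsup>2\<^esup>. \<chi> e = a}"

definition recolored_edges :: "nat \<Rightarrow> (nat set \<Rightarrow> color) \<Rightarrow> (nat set \<Rightarrow> color) \<Rightarrow> nat set set" where
  "recolored_edges N \<chi> \<chi>' = {e \<in> [{..<N}]\<^bsup>2\<^esup>. \<chi> e \<noteq> \<chi>' e}"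

definition balanced_complete_partite :: "nat \<Rightarrow> 'a set \<Rightarrow> 'a set set \<Rightarrow> bool" where
  "balanced_complete_partite k V E \<longleftrightarrow>
     (\<exists>P :: nat \<Rightarrow> 'a set.
        (\<Union>i<k. P i) = V \<and>
        disjoint_family_on P {..<k} \<and>
        (\<forall>i<k. \<forall>j<k. card (P i) \<le> card (P j) + 1) \<and>
        E = {{u, v} | u v. \<exists>i<k. \<exists>j<k. i \<noteq> j \<and> u \<in> P i \<and> v \<in> P j})"

definition mono_cliques :: "nat \<Rightarrow> (nat set \<Rightarrow> color) \<Rightarrow> color \<Rightarrow> nat \<Rightarrow> nat set set" where
  "mono_cliques N \<chi> a k = {Q \<in> [{..<N}]\<^bsup>k\<^esup>. [Q]\<^bsup>2\<^esup> \<subseteq> color_graph N \<chi> a}"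

definition extensions :: "nat \<Rightarrow> (nat set \<Rightarrow> color) \<Rightarrow> color \<Rightarrow> nat set \<Rightarrow> nat set" where
  "extensions N \<chi> a Q = {u \<in> {..<N} - Q. \<forall>v\<in>Q. {u, v} \<in> color_graph N \<chi> a}"

end

theory Submission
  imports Defs "HOL-Analysis.Convex"
begin

text \<open>The number \<open>c\<close> may be taken as small as we like, so the failure of (i) just says that there are
  few red \<open>K\<^bsub>k+1\<^esub>\<close>. Every vertex set \<open>A\<close> of linear size can then, by Ramsey's theorem and a union bound,
  be almost partitioned into blue \<open>m\<close>-cliques (\<open>m\<close> a large constant) all of whose \<open>k\<close>-subsets have at
  most \<open>(1/k + \<gamma>)N\<close> blue extensions, and convexity gives \<open>E\<^sub>u (1 - d(u, A))\<^sup>k \<le> 1/k + o(1)\<close>, where \<open>d(u, A)\<close>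
  is the red density between \<open>u\<close> and \<open>A\<close>. Applied to the classes of a Frieze--Kannan weakly regular
  partition, this bounds the \<open>k\<close>-th moment of \<open>1 - G\<close> for a symmetric weight function \<open>G\<close> that is close to
  the red graph in cut norm, and so has few weighted \<open>K\<^bsub>k+1\<^esub>\<close> too. By Moon--Moser (Turan supersaturation) \<open>G\<close> is
  nearly \<open>0\<close> on a \<open>1/k\<close>-fraction of all pairs; these alone use up the moment bound, so \<open>G\<close> is nearly \<open>1\<close>
  on the other pairs and the red density is at least \<open>1 - 1/k - o(1)\<close>. Finally, the near-equality
  case of Moon--Moser yields stability: for a random red \<open>K\<^sub>k\<close> most vertices miss exactly one of its vertices,
  and this labelling is close to a balanced complete \<open>k\<close>-partite graph.\<close>

section \<open>Clique densities and the Moon--Moser inequalities\<close>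

text \<open>The bound 1/k on the k-th moment of 1 - G is not rigid by itself: the constant weight
  with 1 - G = k^(-1/k) meets it too, at a density below 1 - 1/k. It becomes rigid only together
  with the scarcity of (k+1)-cliques. The failure of (ii) controls all but \<gamma> N^k blue
  k-cliques, not every one; so the blue m-cliques must avoid each exceptional k-set. This is why
  Ramsey's theorem is applied inside a random set of bounded size, where a union bound excludes the
  exceptional sets, and not to a large set directly. Weak regularity suffices because closeness in
  cut norm controls the count of a fixed clique up to a small multiple of N^(k+1), and the number of
  red (k+1)-cliques matters only to that precision. The constants are chosen backwards: \<theta>
  fixes the precision \<rho> of the labelling, \<rho> fixes the admissible density error and clique
  density, these fix the hypotheses of the density result, and c and \<gamma> come last.\<close>

lemma convex_power_nonneg: "convex_on {0::real..} (\<lambda>x. x ^ n)"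
  by (cases "even n") (auto intro: convex_on_subset[OF convex_power_even] convex_power_odd)

lemma sum_PiE_insert:
  assumes "a \<notin> J"
  shows "(\<Sum>x\<in>PiE (insert a J) (\<lambda>_. V). F x) = (\<Sum>y\<in>PiE J (\<lambda>_. V). \<Sum>v\<in>V. F (y(a := v)))"
proof -
  have "(\<Sum>x\<in>PiE (insert a J) (\<lambda>_. V). F x)
      = (\<Sum>p\<in>V \<times> PiE J (\<lambda>_. V). F ((\<lambda>(v, y). y(a := v)) p))"
    unfolding PiE_insert_eq by (subst sum.reindex[OF inj_combinator[OF assms]]) simp
  also have "\<dots> = (\<Sum>v\<in>V. \<Sum>y\<in>PiE J (\<lambda>_. V). F (y(a := v)))"
    by (simp add: sum.cartesian_product split_def)
  also have "\<dots> = (\<Sum>y\<in>PiE J (\<lambda>_. V). \<Sum>v\<in>V. F (y(a := v)))"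
    by (rule sum.swap)
  finally show ?thesis .
qed

section \<open>Weighted homomorphism counts of complete graphs\<close>

definition pairs :: "nat set \<Rightarrow> (nat \<times> nat) set" where
  "pairs I = {(i, j). i \<in> I \<and> j \<in> I \<and> i < j}"

definition clique_weight :: "('a \<Rightarrow> 'a \<Rightarrow> real) \<Rightarrow> nat set \<Rightarrow> (nat \<Rightarrow> 'a) \<Rightarrow> real" where
  "clique_weight h I x = (\<Prod>(i, j)\<in>pairs I. h (x i) (x j))"

text \<open>An unnormalised homomorphism count of the complete graph on \<open>I\<close>: the maps
  need not be injective and \<open>h\<close> may have loops. Index sets are arbitrary because the
  Moon--Moser argument deletes an arbitrary index from \<open>{..<Suc r}\<close>.\<close>

definition clique_sum :: "'a set \<Rightarrow> ('a \<Rightarrow> 'a \<Rightarrow> real) \<Rightarrow> nat set \<Rightarrow> real" where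
  "clique_sum V h I = (\<Sum>x\<in>PiE I (\<lambda>_. V). clique_weight h I x)"

lemma finite_pairs [simp]: "finite I \<Longrightarrow> finite (pairs I)"
  by (rule finite_subset[of _ "I \<times> I"]) (auto simp: pairs_def)

text \<open>Symmetry of \<open>h\<close> lets the new index \<open>a\<close> lie anywhere in the
  order: its edges occur in \<open>pairs\<close> in both orientations, depending on whether the
  other index is smaller or larger.\<close>

lemma clique_weight_insert:
  assumes "finite J" "a \<notin> J" and sym: "\<And>u v. h u v = h v u"
  shows "clique_weight h (insert a J) (x(a := v)) = clique_weight h J x * (\<Prod>j\<in>J. h (x j) v)"
proof -
  let ?f = "\<lambda>j. if j < a then (j, a) else (a, j)"
  have eq: "pairs (insert a J) = pairs J \<union> ?f ` J"
  proof (intro equalityI subsetI)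
    fix p assume "p \<in> pairs (insert a J)"
    then show "p \<in> pairs J \<union> ?f ` J"
      using assms(2) by (cases p) (auto simp: pairs_def image_iff)
  next
    fix p assume "p \<in> pairs J \<union> ?f ` J"
    then show "p \<in> pairs (insert a J)"
      using assms(2) by (auto simp: pairs_def split: if_splits) (metis linorder_neqE_nat)
  qed
  have dis: "pairs J \<inter> ?f ` J = {}"
    using assms(2) by (auto simp: pairs_def)
  have inj: "inj_on ?f J"
    by (auto simp: inj_on_def split: if_splits)
  have "clique_weight h (insert a J) (x(a := v)) =
      (\<Prod>(i, j)\<in>pairs J. h ((x(a := v)) i) ((x(a := v)) j)) *
      (\<Prod>(i, j)\<in>?f ` J. h ((x(a := v)) i) ((x(a := v)) j))"
    unfolding clique_weight_def eq using assms(1) dis by (intro prod.union_disjoint) auto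
  also have "(\<Prod>(i, j)\<in>pairs J. h ((x(a := v)) i) ((x(a := v)) j)) = clique_weight h J x"
    unfolding clique_weight_def using assms(2) by (intro prod.cong) (auto simp: pairs_def)
  also have "(\<Prod>(i, j)\<in>?f ` J. h ((x(a := v)) i) ((x(a := v)) j)) = (\<Prod>j\<in>J. h (x j) v)"
    unfolding prod.reindex[OF inj] using assms(2) sym by (intro prod.cong) auto
  finally show ?thesis .
qed

lemma clique_sum_insert:
  assumes "finite J" "a \<notin> J" and sym: "\<And>u v. h u v = h v u"
  shows "clique_sum V h (insert a J) =
    (\<Sum>y\<in>PiE J (\<lambda>_. V). clique_weight h J y * (\<Sum>v\<in>V. \<Prod>j\<in>J. h (y j) v))"
  unfolding clique_sum_def
  by (simp add: sum_PiE_insert[OF assms(2)] clique_weight_insert[OF assms] sum_distrib_left)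

lemma clique_sum_reindex:
  assumes mono: "strict_mono_on I \<sigma>"
  shows "clique_sum V h (\<sigma> ` I) = clique_sum V h I"
proof -
  have inj: "inj_on \<sigma> I"
    using mono strict_mono_on_imp_inj_on by blast
  define g where "g = (\<lambda>x. restrict (x \<circ> \<sigma>) I :: nat \<Rightarrow> 'a)"
  have "bij_betw g (PiE (\<sigma> ` I) (\<lambda>_. V)) (PiE I (\<lambda>_. V))"
  proof (rule bij_betwI[where g = "\<lambda>y. restrict (y \<circ> inv_into I \<sigma>) (\<sigma> ` I)"])
    show "g \<in> (\<sigma> ` I \<rightarrow>\<^sub>E V) \<rightarrow> I \<rightarrow>\<^sub>E V"
      by (auto simp: g_def)
    show "(\<lambda>y. restrict (y \<circ> inv_into I \<sigma>) (\<sigma> ` I)) \<in> (I \<rightarrow>\<^sub>E V) \<rightarrow> \<sigma> ` I \<rightarrow>\<^sub>E V"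
    proof (intro funcsetI PiE_I)
      fix y j assume y: "y \<in> I \<rightarrow>\<^sub>E V" and "j \<in> \<sigma> ` I"
      then have "inv_into I \<sigma> j \<in> I" by (simp add: inv_into_into)
      with y show "restrict (y \<circ> inv_into I \<sigma>) (\<sigma> ` I) j \<in> V"
        using \<open>j \<in> \<sigma> ` I\<close> by (auto dest: PiE_mem)
    qed simp
    show "restrict (g x \<circ> inv_into I \<sigma>) (\<sigma> ` I) = x" if "x \<in> \<sigma> ` I \<rightarrow>\<^sub>E V" for x
    proof
      fix j
      show "restrict (g x \<circ> inv_into I \<sigma>) (\<sigma> ` I) j = x j"
      proof (cases "j \<in> \<sigma> ` I")
        case True
        then obtain i where "i \<in> I" "j = \<sigma> i" by blast
        then show ?thesis using inj by (simp add: g_def)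
      qed (simp add: PiE_arb[OF that])
    qed
    show "g (restrict (y \<circ> inv_into I \<sigma>) (\<sigma> ` I)) = y" if "y \<in> I \<rightarrow>\<^sub>E V" for y
    proof
      fix j
      show "g (restrict (y \<circ> inv_into I \<sigma>) (\<sigma> ` I)) j = y j"
      proof (cases "j \<in> I")
        case True
        then show ?thesis using inj by (simp add: g_def)
      qed (simp add: g_def PiE_arb[OF that])
    qed
  qed
  moreover have "clique_weight h I (g x) = clique_weight h (\<sigma> ` I) x" for x
  proof -
    have eq: "pairs (\<sigma> ` I) = map_prod \<sigma> \<sigma> ` pairs I"
      using strict_mono_on_less[OF mono] by (fastforce simp: pairs_def image_iff)
    have "inj_on (map_prod \<sigma> \<sigma>) (pairs I)"
      using inj by (auto simp: inj_on_def pairs_def)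
    then show ?thesis
      unfolding clique_weight_def eq
      by (subst prod.reindex) (auto simp: g_def pairs_def intro!: prod.cong)
  qed
  ultimately show ?thesis
    using sum.reindex_bij_betw[of g "PiE (\<sigma> ` I) (\<lambda>_. V)" "PiE I (\<lambda>_. V)" "clique_weight h I"]
    by (simp add: clique_sum_def)
qed

lemma clique_sum_remove:
  assumes "i < Suc r"
  shows "clique_sum V h ({..<Suc r} - {i}) = clique_sum V h {..<r}"
proof -
  let ?\<sigma> = "\<lambda>j. if j < i then j else Suc j"
  have "?\<sigma> ` {..<r} = {..<Suc r} - {i}"
  proof (intro equalityI subsetI)
    fix j assume j: "j \<in> {..<Suc r} - {i}"
    show "j \<in> ?\<sigma> ` {..<r}"
    proof (cases "j < i")
      case True then show ?thesis using assms by (intro image_eqI[of _ _ j]) auto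
    next
      case False then show ?thesis using j by (intro image_eqI[of _ _ "j - 1"]) auto
    qed
  qed (use assms in \<open>auto split: if_splits\<close>)
  then show ?thesis
    using clique_sum_reindex[of "{..<r}" ?\<sigma> V h] by (auto simp: strict_mono_on_def)
qed

lemma clique_weight_01:
  assumes "\<And>u v. h u v \<in> {0, 1}" "finite I"
  shows "clique_weight h I x \<in> {0, 1}"
proof (cases "\<exists>(i, j)\<in>pairs I. h (x i) (x j) = 0")
  case True
  then have "clique_weight h I x = 0"
    unfolding clique_weight_def using assms(2) by (intro prod_zero) (auto simp: split_def)
  then show ?thesis by simp
next
  case False
  then have "\<forall>(i, j)\<in>pairs I. h (x i) (x j) = 1"
    using assms(1) by fastforce
  then show ?thesis
    unfolding clique_weight_def by (subst prod.neutral) auto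
qed

lemma clique_weight_nonneg: "(\<And>u v. 0 \<le> h u v) \<Longrightarrow> 0 \<le> clique_weight h I x"
  unfolding clique_weight_def by (intro prod_nonneg) auto

lemma clique_sum_nonneg: "(\<And>u v. 0 \<le> h u v) \<Longrightarrow> 0 \<le> clique_sum V h I"
  unfolding clique_sum_def by (intro sum_nonneg clique_weight_nonneg)

lemma clique_sum_0 [simp]: "clique_sum V h {} = 1"
  by (simp add: clique_sum_def clique_weight_def pairs_def)

lemma clique_sum_Suc_0: "clique_sum V h {..<Suc 0} = card V"
proof -
  have "pairs {0} = {}" by (auto simp: pairs_def)
  moreover have "{..<Suc 0} = {0::nat}" by auto
  ultimately show ?thesis
    by (simp add: clique_sum_def clique_weight_def card_PiE)
qed

lemma clique_sum_2: "clique_sum V h {..<2} = (\<Sum>u\<in>V. \<Sum>v\<in>V. h u v)"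
proof -
  have 1: "{..<2} = insert 1 (insert (0::nat) {})" and 2: "pairs {Suc 0, 0} = {(0, Suc 0)}"
    by (auto simp: pairs_def)
  show ?thesis
    unfolding clique_sum_def 1
    by (subst sum_PiE_insert, simp)+ (simp add: clique_weight_def 2)
qed

text \<open>Cauchy--Schwarz over the common neighbourhoods of the cliques indexed by \<open>{..<Suc r} - {i}\<close>.\<close>

lemma clique_sum_square_le:
  assumes "finite V" "i < Suc r" and sym: "\<And>u v. h u v = h v u" and nn: "\<And>u v. 0 \<le> h u v"
  shows "(clique_sum V h {..<Suc r})\<^sup>2 \<le> clique_sum V h {..<r} *
    (\<Sum>x\<in>PiE {..<Suc r} (\<lambda>_. V). clique_weight h {..<Suc r} x *
      (\<Sum>u\<in>V. \<Prod>j\<in>{..<Suc r} - {i}. h (x j) u))"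
proof -
  define J where "J = {..<Suc r} - {i}"
  have I: "{..<Suc r} = insert i J" and J: "finite J" "i \<notin> J"
    using assms(2) by (auto simp: J_def)
  define W where "W = clique_weight h J"
  define q where "q = (\<lambda>y. \<Sum>v\<in>V. \<Prod>j\<in>J. h (y j) v)"
  have W: "0 \<le> W y" for y
    unfolding W_def using nn by (rule clique_weight_nonneg)
  \<comment> \<open>The clique sum is the sum of \<open>W y * q y\<close>, where \<open>q y\<close>
    counts the extensions of \<open>y\<close> with weights. Splitting \<open>W\<close> into two
    square roots leaves the sum over r-cliques as one factor and the sum of \<open>W y\<close> times
    the square of \<open>q y\<close> as the other.\<close>
  have "(clique_sum V h {..<Suc r})\<^sup>2 = (\<Sum>y\<in>PiE J (\<lambda>_. V). sqrt (W y) * (sqrt (W y) * q y))\<^sup>2"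
    unfolding I clique_sum_insert[OF J sym] W_def[symmetric] q_def[symmetric]
    using W by (simp add: q_def flip: mult.assoc)
  also have "\<dots> \<le> (\<Sum>y\<in>PiE J (\<lambda>_. V). (sqrt (W y))\<^sup>2) * (\<Sum>y\<in>PiE J (\<lambda>_. V). (sqrt (W y) * q y)\<^sup>2)"
    by (rule Cauchy_Schwarz_ineq_sum)
  also have "(\<Sum>y\<in>PiE J (\<lambda>_. V). (sqrt (W y))\<^sup>2) = clique_sum V h {..<r}"
    using W clique_sum_remove[OF assms(2)] by (simp add: W_def clique_sum_def J_def)
  \<comment> \<open>Of the two vertices counted by the square of \<open>q y\<close>, one becomes the
    value of the clique at \<open>i\<close> and the other is \<open>u\<close>.\<close>
  also have "(\<Sum>y\<in>PiE J (\<lambda>_. V). (sqrt (W y) * q y)\<^sup>2)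
      = (\<Sum>x\<in>PiE {..<Suc r} (\<lambda>_. V). clique_weight h {..<Suc r} x *
      (\<Sum>u\<in>V. \<Prod>j\<in>{..<Suc r} - {i}. h (x j) u))"
  proof -
    have *: "(\<Prod>j\<in>J. h (if j = i then v else y j) u) = (\<Prod>j\<in>J. h (y j) u)" for y v u
      using J(2) by (intro prod.cong) auto
    show ?thesis
      unfolding I sum_PiE_insert[OF J(2)] clique_weight_insert[OF J sym]
      using J(2) W by (simp add: * W_def[symmetric] power_mult_distrib sum_distrib_right[symmetric]
          sum_distrib_left[symmetric] mult.assoc) (simp add: q_def power2_eq_square)
  qed
  finally show ?thesis .
qed

text \<open>Here \<open>a j\<close> records whether a vertex is adjacent to the j-th vertex of a
  clique. With no zero the left side is r + 1; with exactly one zero only the product omitting it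
  survives and equals 1; with two or more zeros every product vanishes.\<close>

lemma moon_moser_pointwise:
  fixes a :: "nat \<Rightarrow> real"
  assumes "\<And>j. a j \<in> {0, 1}"
  shows "(\<Sum>i<Suc r. \<Prod>j\<in>{..<Suc r} - {i}. a j) \<le> of_bool (card {i. i < Suc r \<and> a i = 0} \<le> 1) + r * (\<Prod>j<Suc r. a j)"
proof (cases "\<forall>j<Suc r. a j = 1")
  case True
  then have "{i. i < Suc r \<and> a i = 0} = {}" by auto
  then have 1: "card {i. i < Suc r \<and> a i = 0} \<le> 1" by (simp only: card.empty)
  have "(\<Sum>i<Suc r. \<Prod>j\<in>{..<Suc r} - {i}. a j) = Suc r"
    by (simp add: True)
  moreover have "(\<Prod>j<Suc r. a j) = 1" using True by simp
  ultimately show ?thesis using 1 by simp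
next
  case False
  then obtain l where l: "l < Suc r" "a l = 0"
    using assms by (metis insertE singletonD)
  have "(\<Prod>j\<in>{..<Suc r} - {i}. a j) = 0" if "i \<noteq> l" for i
    using l that by (intro prod_zero) auto
  then have "(\<Sum>i<Suc r. \<Prod>j\<in>{..<Suc r} - {i}. a j) = (\<Sum>i\<in>{l}. \<Prod>j\<in>{..<Suc r} - {i}. a j)"
    using l by (intro sum.mono_neutral_right) auto
  also have "\<dots> \<le> of_bool (card {i. i < Suc r \<and> a i = 0} \<le> 1)"
  proof (cases "\<exists>m<Suc r. m \<noteq> l \<and> a m = 0")
    case True
    then have "(\<Prod>j\<in>{..<Suc r} - {l}. a j) = 0"
      by (intro prod_zero) auto
    then show ?thesis by (simp del: prod_zero_iff)
  next
    case False
    then have "{i. i < Suc r \<and> a i = 0} = {l}" using l by auto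
    then have 1: "card {i. i < Suc r \<and> a i = 0} \<le> 1" by (metis card.empty card_insert_disjoint empty_iff finite.emptyI One_nat_def le_refl)
    have "(\<Prod>j\<in>{..<Suc r} - {l}. a j) \<le> 1"
    proof (intro prod_le_1)
      show "0 \<le> a j \<and> a j \<le> 1" for j using assms[of j] by auto
    qed
    then show ?thesis using 1 by simp
  qed
  also have "\<dots> \<le> of_bool (card {i. i < Suc r \<and> a i = 0} \<le> 1) + r * (\<Prod>j<Suc r. a j)"
  proof -
    have "0 \<le> a j" for j using assms[of j] by auto
    then show ?thesis by (simp add: prod_nonneg del: prod.lessThan_Suc)
  qed
  finally show ?thesis .
qed

lemma sum_clique_extension:
  assumes sym: "\<And>u v. h u v = h v u"
  shows "(\<Sum>x\<in>PiE {..<r} (\<lambda>_. V). clique_weight h {..<r} x * (\<Sum>u\<in>V. \<Prod>j<r. h (x j) u))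
    = clique_sum V h {..<Suc r}"
  by (simp add: clique_sum_insert[OF _ _ sym] lessThan_Suc)

text \<open>The correction term \<open>card \<dots> > 1\<close> counts the vertices with at least two non-neighbours in
  the clique; it is dropped in the Moon--Moser inequality, but bounding it drives the stability
  argument.\<close>

lemma moon_moser_strong:
  fixes T :: "nat \<Rightarrow> real"
  assumes "finite V" and sym: "\<And>u v. h u v = h v u" and h01: "\<And>u v. h u v \<in> {0, 1}"
  defines "T \<equiv> \<lambda>r. clique_sum V h {..<r}"
  shows "Suc r * (T (Suc r))\<^sup>2 \<le> T r * (card V * T (Suc r) + r * T (Suc (Suc r))
     - (\<Sum>x\<in>PiE {..<Suc r} (\<lambda>_. V). clique_weight h {..<Suc r} x *
          card {u\<in>V. \<not> card {i. i < Suc r \<and> h (x i) u = 0} \<le> 1}))"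
proof -
  have nn: "0 \<le> h u v" for u v using h01[of u v] by auto
  let ?I = "{..<Suc r}"
  let ?W = "clique_weight h ?I"
  let ?b = "\<lambda>x. card {u\<in>V. \<not> card {i. i < Suc r \<and> h (x i) u = 0} \<le> 1}"
  \<comment> \<open>The square is written once for each of the r + 1 deleted indices, since the
    pointwise inequality bounds the sum over \<open>i\<close> and not its single terms.\<close>
  have "Suc r * (T (Suc r))\<^sup>2 = (\<Sum>i<Suc r. (T (Suc r))\<^sup>2)" by simp
  also have "\<dots> \<le> (\<Sum>i<Suc r. T r * (\<Sum>x\<in>PiE ?I (\<lambda>_. V). ?W x * (\<Sum>u\<in>V. \<Prod>j\<in>?I - {i}. h (x j) u)))"
    unfolding T_def by (intro sum_mono clique_sum_square_le assms(1) sym nn) simp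
  also have "\<dots> = T r * (\<Sum>x\<in>PiE ?I (\<lambda>_. V). ?W x * (\<Sum>u\<in>V. \<Sum>i<Suc r. \<Prod>j\<in>?I - {i}. h (x j) u))"
  proof -
    have "(\<Sum>x\<in>PiE ?I (\<lambda>_. V). ?W x * (\<Sum>u\<in>V. \<Sum>i<Suc r. \<Prod>j\<in>?I - {i}. h (x j) u))
      = (\<Sum>x\<in>PiE ?I (\<lambda>_. V). ?W x * (\<Sum>i<Suc r. \<Sum>u\<in>V. \<Prod>j\<in>?I - {i}. h (x j) u))"
      by (simp only: sum.swap[of _ V "{..<Suc r}"])
    also have "\<dots> = (\<Sum>x\<in>PiE ?I (\<lambda>_. V). \<Sum>i<Suc r. ?W x * (\<Sum>u\<in>V. \<Prod>j\<in>?I - {i}. h (x j) u))"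
      by (simp only: sum_distrib_left)
    also have "\<dots> = (\<Sum>i<Suc r. \<Sum>x\<in>PiE ?I (\<lambda>_. V). ?W x * (\<Sum>u\<in>V. \<Prod>j\<in>?I - {i}. h (x j) u))"
      by (rule sum.swap)
    finally show ?thesis by (simp only: sum_distrib_left)
  qed
  also have "\<dots> \<le> T r * (\<Sum>x\<in>PiE ?I (\<lambda>_. V). ?W x * (real (card V) - ?b x + r * (\<Sum>u\<in>V. \<Prod>j<Suc r. h (x j) u)))"
  proof (intro mult_left_mono sum_mono clique_weight_nonneg nn)
    fix x
    have "(\<Sum>u\<in>V. \<Sum>i<Suc r. \<Prod>j\<in>?I - {i}. h (x j) u)
      \<le> (\<Sum>u\<in>V. of_bool (card {i. i < Suc r \<and> h (x i) u = 0} \<le> 1) + r * (\<Prod>j<Suc r. h (x j) u))"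
      by (intro sum_mono moon_moser_pointwise h01)
    also have "\<dots> = (\<Sum>u\<in>V. of_bool (card {i. i < Suc r \<and> h (x i) u = 0} \<le> 1)) + r * (\<Sum>u\<in>V. \<Prod>j<Suc r. h (x j) u)"
      by (simp only: sum.distrib sum_distrib_left)
    also have "(\<Sum>u\<in>V. of_bool (card {i. i < Suc r \<and> h (x i) u = 0} \<le> 1)) =
       (\<Sum>u\<in>V. 1 - of_bool (\<not> card {i. i < Suc r \<and> h (x i) u = 0} \<le> 1) :: real)"
      by (intro sum.cong) auto
    also have "\<dots> = real (card V) - ?b x"
      using assms(1) by (simp only: sum_subtractf) (simp add: Int_def)
    finally show "(\<Sum>u\<in>V. \<Sum>i<Suc r. \<Prod>j\<in>?I - {i}. h (x j) u)
      \<le> real (card V) - ?b x + r * (\<Sum>u\<in>V. \<Prod>j<Suc r. h (x j) u)" .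
  qed (simp add: T_def clique_sum_nonneg nn)
  also have "(\<Sum>x\<in>PiE ?I (\<lambda>_. V). ?W x * (real (card V) - ?b x + r * (\<Sum>u\<in>V. \<Prod>j<Suc r. h (x j) u)))
     = card V * T (Suc r) + r * T (Suc (Suc r)) - (\<Sum>x\<in>PiE ?I (\<lambda>_. V). ?W x * ?b x)"
  proof -
    have "(\<Sum>x\<in>PiE ?I (\<lambda>_. V). ?W x * (real (card V) - ?b x + r * (\<Sum>u\<in>V. \<Prod>j<Suc r. h (x j) u)))
     = (\<Sum>x\<in>PiE ?I (\<lambda>_. V). card V * ?W x - ?W x * ?b x + r * (?W x * (\<Sum>u\<in>V. \<Prod>j<Suc r. h (x j) u)))"
      by (intro sum.cong) (auto simp only: algebra_simps)
    also have "\<dots> = card V * sum ?W (PiE ?I (\<lambda>_. V)) - (\<Sum>x\<in>PiE ?I (\<lambda>_. V). ?W x * ?b x)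
        + r * (\<Sum>x\<in>PiE ?I (\<lambda>_. V). ?W x * (\<Sum>u\<in>V. \<Prod>j<Suc r. h (x j) u))"
      unfolding sum.distrib sum_subtractf by (simp only: sum_distrib_left)
    also have "\<dots> = card V * T (Suc r) - (\<Sum>x\<in>PiE ?I (\<lambda>_. V). ?W x * ?b x) + r * T (Suc (Suc r))"
      unfolding T_def sum_clique_extension[of h, OF sym, of "Suc r", symmetric] by (simp only: clique_sum_def)
    finally show ?thesis by simp
  qed
  finally show ?thesis .
qed

text \<open>In terms of the ratios t(r) = T(r+1) / T(r) and n = \<open>card V\<close>, this is the
  recursion (r + 1) t(r) \<le> n + r t(r+1).\<close>

lemma moon_moser:
  fixes T :: "nat \<Rightarrow> real"
  assumes "finite V" and sym: "\<And>u v. h u v = h v u" and h01: "\<And>u v. h u v \<in> {0, 1}"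
  defines "T \<equiv> \<lambda>r. clique_sum V h {..<r}"
  shows "Suc r * (T (Suc r))\<^sup>2 \<le> T r * (card V * T (Suc r) + r * T (Suc (Suc r)))"
proof -
  have nn: "0 \<le> h u v" for u v using h01[of u v] by auto
  have "0 \<le> T r" by (simp add: T_def clique_sum_nonneg nn)
  have "Suc r * (T (Suc r))\<^sup>2 \<le> T r * (card V * T (Suc r) + r * T (Suc (Suc r))
     - (\<Sum>x\<in>PiE {..<Suc r} (\<lambda>_. V). clique_weight h {..<Suc r} x *
          card {u\<in>V. \<not> card {i. i < Suc r \<and> h (x i) u = 0} \<le> 1}))"
    unfolding T_def by (rule moon_moser_strong[OF assms(1) sym h01])
  also have "\<dots> \<le> T r * (card V * T (Suc r) + r * T (Suc (Suc r)))"
  proof (intro mult_left_mono \<open>0 \<le> T r\<close>)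
    have "0 \<le> (\<Sum>x\<in>PiE {..<Suc r} (\<lambda>_. V). clique_weight h {..<Suc r} x *
          real (card {u\<in>V. \<not> card {i. i < Suc r \<and> h (x i) u = 0} \<le> 1}))"
      by (intro sum_nonneg mult_nonneg_nonneg clique_weight_nonneg nn) simp
    then show "card V * T (Suc r) + r * T (Suc (Suc r))
     - (\<Sum>x\<in>PiE {..<Suc r} (\<lambda>_. V). clique_weight h {..<Suc r} x *
          card {u\<in>V. \<not> card {i. i < Suc r \<and> h (x i) u = 0} \<le> 1})
      \<le> card V * T (Suc r) + r * T (Suc (Suc r))"
      by linarith
  qed
  finally show ?thesis .
qed

text \<open>Inserting t(s) \<ge> (1 - s a) n into the recursion gives s t(s+1) \<ge> (s + 1) (1 - s
  a) n - n = s (1 - (s + 1) a) n. For a = 1/k, complete k-partite graphs with equal parts attain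
  equality. Positivity is carried through the induction because the recursion divides by clique
  sums.\<close>

lemma clique_sum_lower:
  fixes a :: real and T :: "nat \<Rightarrow> real"
  assumes V: "finite V" "V \<noteq> {}" and sym: "\<And>u v. h u v = h v u" and h01: "\<And>u v. h u v \<in> {0, 1}"
    and dense: "(1 - a) * (card V)\<^sup>2 \<le> (\<Sum>u\<in>V. \<Sum>v\<in>V. h u v)"
    and "0 \<le> a" "r * a < 1" "s \<le> r"
  defines "T \<equiv> \<lambda>r. clique_sum V h {..<r}"
  shows "(1 - s * a) * card V * T s \<le> T (Suc s) \<and> 0 < T (Suc s)"
  using \<open>s \<le> r\<close>
proof (induction s)
  case 0
  have "0 < card V" using V by (simp add: card_gt_0_iff)
  then show ?case by (simp add: T_def clique_sum_Suc_0)
next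
  case (Suc s)
  let ?n = "real (card V)"
  have n: "0 < ?n" using V by (simp add: card_gt_0_iff)
  have sa: "Suc s * a < 1"
    using Suc.prems assms(6,7) by (meson le_less_trans mult_right_mono of_nat_mono)
  have le: "(1 - Suc s * a) * ?n * T (Suc s) \<le> T (Suc (Suc s))"
  \<comment> \<open>For s = 0 the term with \<open>T (Suc (Suc s))\<close> has coefficient 0 in
    Moon--Moser, so the start has to come from the edge density.\<close>
  proof (cases s)
    case 0
    have "T (Suc (Suc s)) = (\<Sum>u\<in>V. \<Sum>v\<in>V. h u v)"
      unfolding T_def using 0 clique_sum_2[of V h] by (simp add: numeral_2_eq_2)
    with dense 0 show ?thesis
      by (simp add: T_def clique_sum_Suc_0 power2_eq_square algebra_simps)
  next
    case (Suc s')
    have IH: "(1 - s * a) * ?n * T s \<le> T (Suc s)" "0 < T (Suc s)"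
      using Suc.IH Suc.prems by auto
    have Ts: "0 < T s"
    proof -
      have "0 \<le> h u v" for u v using h01[of u v] by auto
      then have "0 \<le> T s" unfolding T_def by (rule clique_sum_nonneg)
      moreover have "T s \<noteq> 0"
      proof
        assume "T s = 0"
        then have "Suc s * (T (Suc s))\<^sup>2 \<le> 0"
          using moon_moser[where V = V and h = h and r = s, OF V(1) sym h01] unfolding T_def by simp
        then show False using IH(2)
          by (metis linorder_not_less mult_pos_pos of_nat_0_less_iff zero_less_Suc zero_less_power)
      qed
      ultimately show ?thesis by simp
    qed
    have s: "0 < real s" using Suc by simp
    have mm: "Suc s * (T (Suc s))\<^sup>2 \<le> T s * (?n * T (Suc s) + s * T (Suc (Suc s)))"
      unfolding T_def by (rule moon_moser[OF V(1) sym h01])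
    have "T s * (?n * T (Suc s) * (Suc s * (1 - s * a)))  \<le> Suc s * (T (Suc s))\<^sup>2"
    proof -
      have "(1 - s * a) * ?n * T s * (Suc s * T (Suc s)) \<le> T (Suc s) * (Suc s * T (Suc s))"
        using IH by (intro mult_right_mono) auto
      then show ?thesis by (simp add: power2_eq_square algebra_simps)
    qed
    with mm have "T s * (?n * T (Suc s) * (Suc s * (1 - s * a))) \<le> T s * (?n * T (Suc s) + s * T (Suc (Suc s)))"
      by linarith
    then have "?n * T (Suc s) * (Suc s * (1 - s * a)) \<le> ?n * T (Suc s) + s * T (Suc (Suc s))"
      using Ts by simp
    then have "s * ((1 - Suc s * a) * ?n * T (Suc s)) \<le> s * T (Suc (Suc s))"
      by (simp add: algebra_simps)
    then show ?thesis using s by simp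
  qed
  moreover have "0 < T (Suc s)" using Suc.IH Suc.prems by simp
  then have "0 < (1 - Suc s * a) * ?n * T (Suc s)"
    using n sa by (intro mult_pos_pos) auto
  ultimately show ?case by (meson less_le_trans)
qed

text \<open>Each of the factors 1 - j a with j < s is at least 1 - r a.\<close>

lemma clique_sum_lower_power:
  fixes a :: real
  assumes V: "finite V" "V \<noteq> {}" and sym: "\<And>u v. h u v = h v u" and h01: "\<And>u v. h u v \<in> {0, 1}"
    and dense: "(1 - a) * (card V)\<^sup>2 \<le> (\<Sum>u\<in>V. \<Sum>v\<in>V. h u v)"
    and "0 \<le> a" "r * a < 1" "s \<le> Suc r"
  shows "((1 - r * a) * card V) ^ s \<le> clique_sum V h {..<s}"
  using \<open>s \<le> Suc r\<close>
proof (induction s)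
  case (Suc s)
  have "0 \<le> h u v" for u v using h01[of u v] by auto
  then have nn: "0 \<le> clique_sum V h {..<s}" by (rule clique_sum_nonneg)
  have "((1 - r * a) * card V) ^ Suc s \<le> ((1 - r * a) * card V) * clique_sum V h {..<s}"
    using Suc assms(7) by (auto intro!: mult_left_mono)
  also have "\<dots> \<le> ((1 - s * a) * card V) * clique_sum V h {..<s}"
    using Suc.prems assms(6) nn by (intro mult_right_mono) (auto intro!: mult_right_mono)
  also have "\<dots> \<le> clique_sum V h {..<Suc s}"
    using clique_sum_lower[OF V sym h01 dense assms(6,7), of s] Suc.prems by simp
  finally show ?case .
qed simp

section \<open>Stability\<close>

lemma weighted_average_le:
  fixes W F :: "'b \<Rightarrow> real"
  assumes "\<And>x. x \<in> A \<Longrightarrow> 0 \<le> W x" "0 < sum W A" "(\<Sum>x\<in>A. W x * F x) \<le> c * sum W A"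
  shows "\<exists>x\<in>A. F x \<le> c"
proof (rule ccontr)
  assume "\<not> ?thesis"
  then have gt: "c < F x" if "x \<in> A" for x using that by auto
  obtain y where y: "y \<in> A" "0 < W y"
    using assms(1,2) by (metis less_eq_real_def linorder_not_less sum_nonpos)
  have fin: "finite A"
    using assms(2) by (metis less_irrefl sum.infinite)
  have "(\<Sum>x\<in>A. W x * c) < (\<Sum>x\<in>A. W x * F x)"
  proof (rule sum_strict_mono_ex1[OF fin])
    show "\<forall>x\<in>A. W x * c \<le> W x * F x"
      using gt assms(1) by (simp add: less_imp_le mult_left_mono)
    show "\<exists>x\<in>A. W x * c < W x * F x"
      using y gt by (intro bexI[of _ y]) auto
  qed
  with assms(3) show False
    by (simp add: sum_distrib_left mult.commute)
qed

text \<open>Adjacent vertices \<open>u\<close> and \<open>v\<close> that both extend the clique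
  without \<open>x i\<close> form with it a clique on r + 1 indices. The vertex \<open>x i\<close>
  is then left unconstrained and costs the factor \<open>card V\<close>.\<close>

lemma sum_clique_double_extension:
  assumes "finite V" "i < r" and sym: "\<And>u v. h u v = h v u" and h01: "\<And>u v. h u v \<in> {0, 1}"
  shows "(\<Sum>x\<in>PiE {..<r} (\<lambda>_. V). clique_weight h {..<r} x *
     (\<Sum>u\<in>V. \<Sum>v\<in>V. (\<Prod>j\<in>{..<r} - {i}. h (x j) u) * (\<Prod>j\<in>{..<r} - {i}. h (x j) v) * h u v))
    \<le> card V * clique_sum V h {..<Suc r}"
proof -
  define J where "J = {..<r} - {i}"
  have I: "{..<r} = insert i J" and J: "finite J" "i \<notin> J"
    using assms(2) by (auto simp: J_def)
  have S: "{..<Suc r} = insert r (insert i J)" and rJ: "r \<notin> insert i J"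
    using assms(2) by (auto simp: J_def)
  have nn: "0 \<le> h u v" and le1: "h u v \<le> 1" for u v using h01[of u v] by auto
  define q where "q = (\<lambda>y u. \<Prod>j\<in>J. h (y j) u)"
  have q: "0 \<le> q y u" "q y u \<le> 1" for y u
    unfolding q_def using nn le1 by (auto intro: prod_nonneg prod_le_1)
  have qi: "q (y(i := w)) u = q y u" for y w u
    unfolding q_def using J(2) by (intro prod.cong) auto
  define Q where "Q = (\<lambda>y. \<Sum>u\<in>V. \<Sum>v\<in>V. q y u * q y v * h u v)"
  have Qi: "Q (y(i := w)) = Q y" for y w
    by (simp only: Q_def qi)
  have Q: "0 \<le> Q y" for y
    unfolding Q_def using q nn by (intro sum_nonneg mult_nonneg_nonneg)
  have "(\<Sum>x\<in>PiE {..<r} (\<lambda>_. V). clique_weight h {..<r} x * Q x)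
    = (\<Sum>y\<in>PiE J (\<lambda>_. V). \<Sum>w\<in>V. (clique_weight h J y * q y w) * Q y)"
    unfolding I sum_PiE_insert[OF J(2)] clique_weight_insert[OF J sym] Qi by (simp only: q_def)
  \<comment> \<open>The adjacency of \<open>w\<close>, the value at \<open>i\<close>, to the rest of
    the clique is dropped here.\<close>
  also have "\<dots> \<le> (\<Sum>y\<in>PiE J (\<lambda>_. V). \<Sum>w\<in>V. clique_weight h J y * Q y)"
    using Q q clique_weight_nonneg[of h J, OF nn]
    by (intro sum_mono mult_right_mono) (auto intro: mult_left_le)
  also have "\<dots> = card V * (\<Sum>y\<in>PiE J (\<lambda>_. V). clique_weight h J y * Q y)"
    by (simp add: sum_distrib_left)
  also have "(\<Sum>y\<in>PiE J (\<lambda>_. V). clique_weight h J y * Q y) = clique_sum V h {..<Suc r}"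
  proof -
    have "(\<Prod>j\<in>insert i J. h ((y(i := u)) j) v) = h u v * q y v" for y u v
      unfolding q_def by (subst prod.insert[OF J]) (use J in \<open>auto intro!: prod.cong arg_cong[where f = "\<lambda>t. h u v * t"]\<close>)
    then show ?thesis
      unfolding S clique_sum_insert[OF finite.insertI[OF J(1)] rJ sym] sum_PiE_insert[OF J(2)]
        clique_weight_insert[OF J sym] Q_def
      by (simp add: q_def sum_distrib_left mult_ac)
  qed
  finally show ?thesis
    by (simp only: Q_def q_def J_def)
qed

text \<open>Take a random clique \<open>x 0, \<dots>, x (k - 1)\<close> and label each vertex by the index of
  its (typically unique) non-neighbour in the clique; an edge inside a label class extends the
  remaining \<open>k - 1\<close> clique vertices to a larger clique.\<close>

lemma stability_labelling:
  fixes \<epsilon> \<tau> :: real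
  assumes V: "finite V" "V \<noteq> {}" and sym: "\<And>u v. h u v = h v u" and h01: "\<And>u v. h u v \<in> {0, 1}"
    and k: "2 \<le> k" and "0 \<le> \<epsilon>"
    and dense: "(1 - 1 / k - \<epsilon>) * (card V)\<^sup>2 \<le> (\<Sum>u\<in>V. \<Sum>v\<in>V. h u v)"
    and sparse: "clique_sum V h {..<Suc k} \<le> \<tau> * card V ^ Suc k"
    and \<mu>: "\<mu> = 1 / k - (real k - 1) * \<epsilon>" "0 < \<mu>"
  shows "\<exists>f. f ` V \<subseteq> {..<k} \<and>
    (\<Sum>u\<in>V. \<Sum>v\<in>V. of_bool (f u = f v) * h u v) \<le> (2 * k * (real k - 1) * \<epsilon> + 3 * k * \<tau> / \<mu> ^ k) * (card V)\<^sup>2"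
proof -
  obtain r where r: "k = Suc r" "0 < r" using k by (cases k) auto
  define n where "n = real (card V)"
  have n: "0 < n" using V by (simp add: n_def card_gt_0_iff)
  have nn: "0 \<le> h u v" and le1: "h u v \<le> 1" for u v using h01[of u v] by auto
  define T where "T = (\<lambda>s. clique_sum V h {..<s})"
  \<comment> \<open>The edge density is at least 1 - a, and with r = k - 1 the number 1 - r a is
    \<mu>, the factor that Moon--Moser guarantees in passing from \<open>T r\<close> to
    \<open>T k\<close>.\<close>
  define a where "a = 1 / k + \<epsilon>"
  have "1 - r * a = \<mu>"
    using \<mu>(1) r by (simp add: a_def field_simps)
  then have a: "0 \<le> a" "1 - a = 1 - 1 / k - \<epsilon>" "1 - r * a = \<mu>" "r * a < 1"
    using \<mu>(2) \<open>0 \<le> \<epsilon>\<close> by (auto simp: a_def)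
  have low: "(1 - r * a) * n * T r \<le> T k" "0 < T k"
    unfolding n_def T_def r(1) using clique_sum_lower[OF V sym h01 dense[folded a(2)] a(1,4), of r] by auto
  have Tr: "0 < T r"
  proof -
    obtain r' where "r = Suc r'" using r by (cases r) auto
    then show ?thesis
      unfolding T_def using clique_sum_lower[OF V sym h01 dense[folded a(2)] a(1,4), of r'] by auto
  qed
  have Tk: "(\<mu> * n) ^ k \<le> T k"
    unfolding T_def n_def a(3)[symmetric] by (rule clique_sum_lower_power[OF V sym h01 dense[folded a(2)] a(1,4)]) (simp add: r)
  have Tk1: "T (Suc k) \<le> \<tau> * n ^ Suc k" "0 \<le> T (Suc k)"
    using sparse by (auto simp: T_def n_def clique_sum_nonneg nn)
  \<comment> \<open>\<open>T (Suc k) / T k\<close> is the mean number of extensions of a random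
    k-clique.\<close>
  have ratio: "T (Suc k) / T k \<le> \<tau> / \<mu> ^ k * n"
  proof -
    have "T (Suc k) / T k \<le> T (Suc k) / (\<mu> * n) ^ k"
      using Tk Tk1 \<mu>(2) n low(2) by (intro divide_left_mono mult_pos_pos) auto
    also have "\<dots> \<le> (\<tau> * n ^ Suc k) / (\<mu> * n) ^ k"
      using Tk1 \<mu>(2) n by (intro divide_right_mono) auto
    also have "\<dots> = \<tau> / \<mu> ^ k * n"
      using \<mu>(2) n by (simp add: field_simps)
    finally show ?thesis .
  qed
  define I where "I = PiE {..<k} (\<lambda>_. V)"
  define W where "W = clique_weight h {..<k}"
  define bad where "bad = (\<lambda>x u. \<not> card {i. i < k \<and> h (x i) u = 0} \<le> 1)"
  define b where "b = (\<lambda>x. real (card {u\<in>V. bad x u}))"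
  define S where "S = (\<Sum>x\<in>I. W x * b x)"
  have W: "0 \<le> W x" for x unfolding W_def by (rule clique_weight_nonneg[OF nn])
  have WT: "sum W I = T k" by (simp add: W_def I_def T_def clique_sum_def)
  \<comment> \<open>Moon--Moser with its correction term bounds k times the square of
    \<open>T k\<close> from above, and \<open>low\<close> bounds it from below. Since k (1 - r a) =
    1 - k r \<epsilon>, the two bounds nearly meet and leave little room for
    \<open>S\<close>.\<close>
  have S_le: "S \<le> k * r * \<epsilon> * n * T k + r * T (Suc k)"
  proof -
    have "k * (T k)\<^sup>2 \<le> T r * (n * T k + r * T (Suc k) - S)"
      using moon_moser_strong[where V = V and h = h and r = r, OF V(1) sym h01]
      unfolding T_def S_def W_def b_def bad_def I_def n_def r(1) .
    moreover have "k * (T k * ((1 - r * a) * n * T r)) \<le> k * (T k)\<^sup>2"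
      unfolding power2_eq_square using low by (intro mult_left_mono) auto
    ultimately have "T r * (k * (1 - r * a) * n * T k) \<le> T r * (n * T k + r * T (Suc k) - S)"
      by (simp add: mult_ac)
    then have *: "k * (1 - r * a) * n * T k \<le> n * T k + r * T (Suc k) - S"
      using Tr by simp
    have "k * (1 - r * a) = 1 - k * r * \<epsilon>"
      using r unfolding a_def by (simp add: field_simps)
    from *[unfolded this] show ?thesis by (simp add: algebra_simps)
  qed
  define P where "P = (\<lambda>x i u. \<Prod>j\<in>{..<k} - {i}. h (x j) u)"
  have P: "0 \<le> P x i u" for x i u unfolding P_def using nn by (intro prod_nonneg) auto
  \<comment> \<open>The default 0 concerns vertices adjacent to the whole clique, for which any
    label would do since all \<open>P x i u\<close> equal 1. For a vertex with one non-neighbour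
    \<open>LEAST\<close> has no choice; it decides only for bad vertices, which are counted
    separately.\<close>
  define lab where "lab = (\<lambda>x u. if \<exists>i<k. h (x i) u = 0 then LEAST i. i < k \<and> h (x i) u = 0 else 0)"
  have lab_less: "lab x u < k" for x u
    unfolding lab_def using r by (auto intro: LeastI2)
  have P_lab: "P x (lab x u) u = 1" if "\<not> bad x u" for x u
  proof -
    have "h (x j) u = 1" if "j < k" "j \<noteq> lab x u" for j
    proof (rule ccontr)
      assume "h (x j) u \<noteq> 1"
      then have j: "j < k \<and> h (x j) u = 0" using h01[of "x j" u] \<open>j < k\<close> by auto
      then have l: "lab x u < k \<and> h (x (lab x u)) u = 0"
        unfolding lab_def by (auto intro: LeastI2)
      have "card {j, lab x u} \<le> card {i. i < k \<and> h (x i) u = 0}"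
        using j l by (intro card_mono) auto
      with that(2) \<open>\<not> bad x u\<close> show False by (simp add: bad_def)
    qed
    then show ?thesis unfolding P_def by (intro prod.neutral) auto
  qed
  define inside where "inside = (\<lambda>x. \<Sum>u\<in>V. \<Sum>v\<in>V. of_bool (lab x u = lab x v) * h u v)"
  define Q where "Q = (\<lambda>x i. \<Sum>u\<in>V. \<Sum>v\<in>V. P x i u * P x i v * h u v)"
  have inside_le: "inside x \<le> 2 * n * b x + (\<Sum>i<k. Q x i)" for x
  proof -
    \<comment> \<open>An edge within a label class either has a bad end or is counted by the summand
      for the common label.\<close>
    have "of_bool (lab x u = lab x v) * h u v
      \<le> of_bool (bad x u) + of_bool (bad x v) + (\<Sum>i<k. P x i u * P x i v * h u v)" for u v
    proof (cases "bad x u \<or> bad x v \<or> lab x u \<noteq> lab x v")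
      case True
      moreover have "0 \<le> (\<Sum>i<k. P x i u * P x i v * h u v)"
        by (intro sum_nonneg mult_nonneg_nonneg P nn)
      ultimately show ?thesis using le1[of u v] nn[of u v] by (auto simp: of_bool_def)
    next
      case False
      then have "h u v = P x (lab x u) u * P x (lab x u) v * h u v"
        using P_lab[of x u] P_lab[of x v] by simp
      also have "\<dots> \<le> (\<Sum>i<k. P x i u * P x i v * h u v)"
        using lab_less by (intro member_le_sum) (auto intro!: mult_nonneg_nonneg P nn)
      finally show ?thesis using False by simp
    qed
    then have "inside x \<le> (\<Sum>u\<in>V. \<Sum>v\<in>V. of_bool (bad x u) + of_bool (bad x v) + (\<Sum>i<k. P x i u * P x i v * h u v))"
      unfolding inside_def by (intro sum_mono)
    also have "\<dots> = (\<Sum>u\<in>V. \<Sum>v\<in>V. of_bool (bad x u)) + (\<Sum>u\<in>V. \<Sum>v\<in>V. of_bool (bad x v))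
       + (\<Sum>u\<in>V. \<Sum>v\<in>V. \<Sum>i<k. P x i u * P x i v * h u v)"
      by (simp only: sum.distrib)
    also have "(\<Sum>u\<in>V. \<Sum>v\<in>V. of_bool (bad x u)) = n * b x"
      using V by (simp add: n_def b_def sum_distrib_left[symmetric] Int_def)
    also have "(\<Sum>u\<in>V. \<Sum>v\<in>V. of_bool (bad x v)) = n * b x"
      using V by (simp add: n_def b_def Int_def)
    also have "(\<Sum>u\<in>V. \<Sum>v\<in>V. \<Sum>i<k. P x i u * P x i v * h u v) = (\<Sum>i<k. Q x i)"
    proof -
      have "(\<Sum>u\<in>V. \<Sum>v\<in>V. \<Sum>i<k. P x i u * P x i v * h u v) = (\<Sum>u\<in>V. \<Sum>i<k. \<Sum>v\<in>V. P x i u * P x i v * h u v)"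
        by (intro sum.cong refl sum.swap)
      also have "\<dots> = (\<Sum>i<k. Q x i)"
        unfolding Q_def by (rule sum.swap)
      finally show ?thesis .
    qed
    finally show ?thesis by simp
  qed
  have "(\<Sum>x\<in>I. W x * inside x) \<le> (\<Sum>x\<in>I. W x * (2 * n * b x + (\<Sum>i<k. Q x i)))"
    by (intro sum_mono mult_left_mono inside_le W)
  also have "\<dots> = 2 * n * S + (\<Sum>x\<in>I. \<Sum>i<k. W x * Q x i)"
    unfolding S_def by (simp add: distrib_left sum.distrib sum_distrib_left mult_ac)
  also have "(\<Sum>x\<in>I. \<Sum>i<k. W x * Q x i) = (\<Sum>i<k. \<Sum>x\<in>I. W x * Q x i)"
    by (rule sum.swap)
  also have "\<dots> \<le> (\<Sum>i<k. n * T (Suc k))"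
    unfolding n_def T_def W_def Q_def P_def I_def
    by (intro sum_mono sum_clique_double_extension V sym h01) simp
  also have "\<dots> = k * n * T (Suc k)" by simp
  also have "2 * n * S \<le> 2 * n * (k * r * \<epsilon> * n * T k + r * T (Suc k))"
    using S_le n by simp
  finally have "(\<Sum>x\<in>I. W x * inside x) \<le> 2 * n * (k * r * \<epsilon> * n * T k + r * T (Suc k)) + k * n * T (Suc k)"
    by simp
  also have "\<dots> = (2 * k * r * \<epsilon> * n\<^sup>2 + (2 * r + k) * n * (T (Suc k) / T k)) * T k"
    using low(2) by (simp add: field_simps power2_eq_square)
  \<comment> \<open>The coefficient 2 r stems from bad vertices at either end of a pair and k from
    the choice of the label; with r = k - 1 they add up to at most 3 k.\<close>
  also have "\<dots> \<le> (2 * k * r * \<epsilon> * n\<^sup>2 + (3 * k) * n * (\<tau> / \<mu> ^ k * n)) * T k"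
  proof -
    have "(2 * r + k) * n * (T (Suc k) / T k) \<le> (3 * k) * n * (T (Suc k) / T k)"
      using Tk1 low(2) n r by (intro mult_right_mono) auto
    also have "\<dots> \<le> (3 * k) * n * (\<tau> / \<mu> ^ k * n)"
      using n ratio by (intro mult_left_mono) auto
    finally show ?thesis using low(2) by (intro mult_right_mono) auto
  qed
  finally have "(\<Sum>x\<in>I. W x * inside x) \<le> ((2 * k * (real k - 1) * \<epsilon> + 3 * k * \<tau> / \<mu> ^ k) * n\<^sup>2) * sum W I"
    unfolding WT using r by (simp add: algebra_simps add_divide_distrib power2_eq_square)
  then obtain x where "inside x \<le> (2 * k * (real k - 1) * \<epsilon> + 3 * k * \<tau> / \<mu> ^ k) * n\<^sup>2"
    using weighted_average_le[where W = W and A = I and F = inside] W low(2)[folded WT] by metis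
  then show ?thesis
    using lab_less by (intro exI[of _ "lab x"]) (auto simp: inside_def n_def)
qed

section \<open>Weak regularity\<close>

text \<open>Conditional expectation in the first variable only, for the partition into fibres of
  \<phi>. The second variable is left alone so that, for a 0/1 relation, the value is the density
  between the vertex \<open>u\<close> and the class of \<open>x\<close>, which is what the packing
  argument bounds.\<close>

definition class_avg :: "'a set \<Rightarrow> ('a \<Rightarrow> nat) \<Rightarrow> ('a \<Rightarrow> 'b \<Rightarrow> real) \<Rightarrow> 'a \<Rightarrow> 'b \<Rightarrow> real" where
  "class_avg V \<phi> R x u = (\<Sum>y\<in>{y\<in>V. \<phi> y = \<phi> x}. R y u) / card {y\<in>V. \<phi> y = \<phi> x}"

lemma class_avg_cong: "\<phi> x = \<phi> y \<Longrightarrow> class_avg V \<phi> R x u = class_avg V \<phi> R y u"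
  by (simp add: class_avg_def)

text \<open>Both sides are sums over pairs \<open>x\<close>, \<open>y\<close> in a common class,
  divided by the class size; a weight that is constant on classes may be moved from \<open>x\<close>
  to \<open>y\<close>.\<close>

lemma sum_class_avg:
  assumes "finite V" and c: "\<And>x y. \<phi> x = \<phi> y \<Longrightarrow> c x = c y"
  shows "(\<Sum>x\<in>V. c x * class_avg V \<phi> R x u) = (\<Sum>x\<in>V. c x * R x u)"
proof -
  let ?C = "\<lambda>x. {y\<in>V. \<phi> y = \<phi> x}"
  have "(\<Sum>x\<in>V. c x * class_avg V \<phi> R x u)
    = (\<Sum>x\<in>V. \<Sum>y\<in>?C x. c y * R y u / card (?C y))"
  proof (intro sum.cong refl)
    fix x
    have "c x * class_avg V \<phi> R x u = (\<Sum>y\<in>?C x. c x * R y u / card (?C x))"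
      by (simp add: class_avg_def sum_distrib_left sum_divide_distrib)
    also have "\<dots> = (\<Sum>y\<in>?C x. c y * R y u / card (?C y))"
    proof (intro sum.cong refl)
      fix y assume y: "y \<in> ?C x"
      then have "c y = c x" using c[of y x] by simp
      with y show "c x * R y u / card (?C x) = c y * R y u / card (?C y)" by simp
    qed
    finally show "c x * class_avg V \<phi> R x u = (\<Sum>y\<in>?C x. c y * R y u / card (?C y))" .
  qed
  also have "\<dots> = (\<Sum>x\<in>V. \<Sum>y\<in>V. if \<phi> y = \<phi> x then c y * R y u / card (?C y) else 0)"
    by (intro sum.cong refl sum.inter_filter assms(1))
  also have "\<dots> = (\<Sum>y\<in>V. \<Sum>x\<in>V. if \<phi> y = \<phi> x then c y * R y u / card (?C y) else 0)"
    by (rule sum.swap)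
  also have "\<dots> = (\<Sum>y\<in>V. \<Sum>x\<in>?C y. c y * R y u / card (?C y))"
  proof (rule sum.cong[OF refl])
    fix y
    show "(\<Sum>x\<in>V. if \<phi> y = \<phi> x then c y * R y u / card (?C y) else 0) = (\<Sum>x\<in>?C y. c y * R y u / card (?C y))"
      unfolding eq_commute[of "\<phi> y"] by (rule sum.inter_filter[OF assms(1), symmetric])
  qed
  also have "\<dots> = (\<Sum>y\<in>V. c y * R y u)"
  proof (intro sum.cong refl)
    fix y assume "y \<in> V"
    then have "card (?C y) \<noteq> 0" using assms(1) by auto
    then show "(\<Sum>x\<in>?C y. c y * R y u / card (?C y)) = c y * R y u"
      by simp
  qed
  finally show ?thesis .
qed

lemma class_avg_bounds:
  assumes "\<And>x u. 0 \<le> R x u" "\<And>x u. R x u \<le> 1"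
  shows "0 \<le> class_avg V \<phi> R x u" "class_avg V \<phi> R x u \<le> 1"
proof -
  show "0 \<le> class_avg V \<phi> R x u"
    unfolding class_avg_def by (intro divide_nonneg_nonneg sum_nonneg assms) simp
  have "(\<Sum>y\<in>{y\<in>V. \<phi> y = \<phi> x}. R y u) \<le> (\<Sum>y\<in>{y\<in>V. \<phi> y = \<phi> x}. 1)"
    by (intro sum_mono assms)
  then show "class_avg V \<phi> R x u \<le> 1"
    unfolding class_avg_def by (intro divide_le_eq_1[THEN iffD2]) (auto simp: neq_iff)
qed

text \<open>Test functions with values in [0,1] take the place of vertex sets because clique
  counting produces products of edge weights as test functions.\<close>

definition cut_close :: "'a set \<Rightarrow> real \<Rightarrow> ('a \<Rightarrow> 'a \<Rightarrow> real) \<Rightarrow> ('a \<Rightarrow> 'a \<Rightarrow> real) \<Rightarrow> bool" where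
  "cut_close V \<epsilon> R D \<longleftrightarrow> (\<forall>f g. (\<forall>x. 0 \<le> f x \<and> f x \<le> 1) \<longrightarrow> (\<forall>x. 0 \<le> g x \<and> g x \<le> 1) \<longrightarrow>
     \<bar>\<Sum>x\<in>V. \<Sum>u\<in>V. (R x u - D x u) * f x * g u\<bar> \<le> \<epsilon> * (card V)\<^sup>2)"

definition energy :: "'a set \<Rightarrow> ('a \<Rightarrow> 'a \<Rightarrow> real) \<Rightarrow> real" where
  "energy V D = (\<Sum>x\<in>V. \<Sum>u\<in>V. (D x u)\<^sup>2)"

text \<open>By linearity in \<open>f\<close>, a witness of failure can be sharpened to a set
  \<open>F\<close> in the first variable; \<open>g\<close> may stay fractional, as the second
  variable is never averaged. Splitting along \<open>F\<close> at most doubles the number of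
  classes. By Pythagoras the energy gain is the squared distance of the two averages, and
  Cauchy--Schwarz bounds that distance from below by testing against \<open>F\<close> and
  \<open>g\<close>.\<close>

lemma energy_increment:
  assumes V: "finite V" and R: "\<And>x u. 0 \<le> R x u" "\<And>x u. R x u \<le> 1"
    and far: "\<not> cut_close V \<epsilon> R (class_avg V \<phi> R)" and "0 \<le> \<epsilon>"
  shows "\<exists>F. energy V (class_avg V \<phi> R) + \<epsilon>\<^sup>2 * (card V)\<^sup>2
     \<le> energy V (class_avg V (\<lambda>x. 2 * \<phi> x + of_bool (x \<in> F)) R)"
proof -
  define n where "n = real (card V)"
  let ?D = "class_avg V \<phi> R"
  obtain f g :: "'a \<Rightarrow> real" where fg: "\<forall>x. 0 \<le> f x \<and> f x \<le> 1" "\<forall>x. 0 \<le> g x \<and> g x \<le> 1"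
    and gt: "\<epsilon> * n\<^sup>2 < \<bar>\<Sum>x\<in>V. \<Sum>u\<in>V. (R x u - ?D x u) * f x * g u\<bar>"
    using far unfolding cut_close_def n_def not_all not_imp not_le of_nat_power by blast
  then have f: "0 \<le> f x" "f x \<le> 1" and g: "0 \<le> g x" "g x \<le> 1" for x by auto
  have "n > 0"
  proof (rule ccontr)
    assume "\<not> n > 0"
    then have "V = {}" using V by (simp add: n_def card_gt_0_iff)
    then show False using gt by (simp add: n_def)
  qed
  define s :: real where "s = (if (\<Sum>x\<in>V. \<Sum>u\<in>V. (R x u - ?D x u) * f x * g u) \<ge> 0 then 1 else -1)"
  have s: "s * s = 1" "\<bar>s\<bar> = 1" by (auto simp: s_def)
  define A where "A = (\<lambda>x. s * (\<Sum>u\<in>V. (R x u - ?D x u) * g u))"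
  define F where "F = {x. A x \<ge> 0}"
  have gt': "\<epsilon> * n\<^sup>2 < (\<Sum>x\<in>V. of_bool (x \<in> F) * A x)"
  proof -
    have "\<epsilon> * n\<^sup>2 < s * (\<Sum>x\<in>V. \<Sum>u\<in>V. (R x u - ?D x u) * f x * g u)"
      using gt by (auto simp: s_def split: if_splits)
    also have "\<dots> = (\<Sum>x\<in>V. f x * A x)"
      by (simp add: A_def sum_distrib_left mult_ac)
    also have "\<dots> \<le> (\<Sum>x\<in>V. of_bool (x \<in> F) * A x)"
    proof (rule sum_mono)
      fix x
      show "f x * A x \<le> of_bool (x \<in> F) * A x"
        using f[of x] mult_right_mono[of "f x" 1 "A x"] mult_nonneg_nonpos[of "f x" "A x"]
        by (auto simp: F_def)
    qed
    finally show ?thesis .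
  qed
  define \<psi> where "\<psi> = (\<lambda>x. 2 * \<phi> x + of_bool (x \<in> F))"
  let ?D' = "class_avg V \<psi> R"
  have \<psi>: "\<phi> x = \<phi> y \<and> (x \<in> F \<longleftrightarrow> y \<in> F)" if "\<psi> x = \<psi> y" for x y
  proof -
    have "\<phi> x = \<phi> y" using arg_cong[OF that, of "\<lambda>t. t div 2"] by (simp add: \<psi>_def)
    then show ?thesis using that by (auto simp: \<psi>_def of_bool_def split: if_splits)
  qed
  \<comment> \<open>\<open>F\<close> is a union of classes of \<psi>, so summed over
    \<open>F\<close> the function \<open>R\<close> may be replaced by its finer average.\<close>
  have sum_eq: "(\<Sum>x\<in>V. of_bool (x \<in> F) * A x) = (\<Sum>x\<in>V. \<Sum>u\<in>V. (?D' x u - ?D x u) * (s * of_bool (x \<in> F) * g u))"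
  proof -
    have 1: "(\<Sum>x\<in>V. of_bool (x \<in> F) * ?D' x u) = (\<Sum>x\<in>V. of_bool (x \<in> F) * R x u)" for u
      by (rule sum_class_avg[OF V]) (drule \<psi>, simp)
    have "(\<Sum>x\<in>V. of_bool (x \<in> F) * A x)
      = (\<Sum>x\<in>V. \<Sum>u\<in>V. (of_bool (x \<in> F) * R x u) * (s * g u) - ?D x u * (s * of_bool (x \<in> F) * g u))"
      by (simp add: A_def sum_distrib_left algebra_simps)
    also have "\<dots> = (\<Sum>u\<in>V. (\<Sum>x\<in>V. of_bool (x \<in> F) * R x u) * (s * g u)) - (\<Sum>x\<in>V. \<Sum>u\<in>V. ?D x u * (s * of_bool (x \<in> F) * g u))"
      by (simp only: sum_subtractf sum_distrib_right) (subst sum.swap, rule refl)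
    also have "\<dots> = (\<Sum>x\<in>V. \<Sum>u\<in>V. (of_bool (x \<in> F) * ?D' x u) * (s * g u) - ?D x u * (s * of_bool (x \<in> F) * g u))"
      unfolding 1[symmetric] by (simp only: sum_subtractf sum_distrib_right) (subst sum.swap, rule refl)
    finally show ?thesis by (simp add: algebra_simps)
  qed
  \<comment> \<open>The difference of the finer and the coarser average is orthogonal to the coarser
    one.\<close>
  have orth: "(\<Sum>x\<in>V. ?D x u * ?D' x u) = (\<Sum>x\<in>V. ?D x u * ?D x u)" for u
  proof -
    have "(\<Sum>x\<in>V. ?D x u * ?D' x u) = (\<Sum>x\<in>V. ?D x u * R x u)"
      by (rule sum_class_avg[OF V]) (use \<psi> in \<open>blast intro: class_avg_cong\<close>)
    also have "\<dots> = (\<Sum>x\<in>V. ?D x u * ?D x u)"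
      by (rule sum_class_avg[OF V, symmetric]) (blast intro: class_avg_cong)
    finally show ?thesis .
  qed
  define d where "d = (\<lambda>p. ?D' (fst p) (snd p) - ?D (fst p) (snd p))"
  have pyth: "(\<Sum>p\<in>V\<times>V. (d p)\<^sup>2) = energy V ?D' - energy V ?D"
  proof -
    have "(\<Sum>p\<in>V\<times>V. (d p)\<^sup>2) = (\<Sum>x\<in>V. \<Sum>u\<in>V. (?D' x u - ?D x u)\<^sup>2)"
      by (simp add: d_def sum.cartesian_product split_def)
    also have "\<dots> = (\<Sum>u\<in>V. \<Sum>x\<in>V. (?D' x u - ?D x u)\<^sup>2)" by (rule sum.swap)
    also have "\<dots> = (\<Sum>u\<in>V. (\<Sum>x\<in>V. (?D' x u)\<^sup>2) - (\<Sum>x\<in>V. (?D x u)\<^sup>2))"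
    proof (rule sum.cong[OF refl])
      fix u
      have "(\<Sum>x\<in>V. (?D' x u - ?D x u)\<^sup>2) = (\<Sum>x\<in>V. (?D' x u)\<^sup>2 + ?D x u * ?D x u - 2 * (?D x u * ?D' x u))"
        by (intro sum.cong refl) (simp add: power2_eq_square algebra_simps)
      also have "\<dots> = (\<Sum>x\<in>V. (?D' x u)\<^sup>2) + (\<Sum>x\<in>V. ?D x u * ?D x u) - 2 * (\<Sum>x\<in>V. ?D x u * ?D' x u)"
        by (simp only: sum.distrib sum_subtractf sum_distrib_left)
      finally show "(\<Sum>x\<in>V. (?D' x u - ?D x u)\<^sup>2) = (\<Sum>x\<in>V. (?D' x u)\<^sup>2) - (\<Sum>x\<in>V. (?D x u)\<^sup>2)"
        unfolding orth by (simp add: power2_eq_square)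
    qed
    also have "\<dots> = energy V ?D' - energy V ?D"
      unfolding energy_def sum_subtractf by (subst (1 2) sum.swap) (rule refl)
    finally show ?thesis .
  qed
  define b where "b = (\<lambda>p. s * of_bool (fst p \<in> F) * g (snd p))"
  have "(\<Sum>p\<in>V\<times>V. (b p)\<^sup>2) \<le> (\<Sum>p\<in>V\<times>V. 1)"
  proof (rule sum_mono)
    fix p
    have "\<bar>b p\<bar> \<le> 1" using s(2) g[of "snd p"] by (simp add: b_def abs_mult)
    then show "(b p)\<^sup>2 \<le> 1" by (simp add: abs_square_le_1)
  qed
  then have b: "(\<Sum>p\<in>V\<times>V. (b p)\<^sup>2) \<le> n\<^sup>2"
    by (simp add: n_def power2_eq_square card_cartesian_product)
  have "(\<epsilon> * n\<^sup>2)\<^sup>2 \<le> (\<Sum>p\<in>V\<times>V. d p * b p)\<^sup>2"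
    using gt' \<open>0 \<le> \<epsilon>\<close> unfolding sum_eq
    by (intro power_mono) (auto simp: d_def b_def sum.cartesian_product split_def)
  also have "\<dots> \<le> (\<Sum>p\<in>V\<times>V. (d p)\<^sup>2) * (\<Sum>p\<in>V\<times>V. (b p)\<^sup>2)"
    by (rule Cauchy_Schwarz_ineq_sum)
  also have "\<dots> \<le> (\<Sum>p\<in>V\<times>V. (d p)\<^sup>2) * n\<^sup>2"
    using b by (intro mult_left_mono sum_nonneg) auto
  finally have "n\<^sup>2 * (\<epsilon>\<^sup>2 * n\<^sup>2) \<le> n\<^sup>2 * (energy V ?D' - energy V ?D)"
    unfolding pyth by (simp add: power2_eq_square mult_ac)
  then have "\<epsilon>\<^sup>2 * n\<^sup>2 \<le> energy V ?D' - energy V ?D"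
    using \<open>n > 0\<close> by simp
  then show ?thesis
    unfolding \<psi>_def n_def by (intro exI[of _ F]) simp
qed

text \<open>The energy never exceeds n^2 for n = \<open>card V\<close>, and each failure of
  closeness raises it by \<epsilon>^2 n^2. Hence t > 1/\<epsilon>^2 refinements are impossible; each
  doubles the range of labels, which gives m = 2^t.\<close>

lemma weak_regularity:
  fixes \<epsilon> :: real
  assumes "0 < \<epsilon>"
  shows "\<exists>m::nat. \<forall>(V :: 'a set) R. finite V \<longrightarrow> (\<forall>x u. 0 \<le> R x u \<and> R x u \<le> 1) \<longrightarrow>
    (\<exists>\<phi>. \<phi> ` V \<subseteq> {..<m} \<and> cut_close V \<epsilon> R (class_avg V \<phi> R))"
proof -
  obtain t :: nat where t: "1 / \<epsilon>\<^sup>2 < t" using reals_Archimedean2 by blast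
  have "\<exists>\<phi>. \<phi> ` V \<subseteq> {..<2 ^ t} \<and> cut_close V \<epsilon> R (class_avg V \<phi> R)"
    if V: "finite V" and R: "\<forall>x u. 0 \<le> R x u \<and> R x u \<le> 1" for V :: "'a set" and R
  proof (cases "V = {}")
    case True
    then show ?thesis by (intro exI[of _ "\<lambda>_. 0"]) (simp add: cut_close_def)
  next
    case False
    then have n: "0 < real (card V)" using V by (simp add: card_gt_0_iff)
    have R': "0 \<le> R x u" "R x u \<le> 1" for x u using R by auto
    show ?thesis
    proof (rule ccontr)
      assume none: "\<not> ?thesis"
      have "\<exists>\<phi>. \<phi> ` V \<subseteq> {..<2 ^ s} \<and> s * (\<epsilon>\<^sup>2 * (card V)\<^sup>2) \<le> energy V (class_avg V \<phi> R)" if "s \<le> t" for s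
        using that
      proof (induction s)
        case 0
        show ?case by (intro exI[of _ "\<lambda>_. 0"]) (auto simp: energy_def intro!: sum_nonneg)
      next
        case (Suc s)
        then obtain \<phi> where \<phi>: "\<phi> ` V \<subseteq> {..<2 ^ s}" "s * (\<epsilon>\<^sup>2 * (card V)\<^sup>2) \<le> energy V (class_avg V \<phi> R)"
          by auto
        have "(2::nat) ^ s \<le> 2 ^ t" using Suc.prems by (intro power_increasing) auto
        then have "{..<2 ^ s} \<subseteq> {..<2 ^ t :: nat}" by simp
        then have "\<phi> ` V \<subseteq> {..<2 ^ t}" using \<phi>(1) by (rule subset_trans[rotated])
        then have far: "\<not> cut_close V \<epsilon> R (class_avg V \<phi> R)"
          using none by blast
        then obtain F where F: "energy V (class_avg V \<phi> R) + \<epsilon>\<^sup>2 * (card V)\<^sup>2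
            \<le> energy V (class_avg V (\<lambda>x. 2 * \<phi> x + of_bool (x \<in> F)) R)"
          using energy_increment[OF V R'(1) R'(2) far less_imp_le[OF assms]] by blast
        show ?case
        proof (intro exI[of _ "\<lambda>x. 2 * \<phi> x + of_bool (x \<in> F)"] conjI)
          show "(\<lambda>x. 2 * \<phi> x + of_bool (x \<in> F)) ` V \<subseteq> {..<2 ^ Suc s}"
            using \<phi>(1) by (force simp: of_bool_def)
          show "Suc s * (\<epsilon>\<^sup>2 * (card V)\<^sup>2) \<le> energy V (class_avg V (\<lambda>x. 2 * \<phi> x + of_bool (x \<in> F)) R)"
            using F \<phi>(2) by (simp add: algebra_simps)
        qed
      qed
      then obtain \<phi> where "t * (\<epsilon>\<^sup>2 * (card V)\<^sup>2) \<le> energy V (class_avg V \<phi> R)" by blast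
      also have "\<dots> \<le> (\<Sum>x\<in>V. \<Sum>u\<in>V. 1)"
        unfolding energy_def by (intro sum_mono power_le_one class_avg_bounds R')
      also have "\<dots> = (card V)\<^sup>2" by (simp add: power2_eq_square)
      finally have "(t * \<epsilon>\<^sup>2) * real ((card V)\<^sup>2) \<le> 1 * real ((card V)\<^sup>2)" by (simp add: mult_ac)
      then have "t * \<epsilon>\<^sup>2 \<le> 1"
        by (rule mult_right_le_imp_le) (use n in simp)
      with t assms show False by (simp add: field_simps)
    qed
  qed
  then show ?thesis by blast
qed

section \<open>Counting cliques\<close>

text \<open>Each pair of indices carries its own weight function, so that \<open>R\<close> can be
  exchanged for \<open>D\<close> one edge of the clique at a time.\<close>

definition pair_sum :: "'a set \<Rightarrow> (nat \<times> nat \<Rightarrow> 'a \<Rightarrow> 'a \<Rightarrow> real) \<Rightarrow> nat set \<Rightarrow> real" where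
  "pair_sum V H I = (\<Sum>x\<in>PiE I (\<lambda>_. V). \<Prod>p\<in>pairs I. H p (x (fst p)) (x (snd p)))"

text \<open>Fix the vertices at all indices except the two in \<open>p0\<close>. No other pair
  involves both of these, so the remaining factors split into a function of one vertex and a
  function of the other, and these serve as the test functions in \<open>cut_close\<close>.\<close>

lemma pair_sum_replace_one:
  assumes "finite V" "finite I" and p0: "p0 \<in> pairs I"
    and H: "\<And>p u v. 0 \<le> H p u v" "\<And>p u v. H p u v \<le> 1"
    and close: "cut_close V \<epsilon> R D"
  shows "\<bar>pair_sum V (H(p0 := R)) I - pair_sum V (H(p0 := D)) I\<bar> \<le> \<epsilon> * card V ^ card I"
proof -
  obtain a b where ab: "p0 = (a, b)" "a \<in> I" "b \<in> I" "a < b"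
    using p0 by (auto simp: pairs_def)
  define K where "K = I - {a, b}"
  have I: "I = insert a (insert b K)" and aK: "a \<notin> insert b K" and bK: "b \<notin> K" and K: "finite K"
    using ab \<open>finite I\<close> by (auto simp: K_def)
  define A where "A = {p \<in> pairs I - {p0}. fst p = a \<or> snd p = a}"
  define B where "B = {p \<in> pairs I - {p0}. fst p \<noteq> a \<and> snd p \<noteq> a}"
  have fin: "finite A" "finite B" "finite (pairs I)"
    using \<open>finite I\<close> by (auto simp: A_def B_def)
  define f where "f = (\<lambda>z v. \<Prod>p\<in>A. H p ((z(a := v)) (fst p)) ((z(a := v)) (snd p)))"
  define g where "g = (\<lambda>z u. \<Prod>p\<in>B. H p ((z(b := u)) (fst p)) ((z(b := u)) (snd p)))"
  have f: "0 \<le> f z v \<and> f z v \<le> 1" and g: "0 \<le> g z v \<and> g z v \<le> 1" for z v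
    unfolding f_def g_def using H by (auto intro!: prod_nonneg prod_le_1)
  have split: "(\<Prod>p\<in>pairs I. (H(p0 := M)) p ((z(b := u, a := v)) (fst p)) ((z(b := u, a := v)) (snd p)))
      = M v u * f z v * g z u" for M z u v
  proof -
    let ?t = "\<lambda>p. (H(p0 := M)) p ((z(b := u, a := v)) (fst p)) ((z(b := u, a := v)) (snd p))"
    have "prod ?t (pairs I) = ?t p0 * prod ?t (pairs I - {p0})"
      using fin(3) p0 by (rule prod.remove)
    also have "pairs I - {p0} = A \<union> B" by (auto simp: A_def B_def)
    also have "prod ?t (A \<union> B) = prod ?t A * prod ?t B"
      using fin by (intro prod.union_disjoint) (auto simp: A_def B_def)
    also have "prod ?t A = f z v"
      unfolding f_def by (intro prod.cong) (use ab(1,4) in \<open>auto simp: A_def pairs_def\<close>)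
    also have "prod ?t B = g z u"
      unfolding g_def by (intro prod.cong) (auto simp: B_def)
    also have "?t p0 = M v u" using ab by simp
    finally show ?thesis by (simp only: mult.assoc)
  qed
  have expand: "pair_sum V (H(p0 := M)) I = (\<Sum>z\<in>PiE K (\<lambda>_. V). \<Sum>v\<in>V. \<Sum>u\<in>V. M v u * f z v * g z u)" for M
  proof -
    have "pair_sum V (H(p0 := M)) I = (\<Sum>z\<in>PiE K (\<lambda>_. V). \<Sum>u\<in>V. \<Sum>v\<in>V.
       (\<Prod>p\<in>pairs I. (H(p0 := M)) p ((z(b := u, a := v)) (fst p)) ((z(b := u, a := v)) (snd p))))"
      unfolding pair_sum_def by (subst (1) I) (simp only: sum_PiE_insert[OF aK] sum_PiE_insert[OF bK])
    also have "\<dots> = (\<Sum>z\<in>PiE K (\<lambda>_. V). \<Sum>u\<in>V. \<Sum>v\<in>V. M v u * f z v * g z u)"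
      by (simp only: split)
    also have "\<dots> = (\<Sum>z\<in>PiE K (\<lambda>_. V). \<Sum>v\<in>V. \<Sum>u\<in>V. M v u * f z v * g z u)"
      by (intro sum.cong refl sum.swap)
    finally show ?thesis .
  qed
  have "pair_sum V (H(p0 := R)) I - pair_sum V (H(p0 := D)) I
    = (\<Sum>z\<in>PiE K (\<lambda>_. V). \<Sum>v\<in>V. \<Sum>u\<in>V. (R v u - D v u) * f z v * g z u)"
    unfolding expand by (simp add: sum_subtractf left_diff_distrib)
  also have "\<bar>\<dots>\<bar> \<le> (\<Sum>z\<in>PiE K (\<lambda>_. V). \<epsilon> * (card V)\<^sup>2)"
  proof (rule order_trans[OF sum_abs sum_mono])
    fix z
    show "\<bar>\<Sum>v\<in>V. \<Sum>u\<in>V. (R v u - D v u) * f z v * g z u\<bar> \<le> \<epsilon> * (card V)\<^sup>2"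
      using close f[of z] g[of z] unfolding cut_close_def by blast
  qed
  also have "\<dots> = \<epsilon> * card V ^ card I"
  proof -
    have "card I = card K + 2" using aK bK K by (simp add: I)
    then show ?thesis using K by (simp add: card_PiE power_add power2_eq_square)
  qed
  finally show ?thesis .
qed

lemma pair_sum_replace:
  fixes \<epsilon> :: real
  assumes "finite V" "finite I" and "F \<subseteq> pairs I"
    and R: "\<And>u v. 0 \<le> R u v" "\<And>u v. R u v \<le> 1" and D: "\<And>u v. 0 \<le> D u v" "\<And>u v. D u v \<le> 1"
    and close: "cut_close V \<epsilon> R D"
  shows "\<bar>pair_sum V (\<lambda>p. R) I - pair_sum V (\<lambda>p. if p \<in> F then D else R) I\<bar> \<le> card F * (\<epsilon> * card V ^ card I)"
proof -
  have "finite F" using assms(2,3) finite_pairs finite_subset by blast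
  then show ?thesis
    using \<open>F \<subseteq> pairs I\<close>
  proof (induction F)
    case empty
    then show ?case by simp
  next
    case (insert p F)
    let ?H = "\<lambda>F p. if p \<in> F then D else R"
    have 1: "(?H F)(p := R) = ?H F" "(?H F)(p := D) = ?H (insert p F)"
      using insert.hyps by auto
    have "\<bar>pair_sum V ((?H F)(p := R)) I - pair_sum V ((?H F)(p := D)) I\<bar> \<le> \<epsilon> * card V ^ card I"
      using insert.prems R D by (intro pair_sum_replace_one assms(1,2) close) auto
    then have "\<bar>pair_sum V (?H F) I - pair_sum V (?H (insert p F)) I\<bar> \<le> \<epsilon> * card V ^ card I"
      unfolding 1 .
    moreover have "\<bar>pair_sum V (\<lambda>p. R) I - pair_sum V (?H F) I\<bar> \<le> card F * (\<epsilon> * card V ^ card I)"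
      using insert by simp
    moreover have "card (insert p F) * (\<epsilon> * card V ^ card I) = card F * (\<epsilon> * card V ^ card I) + \<epsilon> * card V ^ card I"
      using insert.hyps by (simp add: algebra_simps)
    ultimately show ?case by linarith
  qed
qed

lemma clique_sum_cut_close:
  fixes \<epsilon> :: real
  assumes "finite V" "finite I" "0 \<le> \<epsilon>"
    and R: "\<And>u v. 0 \<le> R u v" "\<And>u v. R u v \<le> 1" and D: "\<And>u v. 0 \<le> D u v" "\<And>u v. D u v \<le> 1"
    and close: "cut_close V \<epsilon> R D"
  shows "\<bar>clique_sum V R I - clique_sum V D I\<bar> \<le> (card I)\<^sup>2 * \<epsilon> * card V ^ card I"
proof -
  have cs: "clique_sum V M I = pair_sum V (\<lambda>p. M) I" for M
    by (simp add: clique_sum_def pair_sum_def clique_weight_def split_def)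
  have eq: "pair_sum V (\<lambda>p. if p \<in> pairs I then D else R) I = pair_sum V (\<lambda>p. D) I"
    unfolding pair_sum_def by (intro sum.cong refl prod.cong) simp
  have "card (pairs I) \<le> card (I \<times> I)"
    using assms(2) by (intro card_mono) (auto simp: pairs_def)
  then have c: "real (card (pairs I)) \<le> (card I)\<^sup>2"
    by (simp only: card_cartesian_product power2_eq_square of_nat_le_iff)
  have "\<bar>clique_sum V R I - clique_sum V D I\<bar> \<le> card (pairs I) * (\<epsilon> * card V ^ card I)"
    unfolding cs eq[symmetric] by (rule pair_sum_replace[OF assms(1,2) order_refl R D close])
  also have "\<dots> \<le> (card I)\<^sup>2 * (\<epsilon> * card V ^ card I)"
    using c assms(3) by (intro mult_right_mono) auto
  finally show ?thesis by (simp add: mult.assoc)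
qed

text \<open>For symmetric \<open>R\<close> the transpose of \<open>D\<close> is as close as
  \<open>D\<close>, by exchanging \<open>f\<close> and \<open>g\<close>, and so is their mean.
  Averages in one variable are in general not symmetric, while Moon--Moser requires a symmetric
  weight.\<close>

lemma cut_close_symmetrize:
  assumes "cut_close V \<epsilon> R D" and sym: "\<And>u v. R u v = R v u"
  shows "cut_close V \<epsilon> R (\<lambda>u v. (D u v + D v u) / 2)"
  unfolding cut_close_def
proof (intro allI impI)
  fix f g :: "'a \<Rightarrow> real"
  assume f: "\<forall>x. 0 \<le> f x \<and> f x \<le> 1" and g: "\<forall>x. 0 \<le> g x \<and> g x \<le> 1"
  let ?S = "\<lambda>f g. \<Sum>x\<in>V. \<Sum>u\<in>V. (R x u - D x u) * f x * g u"
  have "(\<Sum>x\<in>V. \<Sum>u\<in>V. (R x u - (D x u + D u x) / 2) * f x * g u)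
    = (\<Sum>x\<in>V. \<Sum>u\<in>V. (R x u - D x u) * f x * g u / 2 + (R u x - D u x) * g u * f x / 2)"
    by (intro sum.cong refl) (simp add: sym[of _ x for x] field_simps)
  also have "\<dots> = (\<Sum>x\<in>V. \<Sum>u\<in>V. (R x u - D x u) * f x * g u / 2) + (\<Sum>x\<in>V. \<Sum>u\<in>V. (R u x - D u x) * g u * f x / 2)"
    by (simp only: sum.distrib)
  also have "(\<Sum>x\<in>V. \<Sum>u\<in>V. (R u x - D u x) * g u * f x / 2) = (\<Sum>u\<in>V. \<Sum>x\<in>V. (R u x - D u x) * g u * f x / 2)"
    by (rule sum.swap)
  also have "(\<Sum>x\<in>V. \<Sum>u\<in>V. (R x u - D x u) * f x * g u / 2) = ?S f g / 2"
    by (simp add: sum_divide_distrib)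
  also have "(\<Sum>u\<in>V. \<Sum>x\<in>V. (R u x - D u x) * g u * f x / 2) = ?S g f / 2"
    by (simp add: sum_divide_distrib)
  finally have eq: "(\<Sum>x\<in>V. \<Sum>u\<in>V. (R x u - (D x u + D u x) / 2) * f x * g u) = ?S f g / 2 + ?S g f / 2" .
  have "\<bar>?S f g\<bar> \<le> \<epsilon> * (card V)\<^sup>2" "\<bar>?S g f\<bar> \<le> \<epsilon> * (card V)\<^sup>2"
    using assms(1) f g unfolding cut_close_def by blast+
  then show "\<bar>\<Sum>x\<in>V. \<Sum>u\<in>V. (R x u - (D x u + D u x) / 2) * f x * g u\<bar> \<le> \<epsilon> * (card V)\<^sup>2"
    unfolding eq by linarith
qed

section \<open>Packing large monochromatic cliques\<close>

lemma power_perturb: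
  fixes a x y :: real
  assumes "0 \<le> a" "a \<le> 1" "0 \<le> x" "x \<le> 1" "a \<le> x + y" "0 \<le> y"
  shows "a ^ k \<le> x ^ k + k * y"
proof (induction k)
  case (Suc k)
  have "a ^ Suc k = a * a ^ k" by simp
  also have "\<dots> \<le> a * (x ^ k + k * y)"
    using Suc assms by (intro mult_left_mono) auto
  also have "\<dots> = a * x ^ k + a * (k * y)" by (simp add: algebra_simps)
  also have "\<dots> \<le> (x + y) * x ^ k + 1 * (k * y)"
    using assms by (intro add_mono mult_right_mono) auto
  also have "\<dots> \<le> x ^ Suc k + Suc k * y"
    using assms mult_left_le[of "x ^ k" y] by (simp add: algebra_simps power_le_one)
  finally show ?case .
qed simp

text \<open>The power and the binomial ratio are the probabilities that k draws from m points, with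
  and without replacement, all fall into c given points. In the induction one more draw costs at
  most k/m, and k + k^2 \<le> (k + 1)^2.\<close>

lemma binomial_ratio_lower:
  assumes "k \<le> m" "c \<le> m" "0 < m"
  shows "(real c / m) ^ k \<le> real (c choose k) / (m choose k) + real k ^ 2 / m"
  using assms(1)
proof (induction k)
  case (Suc k)
  define \<rho> where "\<rho> = real (c choose k) / (m choose k)"
  have pos: "0 < real (m choose k)" using Suc.prems by simp
  have "(c choose k) \<le> (m choose k)"
    unfolding binomial_eq_nsets using assms(2)
    by (intro card_mono nsets_mono finite_imp_finite_nsets) auto
  then have \<rho>: "0 \<le> \<rho>" "\<rho> \<le> 1"
    using pos by (auto simp: \<rho>_def)
  have absorb: "Suc k * (n choose Suc k) = (n choose k) * (n - k)" for n :: nat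
    using binomial_absorb_comp[of n k] binomial_absorption[of k n] by (simp only: mult.commute)
  have eq: "real (n choose Suc k) = (n choose k) * real (n - k) / Suc k" for n :: nat
    using arg_cong[OF absorb[of n], of real] by (simp add: field_simps)
  have "\<rho> * (real c - real k) / m \<le> \<rho> * real (c - k) / m"
    using \<rho> assms(3) by (intro divide_right_mono mult_left_mono) auto
  also have "\<dots> \<le> \<rho> * real (c - k) / real (m - k)"
    using \<rho> Suc.prems by (intro divide_left_mono) auto
  also have "\<dots> = real (c choose Suc k) / (m choose Suc k)"
    unfolding eq \<rho>_def by simp
  finally have "\<rho> * (real c - real k) / m \<le> real (c choose Suc k) / (m choose Suc k)" .
  moreover have "(real c / m) ^ Suc k \<le> \<rho> * (real c - real k) / m + real (Suc k) ^ 2 / m"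
  proof -
    have cm: "0 \<le> real c / m" "real c / m \<le> 1" using assms by auto
    have "(real c / m) ^ Suc k = (real c / m) * (real c / m) ^ k" by simp
    also have "\<dots> \<le> (real c / m) * (\<rho> + real k ^ 2 / m)"
      using Suc cm by (intro mult_left_mono) (auto simp: \<rho>_def)
    also have "\<dots> = \<rho> * real c / m + (real c / m) * (real k ^ 2 / m)"
      by (simp add: algebra_simps add_divide_distrib)
    also have "\<dots> \<le> \<rho> * real c / m + 1 * (real k ^ 2 / m)"
      using cm by (intro add_left_mono mult_right_mono) auto
    also have "\<dots> = \<rho> * (real c - real k) / m + \<rho> * (k / m) + real k ^ 2 / m"
      by (simp add: algebra_simps diff_divide_distrib)
    also have "\<dots> \<le> \<rho> * (real c - real k) / m + 1 * (k / m) + real k ^ 2 / m"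
      using \<rho> by (intro add_mono mult_right_mono order_refl) auto
    also have "\<dots> \<le> \<rho> * (real c - real k) / m + real (Suc k) ^ 2 / m"
    proof -
      have "k + real k ^ 2 \<le> real (Suc k) ^ 2" by (simp add: power2_eq_square algebra_simps)
      then have "(k + real k ^ 2) / m \<le> real (Suc k) ^ 2 / m"
        using assms(3) by (intro divide_right_mono) auto
      then show ?thesis by (simp add: add_divide_distrib)
    qed
    finally show ?thesis .
  qed
  ultimately show ?case by linarith
qed simp

text \<open>Divided by \<open>n choose r\<close>, the left side is the probability that a random
  r-subset of n points contains s given ones. Requiring one more point multiplies it by (r - s) / (n
  - s) \<le> r / n.\<close>

lemma binomial_diff_le:
  assumes "s \<le> r" "r \<le> n"
  shows "real (n - s choose (r - s)) \<le> (n choose r) * (r / n) ^ s"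
  using assms(1)
proof (induction s)
  case (Suc s)
  define n' r' where "n' = n - Suc s" "r' = r - Suc s"
  have nr: "n - s = Suc n'" "r - s = Suc r'" "0 < n"
    using Suc.prems assms(2) by (auto simp: n'_r'_def)
  have "Suc r' * (Suc n' choose Suc r') = Suc n' * (n' choose r')"
    using binomial_absorption[of r' "Suc n'"] by simp
  then have "real (n' choose r') = (Suc n' choose Suc r') * (Suc r' / Suc n')"
    by (simp add: field_simps flip: of_nat_mult)
  also have "\<dots> \<le> (Suc n' choose Suc r') * (r / n)"
  proof (intro mult_left_mono)
    have "(r - s) * n \<le> r * (n - s)"
      using assms(2) by (simp add: diff_mult_distrib diff_mult_distrib2 diff_le_mono2)
    then have "real (r - s) * n \<le> r * real (n - s)"
      by (metis of_nat_le_iff of_nat_mult)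
    then show "real (Suc r') / real (Suc n') \<le> r / n"
      unfolding nr(1,2)[symmetric] using nr by (simp add: field_simps)
  qed simp
  also have "\<dots> \<le> (n choose r) * (r / n) ^ s * (r / n)"
    using Suc unfolding nr by (intro mult_right_mono) auto
  finally show ?case by (simp add: n'_r'_def mult_ac)
qed simp

lemma card_supersets_le:
  assumes "finite A" "F \<subseteq> A" "r \<le> card A"
  shows "real (card {S \<in> [A]\<^bsup>r\<^esup>. F \<subseteq> S}) \<le> (card A choose r) * (r / card A) ^ card F"
proof (cases "card F \<le> r")
  case True
  have finF: "finite F" using assms finite_subset by blast
  have "card {S \<in> [A]\<^bsup>r\<^esup>. F \<subseteq> S} \<le> card ([A - F]\<^bsup>(r - card F)\<^esup>)"
  proof (rule card_inj_on_le[where f = "\<lambda>S. S - F"])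
    show "inj_on (\<lambda>S. S - F) {S \<in> [A]\<^bsup>r\<^esup>. F \<subseteq> S}"
      by (rule inj_onI) blast
    show "(\<lambda>S. S - F) ` {S \<in> [A]\<^bsup>r\<^esup>. F \<subseteq> S} \<subseteq> [A - F]\<^bsup>(r - card F)\<^esup>"
      using finF by (auto simp: nsets_def card_Diff_subset)
    show "finite ([A - F]\<^bsup>(r - card F)\<^esup>)"
      using assms(1) by (intro finite_imp_finite_nsets) simp
  qed
  also have "\<dots> = (card A - card F choose (r - card F))"
    using finF assms(2) by (simp add: card_nsets card_Diff_subset)
  finally show ?thesis
    using binomial_diff_le[OF True assms(3)] by linarith
next
  case False
  have "{S \<in> [A]\<^bsup>r\<^esup>. F \<subseteq> S} = {}"
    using False by (auto simp: nsets_def dest: card_mono)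
  then show ?thesis by (simp only: card.empty) simp
qed

text \<open>The union bound for a random r-subset in counting form: the sum assumed to be less than
  1 dominates the expected number of members of \<open>\<F>\<close> inside it.\<close>

lemma exists_avoiding_set:
  assumes A: "finite A" "r \<le> card A" and \<F>: "finite \<F>" "\<And>F. F \<in> \<F> \<Longrightarrow> F \<subseteq> A"
    and less: "(\<Sum>F\<in>\<F>. (r / card A) ^ card F) < 1"
  shows "\<exists>S\<in>[A]\<^bsup>r\<^esup>. \<forall>F\<in>\<F>. \<not> F \<subseteq> S"
proof (rule ccontr)
  assume "\<not> ?thesis"
  then have "[A]\<^bsup>r\<^esup> \<subseteq> (\<Union>F\<in>\<F>. {S \<in> [A]\<^bsup>r\<^esup>. F \<subseteq> S})" by auto
  then have "card ([A]\<^bsup>r\<^esup>) \<le> card (\<Union>F\<in>\<F>. {S \<in> [A]\<^bsup>r\<^esup>. F \<subseteq> S})"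
    using \<F>(1) finite_imp_finite_nsets[OF A(1)] by (intro card_mono) auto
  also have "\<dots> \<le> (\<Sum>F\<in>\<F>. card {S \<in> [A]\<^bsup>r\<^esup>. F \<subseteq> S})"
    by (rule card_UN_le[OF \<F>(1)])
  finally have "real (card A choose r) \<le> (\<Sum>F\<in>\<F>. real (card {S \<in> [A]\<^bsup>r\<^esup>. F \<subseteq> S}))"
    by (simp add: card_nsets flip: of_nat_sum)
  also have "\<dots> \<le> (\<Sum>F\<in>\<F>. (card A choose r) * (r / card A) ^ card F)"
    using A \<F> by (intro sum_mono card_supersets_le) auto
  also have "\<dots> = (card A choose r) * (\<Sum>F\<in>\<F>. (r / card A) ^ card F)"
    by (simp only: sum_distrib_left)
  also have "\<dots> < (card A choose r) * 1"
    using less A(2) by (simp add: zero_less_binomial)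
  finally show False by simp
qed

lemma greedy_packing:
  assumes "finite A" and step: "\<And>B. B \<subseteq> A \<Longrightarrow> q \<le> real (card B) \<Longrightarrow> \<exists>K\<subseteq>B. P K \<and> K \<noteq> {}"
  shows "\<exists>\<K>. finite \<K> \<and> disjoint \<K> \<and> (\<forall>K\<in>\<K>. P K \<and> K \<subseteq> A) \<and> real (card (A - \<Union>\<K>)) < q"
  using assms
proof (induction A rule: finite_psubset_induct)
  case (psubset A)
  show ?case
  proof (cases "q \<le> card A")
    case False
    then show ?thesis by (intro exI[of _ "{}"]) (auto simp: disjoint_def)
  next
    case True
    then obtain K where K: "K \<subseteq> A" "P K" "K \<noteq> {}" using psubset.prems by blast
    then have sub: "A - K \<subset> A" by blast
    have step': "\<exists>L\<subseteq>B. P L \<and> L \<noteq> {}" if "B \<subseteq> A - K" "q \<le> real (card B)" for B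
      using psubset.prems that by blast
    obtain \<K> where \<K>: "finite \<K>" "disjoint \<K>" "\<forall>L\<in>\<K>. P L \<and> L \<subseteq> A - K" "real (card (A - K - \<Union>\<K>)) < q"
      using psubset.IH[OF sub step'] by blast
    have "disjoint (insert K \<K>)"
      using \<K>(2,3) unfolding disjoint_def by blast
    then show ?thesis
      using \<K> K by (intro exI[of _ "insert K \<K>"]) (auto simp: Diff_eq Int_assoc)
  qed
qed

text \<open>Averaging over the \<open>k\<close>-subsets of a single large clique \<open>K\<close> in the complement of \<open>E\<close>: the
  number of those avoided by \<open>u\<close> is a convex function of the number of non-neighbours of \<open>u\<close>.\<close>

lemma indep_set_nonnbr_bound:
  fixes b :: real
  assumes V: "finite V" and K: "K \<subseteq> V" "card K = m" "k \<le> m" "0 < m"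
    and ext: "\<And>Q. Q \<subseteq> K \<Longrightarrow> card Q = k \<Longrightarrow> card {u\<in>V - Q. \<forall>x\<in>Q. \<not> E x u} \<le> b"
  shows "(\<Sum>u\<in>V. (card {x\<in>K. \<not> E x u} / m) ^ k) \<le> b + k + real k ^ 2 / m * card V"
proof -
  have finK: "finite K" using K V finite_subset by blast
  let ?c = "\<lambda>u. card {x\<in>K. \<not> E x u}"
  have pos: "0 < real (m choose k)" using K(3) by simp
  have "(\<Sum>u\<in>V. real (?c u choose k)) = (\<Sum>u\<in>V. \<Sum>Q\<in>[K]\<^bsup>k\<^esup>. of_bool (\<forall>x\<in>Q. \<not> E x u))"
  proof (intro sum.cong refl)
    fix u
    have "[{x\<in>K. \<not> E x u}]\<^bsup>k\<^esup> = {Q\<in>[K]\<^bsup>k\<^esup>. \<forall>x\<in>Q. \<not> E x u}"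
      by (auto simp: nsets_def)
    then show "real (?c u choose k) = (\<Sum>Q\<in>[K]\<^bsup>k\<^esup>. of_bool (\<forall>x\<in>Q. \<not> E x u))"
      using finite_imp_finite_nsets[OF finK, of k] by (simp add: card_nsets[symmetric] Int_def)
  qed
  also have "\<dots> = (\<Sum>Q\<in>[K]\<^bsup>k\<^esup>. \<Sum>u\<in>V. of_bool (\<forall>x\<in>Q. \<not> E x u))"
    by (rule sum.swap)
  also have "\<dots> \<le> (\<Sum>Q\<in>[K]\<^bsup>k\<^esup>. b + k)"
  proof (rule sum_mono)
    fix Q assume "Q \<in> [K]\<^bsup>k\<^esup>"
    then have Q: "Q \<subseteq> K" "card Q = k" "finite Q" by (auto simp: nsets_def)
    \<comment> \<open>Members of \<open>Q\<close> may be counted here although \<open>ext\<close>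
      excludes them; this is the origin of the summand \<open>k\<close>.\<close>
    have "(\<Sum>u\<in>V. of_bool (\<forall>x\<in>Q. \<not> E x u)) = real (card {u\<in>V. \<forall>x\<in>Q. \<not> E x u})"
      using V by (simp add: Int_def)
    also have "\<dots> \<le> real (card ({u\<in>V - Q. \<forall>x\<in>Q. \<not> E x u} \<union> Q))"
      using V Q by (intro of_nat_mono card_mono) auto
    also have "\<dots> \<le> real (card {u\<in>V - Q. \<forall>x\<in>Q. \<not> E x u}) + card Q"
      by (simp only: of_nat_add[symmetric] of_nat_le_iff card_Un_le)
    also have "\<dots> \<le> b + k" using ext[OF Q(1,2)] Q(2) by simp
    finally show "(\<Sum>u\<in>V. of_bool (\<forall>x\<in>Q. \<not> E x u)) \<le> b + k" .
  qed
  also have "\<dots> = (m choose k) * (b + k)" by (simp add: card_nsets K(2))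
  finally have sum: "(\<Sum>u\<in>V. real (?c u choose k)) \<le> (m choose k) * (b + k)" .
  have "(\<Sum>u\<in>V. (?c u / m) ^ k) \<le> (\<Sum>u\<in>V. real (?c u choose k) / (m choose k) + real k ^ 2 / m)"
  proof (intro sum_mono binomial_ratio_lower K)
    show "?c u \<le> m" for u using card_mono[OF finK, of "{x\<in>K. \<not> E x u}"] K(2) by auto
  qed
  also have "\<dots> = (\<Sum>u\<in>V. real (?c u choose k)) / (m choose k) + real k ^ 2 / m * card V"
    by (simp add: sum.distrib sum_divide_distrib)
  also have "\<dots> \<le> (b + k) + real k ^ 2 / m * card V"
    using sum pos by (simp add: pos_divide_le_eq mult.commute)
  finally show ?thesis by simp
qed

section \<open>Passing from cliques to large vertex sets by convexity\<close>

lemma power_mean_le: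
  fixes y :: "'b \<Rightarrow> real"
  assumes "finite S" "S \<noteq> {}" "\<And>i. i \<in> S \<Longrightarrow> 0 \<le> y i"
  shows "((\<Sum>i\<in>S. y i) / card S) ^ k \<le> (\<Sum>i\<in>S. y i ^ k) / card S"
  using convex_on_sum[OF assms(1,2) convex_power_nonneg, of "\<lambda>_. 1 / card S" y k] assms
  by (simp add: sum_divide_distrib)

text \<open>The non-neighbour density of \<open>u\<close> in a disjoint union of blocks of equal
  size is the mean of its densities in the blocks, so its k-th power is at most the mean of the k-th
  powers. The uncovered part of \<open>A\<close> raises the density by at most c, hence the k-th
  power by at most k c.\<close>

lemma packing_nonnbr_bound:
  fixes c B \<beta> :: real
  assumes V: "finite V" and \<K>: "finite \<K>" "disjoint \<K>" "\<K> \<noteq> {}"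
    and A: "A \<subseteq> V" and m: "0 < m" and card_K: "\<And>K. K \<in> \<K> \<Longrightarrow> card K = m \<and> K \<subseteq> A"
    and rest: "real (card (A - \<Union>\<K>)) \<le> c * card A" "0 \<le> c"
    and each: "\<And>K. K \<in> \<K> \<Longrightarrow> (\<Sum>u\<in>V. (card {x\<in>K. \<not> E x u} / m) ^ k) \<le> B"
  shows "(\<Sum>u\<in>V. (card {x\<in>A. \<not> E x u} / card A) ^ k) \<le> B + k * c * card V"
proof -
  have finA: "finite A" using A V finite_subset by blast
  have finK: "finite K" if "K \<in> \<K>" for K using card_K that finA finite_subset by blast
  define A0 where "A0 = \<Union>\<K>"
  have A0: "A0 \<subseteq> A" "finite A0" unfolding A0_def using card_K \<K>(1) finK by auto
  have cardA0: "card A0 = card \<K> * m"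
    unfolding A0_def using card_K finK \<K>(2) by (subst card_Union_disjoint) (auto simp: disjoint_def pairwise_def disjnt_def)
  have t: "0 < card \<K>" using \<K> by (simp add: card_gt_0_iff)
  have A0pos: "0 < real (card A0)" using cardA0 t m by simp
  have le: "real (card A0) \<le> card A" using A0 finA by (simp add: card_mono)
  have pt: "(card {x\<in>A. \<not> E x u} / card A) ^ k \<le> (\<Sum>K\<in>\<K>. (card {x\<in>K. \<not> E x u} / m) ^ k) / card \<K> + k * c" for u
  proof -
    let ?N = "\<lambda>S. {x\<in>S. \<not> E x u}"
    have fN: "finite (?N A)" "finite (?N A0)" using finA A0 by auto
    have "card (?N A) \<le> card (?N A0 \<union> (A - A0))"
      using finA A0 by (intro card_mono) auto
    also have "\<dots> \<le> card (?N A0) + card (A - A0)" by (rule card_Un_le)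
    finally have "real (card (?N A)) \<le> card (?N A0) + real (card (A - A0))" by linarith
    then have "real (card (?N A)) \<le> card (?N A0) + c * card A"
      using rest(1) unfolding A0_def[symmetric] by linarith
    then have "real (card (?N A)) / card A \<le> (card (?N A0) + c * card A) / card A"
      by (intro divide_right_mono) auto
    also have "\<dots> = real (card (?N A0)) / card A + c"
      using A0pos le by (simp add: add_divide_distrib)
    also have "\<dots> \<le> real (card (?N A0)) / card A0 + c"
      using A0pos le by (intro add_right_mono divide_left_mono) auto
    finally have 1: "real (card (?N A)) / card A \<le> real (card (?N A0)) / card A0 + c" .
    have "(card (?N A) / card A) ^ k \<le> (card (?N A0) / card A0) ^ k + k * c"
      using 1 rest(2) A0 finA by (intro power_perturb) (auto intro!: divide_le_eq_1[THEN iffD2] card_mono simp: card_gt_0_iff)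
    also have "card (?N A0) = (\<Sum>K\<in>\<K>. card (?N K))"
    proof -
      have "?N A0 = (\<Union>K\<in>\<K>. ?N K)" unfolding A0_def by auto
      also have "card \<dots> = (\<Sum>K\<in>\<K>. card (?N K))"
        using \<K>(1,2) finK by (intro card_UN_disjoint) (auto simp: disjoint_def)
      finally show ?thesis .
    qed
    also have "(real (\<Sum>K\<in>\<K>. card (?N K)) / card A0) = (\<Sum>K\<in>\<K>. card (?N K) / m) / card \<K>"
      unfolding cardA0 by (simp add: sum_divide_distrib mult.commute)
    also have "\<dots> ^ k \<le> (\<Sum>K\<in>\<K>. (card (?N K) / m) ^ k) / card \<K>"
      by (rule power_mean_le[OF \<K>(1,3)]) simp
    finally show ?thesis by simp
  qed
  have "(\<Sum>u\<in>V. (card {x\<in>A. \<not> E x u} / card A) ^ k)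
    \<le> (\<Sum>u\<in>V. (\<Sum>K\<in>\<K>. (card {x\<in>K. \<not> E x u} / m) ^ k) / card \<K> + k * c)"
    by (intro sum_mono pt)
  also have "\<dots> = (\<Sum>u\<in>V. (\<Sum>K\<in>\<K>. (card {x\<in>K. \<not> E x u} / m) ^ k)) / card \<K> + k * c * card V"
    by (simp add: sum.distrib sum_divide_distrib)
  also have "(\<Sum>u\<in>V. (\<Sum>K\<in>\<K>. (card {x\<in>K. \<not> E x u} / m) ^ k)) = (\<Sum>K\<in>\<K>. (\<Sum>u\<in>V. (card {x\<in>K. \<not> E x u} / m) ^ k))"
    by (rule sum.swap)
  also have "\<dots> \<le> card \<K> * B"
    using sum_bounded_above[of \<K> "\<lambda>K. \<Sum>u\<in>V. (card {x\<in>K. \<not> E x u} / m) ^ k" B] each by simp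
  finally show ?thesis using t by (simp add: divide_right_mono)
qed

definition red_cliques :: "'a set \<Rightarrow> ('a \<Rightarrow> 'a \<Rightarrow> bool) \<Rightarrow> nat \<Rightarrow> 'a set set" where
  "red_cliques V E s = {Q \<in> [V]\<^bsup>s\<^esup>. \<forall>x\<in>Q. \<forall>y\<in>Q. x \<noteq> y \<longrightarrow> E x y}"

text \<open>With blue as the absence of \<open>E\<close>, these are the blue k-cliques with at least
  \<open>b\<close> blue extensions, as in (ii).\<close>

definition rich_indep_sets :: "'a set \<Rightarrow> ('a \<Rightarrow> 'a \<Rightarrow> bool) \<Rightarrow> nat \<Rightarrow> real \<Rightarrow> 'a set set" where
  "rich_indep_sets V E k b = {Q \<in> [V]\<^bsup>k\<^esup>. (\<forall>x\<in>Q. \<forall>y\<in>Q. x \<noteq> y \<longrightarrow> \<not> E x y) \<and>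
     b \<le> card {u\<in>V - Q. \<forall>x\<in>Q. \<not> E x u}}"

text \<open>A random subset of \<open>B\<close> of Ramsey size contains fewer than one forbidden set
  on average, so some r-subset contains neither a red (k+1)-clique nor a rich k-set. In it Ramsey's
  theorem can only return an independent m-set, and none of the k-subsets of that set is
  rich.\<close>

lemma ramsey_avoiding:
  fixes \<beta> :: real
  assumes "0 < \<beta>"
  shows "\<exists>\<delta>::real. 0 < \<delta> \<and> (\<exists>N0. \<forall>(V::'a set) E (b::real). finite V \<longrightarrow> (\<forall>x y. E x y = E y x) \<longrightarrow> N0 \<le> card V \<longrightarrow>
    card (red_cliques V E (Suc k)) \<le> \<delta> * card V ^ Suc k \<longrightarrow>
    card (rich_indep_sets V E k b) \<le> \<delta> * card V ^ k \<longrightarrow>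
    (\<forall>B\<subseteq>V. \<beta> * card V \<le> card B \<longrightarrow> (\<exists>K\<subseteq>B. card K = m \<and>
       (\<forall>Q\<subseteq>K. card Q = k \<longrightarrow> card {u\<in>V - Q. \<forall>x\<in>Q. \<not> E x u} \<le> b))))"
proof -
  obtain r where r: "1 \<le> r" and ramsey: "\<And>(S::'a set) E. finite S \<Longrightarrow> r \<le> card S \<Longrightarrow>
      \<exists>R\<subseteq>S. card R = Suc k \<and> clique R E \<or> card R = m \<and> indep R E"
    using ramsey2[where 'a = 'a, of "Suc k" m] by blast
  \<comment> \<open>Given at most \<delta> N^s forbidden s-sets and a set \<open>B\<close> of size
    at least \<beta> N, a random r-subset of \<open>B\<close> contains on average at most \<delta>
    (r/\<beta>)^s of them. This is at most 1/3 both for s = k and for s = k + 1.\<close>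
  define \<delta> where "\<delta> = min ((\<beta> / r) ^ Suc k) ((\<beta> / r) ^ k) / 3"
  have \<delta>: "0 < \<delta>" using assms r by (simp add: \<delta>_def)
  obtain N0 :: nat where N0: "r / \<beta> < N0" using reals_Archimedean2 by blast
  have main: "\<exists>K\<subseteq>B. card K = m \<and> (\<forall>Q\<subseteq>K. card Q = k \<longrightarrow> card {u\<in>V - Q. \<forall>x\<in>Q. \<not> E x u} \<le> b)"
    if V: "finite V" and sym: "\<forall>x y. E x y = E y x" and N: "N0 \<le> card V"
      and red: "card (red_cliques V E (Suc k)) \<le> \<delta> * card V ^ Suc k"
      and rich: "card (rich_indep_sets V E k b) \<le> \<delta> * card V ^ k"
      and B: "B \<subseteq> V" "\<beta> * card V \<le> card B" for V :: "'a set" and E B and b :: real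
  proof -
    have "r < \<beta> * N0" using N0 assms by (simp add: pos_divide_less_eq mult.commute)
    also have "\<dots> \<le> \<beta> * card V" using N assms by simp
    also have "\<dots> \<le> card B" by (rule B)
    finally have rB: "r \<le> card B" by simp
    then have B0: "0 < real (card B)" using r by simp
    have V0: "0 < real (card V)"
      using B0 card_mono[OF V B(1)] by linarith
    have finB: "finite B" using B V finite_subset by blast
    define \<C> where "\<C> = {Q \<in> red_cliques V E (Suc k). Q \<subseteq> B}"
    define \<R> where "\<R> = {Q \<in> rich_indep_sets V E k b. Q \<subseteq> B}"
    have fin: "finite (red_cliques V E (Suc k))" "finite (rich_indep_sets V E k b)"
      unfolding red_cliques_def rich_indep_sets_def using finite_imp_finite_nsets[OF V] by auto
    then have fin': "finite \<C>" "finite \<R>" by (auto simp: \<C>_def \<R>_def)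
    have card_\<C>: "card Q = Suc k" if "Q \<in> \<C>" for Q
      using that by (auto simp: \<C>_def red_cliques_def nsets_def)
    have card_\<R>: "card Q = k" if "Q \<in> \<R>" for Q
      using that by (auto simp: \<R>_def rich_indep_sets_def nsets_def)
    have le3: "real (card \<F>) * (r / card B) ^ s \<le> 1 / 3"
      if "card \<F> \<le> \<delta> * card V ^ s" "\<delta> \<le> (\<beta> / r) ^ s / 3" for \<F> :: "'a set set" and s
    proof -
      have "(r / card B) ^ s \<le> (r / (\<beta> * card V)) ^ s"
        using B(2) assms V0 B0 by (intro power_mono divide_left_mono) auto
      moreover have "real (card \<F>) \<le> (\<beta> / r) ^ s / 3 * card V ^ s"
        using that(1) mult_right_mono[OF that(2), of "real (card V ^ s)"] by simp
      ultimately have "real (card \<F>) * (r / card B) ^ s \<le> ((\<beta> / r) ^ s / 3 * card V ^ s) * (r / (\<beta> * card V)) ^ s"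
        using assms by (intro mult_mono) auto
      also have "\<dots> = 1 / 3"
        using r assms V0 by (simp add: power_divide power_mult_distrib)
      finally show ?thesis .
    qed
    have "real (card \<C>) * (r / card B) ^ Suc k \<le> 1 / 3"
    proof (rule le3)
      have "card \<C> \<le> card (red_cliques V E (Suc k))"
        using fin by (intro card_mono) (auto simp: \<C>_def)
      then show "card \<C> \<le> \<delta> * card V ^ Suc k" using red by linarith
    qed (simp add: \<delta>_def)
    moreover have "real (card \<R>) * (r / card B) ^ k \<le> 1 / 3"
    proof (rule le3)
      have "card \<R> \<le> card (rich_indep_sets V E k b)"
        using fin by (intro card_mono) (auto simp: \<R>_def)
      then show "card \<R> \<le> \<delta> * card V ^ k" using rich by linarith
    qed (simp add: \<delta>_def)
    moreover have "(\<Sum>F\<in>\<C> \<union> \<R>. (r / card B) ^ card F) \<le> card \<C> * (r / card B) ^ Suc k + card \<R> * (r / card B) ^ k"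
    proof -
      have "(\<Sum>F\<in>\<C> \<union> \<R>. (r / card B) ^ card F) \<le> (\<Sum>F\<in>\<C>. (r / card B) ^ card F) + (\<Sum>F\<in>\<R>. (r / card B) ^ card F)"
        using fin' by (subst sum_Un) (auto intro!: sum_nonneg)
      then show ?thesis by (simp add: card_\<C> card_\<R>)
    qed
    ultimately have "(\<Sum>F\<in>\<C> \<union> \<R>. (r / card B) ^ card F) < 1" by linarith
    moreover have "F \<subseteq> B" if "F \<in> \<C> \<union> \<R>" for F using that by (auto simp: \<C>_def \<R>_def)
    ultimately obtain S where S: "S \<in> [B]\<^bsup>r\<^esup>" "\<forall>F\<in>\<C> \<union> \<R>. \<not> F \<subseteq> S"
      using exists_avoiding_set[OF finB rB, of "\<C> \<union> \<R>"] fin' by blast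
    then have S': "S \<subseteq> B" "finite S" "card S = r" by (auto simp: nsets_def)
    define Es where "Es = {{x, y} | x y. E x y}"
    have Es: "{x, y} \<in> Es \<longleftrightarrow> E x y" for x y
      using sym by (auto simp: Es_def doubleton_eq_iff)
    obtain K where K: "K \<subseteq> S" "card K = Suc k \<and> clique K Es \<or> card K = m \<and> indep K Es"
      using ramsey[of S Es] S' by auto
    have KV: "K \<subseteq> V" "finite K" "K \<subseteq> B" using K S' B finite_subset by blast+
    have "\<not> (card K = Suc k \<and> clique K Es)"
    proof
      assume "card K = Suc k \<and> clique K Es"
      then have "K \<in> \<C>"
        using KV by (auto simp: \<C>_def red_cliques_def nsets_def clique_def Es)
      then show False using S(2) K(1) by blast
    qed
    then have m: "card K = m" and ind: "indep K Es" using K by auto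
    have "card {u\<in>V - Q. \<forall>x\<in>Q. \<not> E x u} \<le> b" if Q: "Q \<subseteq> K" "card Q = k" for Q
    proof (rule ccontr)
      assume "\<not> ?thesis"
      moreover have "\<not> E x y" if "x \<in> Q" "y \<in> Q" "x \<noteq> y" for x y
        using ind Q(1) that unfolding indep_def Es by blast
      ultimately have "Q \<in> \<R>"
        using Q KV finite_subset[OF Q(1)] unfolding \<R>_def rich_indep_sets_def nsets_def
        by auto
      then show False using S(2) K(1) Q(1) by blast
    qed
    then show ?thesis using KV m by blast
  qed
  show ?thesis
    by (rule exI[of _ \<delta>], intro conjI \<delta> exI[of _ N0] allI impI) (rule main; assumption)
qed

text \<open>Blocks supplied by Ramsey's theorem are packed into \<open>A\<close>. The four
  \<epsilon> are the slack in the number of blue extensions, the k vertices of a k-set (as k \<le>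
  \<epsilon> n), the sampling error k^2/m, and the uncovered part of \<open>A\<close>.\<close>

lemma nonnbr_density_bound:
  fixes \<alpha> \<epsilon> :: real
  assumes "0 < \<alpha>" "0 < \<epsilon>" "1 \<le> k"
  shows "\<exists>\<delta>::real. 0 < \<delta> \<and> (\<exists>N0. \<forall>(V::'a set) E. finite V \<longrightarrow> (\<forall>x y. E x y = E y x) \<longrightarrow> N0 \<le> card V \<longrightarrow>
    card (red_cliques V E (Suc k)) \<le> \<delta> * card V ^ Suc k \<longrightarrow>
    card (rich_indep_sets V E k ((1 / k + \<epsilon>) * card V)) \<le> \<delta> * card V ^ k \<longrightarrow>
    (\<forall>A\<subseteq>V. \<alpha> * card V \<le> card A \<longrightarrow>
      (\<Sum>u\<in>V. (card {x\<in>A. \<not> E x u} / card A) ^ k) \<le> (1 / k + 4 * \<epsilon>) * card V))"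
proof -
  obtain m0 :: nat where m0: "real k ^ 2 / \<epsilon> < m0" using reals_Archimedean2 by blast
  define m where "m = max m0 k"
  have m: "k \<le> m" "0 < m" using assms by (auto simp: m_def)
  have "real k ^ 2 < m0 * \<epsilon>" using m0 assms by (simp add: pos_divide_less_eq)
  also have "\<dots> \<le> m * \<epsilon>" using assms by (intro mult_right_mono) (auto simp: m_def)
  finally have km: "real k ^ 2 / m \<le> \<epsilon>" using m by (simp add: pos_divide_le_eq mult.commute)
  \<comment> \<open>The factor \<epsilon>/k keeps the cost of the uncovered part below \<epsilon>;
    the factor 1/2 gives \<beta> < \<alpha>, so that at least one block is packed.\<close>
  define \<beta> where "\<beta> = \<alpha> * min (\<epsilon> / k) (1 / 2)"
  have \<beta>: "0 < \<beta>" "\<beta> < \<alpha>" "k * (\<beta> / \<alpha>) \<le> \<epsilon>"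
    using assms by (auto simp: \<beta>_def min_def field_simps)
  obtain \<delta> :: real and N1 where \<delta>: "0 < \<delta>" and K: "\<forall>(V::'a set) E (b::real). finite V \<longrightarrow> (\<forall>x y. E x y = E y x) \<longrightarrow> N1 \<le> card V \<longrightarrow>
    card (red_cliques V E (Suc k)) \<le> \<delta> * card V ^ Suc k \<longrightarrow>
    card (rich_indep_sets V E k b) \<le> \<delta> * card V ^ k \<longrightarrow>
    (\<forall>B\<subseteq>V. \<beta> * card V \<le> card B \<longrightarrow> (\<exists>K\<subseteq>B. card K = m \<and>
       (\<forall>Q\<subseteq>K. card Q = k \<longrightarrow> card {u\<in>V - Q. \<forall>x\<in>Q. \<not> E x u} \<le> b)))"
    using ramsey_avoiding[where 'a = 'a, OF \<beta>(1), of k m] by (elim exE conjE) (rule that; assumption)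
  obtain N2 :: nat where N2: "k / \<epsilon> < N2" using reals_Archimedean2 by blast
  define N0 where "N0 = max N1 (max N2 1)"
  have main: "(\<Sum>u\<in>V. (card {x\<in>A. \<not> E x u} / card A) ^ k) \<le> (1 / k + 4 * \<epsilon>) * card V"
    if V: "finite V" and sym: "\<forall>x y. E x y = E y x" and N: "N0 \<le> card V"
      and red: "card (red_cliques V E (Suc k)) \<le> \<delta> * card V ^ Suc k"
      and rich: "card (rich_indep_sets V E k ((1 / k + \<epsilon>) * card V)) \<le> \<delta> * card V ^ k"
      and A: "A \<subseteq> V" "\<alpha> * card V \<le> card A" for V :: "'a set" and E A
  proof -
    define n where "n = real (card V)"
    have n: "0 < n" "N1 \<le> card V" "real N2 \<le> n" using N by (auto simp: N0_def n_def)
    have "k < N2 * \<epsilon>" using N2 assms by (simp add: pos_divide_less_eq)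
    also have "\<dots> \<le> n * \<epsilon>" using n assms by (intro mult_right_mono) auto
    finally have kn: "k \<le> \<epsilon> * n" by (simp add: mult.commute)
    define P where "P = (\<lambda>K. card K = m \<and> (\<forall>Q\<subseteq>K. card Q = k \<longrightarrow> card {u\<in>V - Q. \<forall>x\<in>Q. \<not> E x u} \<le> (1 / k + \<epsilon>) * n))"
    have finA: "finite A" using A V finite_subset by blast
    have K': "\<forall>B\<subseteq>V. \<beta> * n \<le> card B \<longrightarrow> (\<exists>K\<subseteq>B. P K)"
      unfolding P_def n_def by (rule K[THEN spec, THEN spec, THEN spec, THEN mp, THEN mp, THEN mp, THEN mp, THEN mp, OF V sym n(2) red rich])
    have "\<exists>K\<subseteq>B. P K \<and> K \<noteq> {}" if B: "B \<subseteq> A" "\<beta> * n \<le> card B" for B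
    proof -
      obtain K where "K \<subseteq> B" "P K"
        using K' B A(1) by (meson order_trans)
      moreover have "K \<noteq> {}" using \<open>P K\<close> m by (auto simp: P_def)
      ultimately show ?thesis by blast
    qed
    then obtain \<K> where \<K>: "finite \<K>" "disjoint \<K>" "\<forall>K\<in>\<K>. P K \<and> K \<subseteq> A" "real (card (A - \<Union>\<K>)) < \<beta> * n"
      using greedy_packing[OF finA, of "\<beta> * n" P] by blast
    have "\<beta> * n < \<alpha> * n" using \<beta> n by simp
    also have "\<dots> \<le> card A" using A(2) by (simp add: n_def)
    finally have "\<K> \<noteq> {}" using \<K>(4) by auto
    have "(\<Sum>u\<in>V. (card {x\<in>A. \<not> E x u} / card A) ^ k)
      \<le> ((1 / k + \<epsilon>) * n + k + real k ^ 2 / m * n) + k * (\<beta> / \<alpha>) * n"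
      unfolding n_def
    proof (rule packing_nonnbr_bound[OF V \<K>(1,2) \<open>\<K> \<noteq> {}\<close> A(1) m(2)])
      show "card K = m \<and> K \<subseteq> A" if "K \<in> \<K>" for K using \<K>(3) that by (auto simp: P_def)
      have "\<beta> * n \<le> \<beta> / \<alpha> * card A"
        using A(2) \<beta> assms(1) by (simp add: n_def field_simps)
      then show "real (card (A - \<Union>\<K>)) \<le> \<beta> / \<alpha> * card A" using \<K>(4) by linarith
      show "0 \<le> \<beta> / \<alpha>" using \<beta> assms by simp
      show "(\<Sum>u\<in>V. (card {x\<in>K. \<not> E x u} / m) ^ k) \<le> (1 / k + \<epsilon>) * card V + k + real k ^ 2 / m * card V"
        if "K \<in> \<K>" for K
        using \<K>(3) that A(1) m by (intro indep_set_nonnbr_bound V) (auto simp: P_def n_def)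
    qed
    also have "\<dots> \<le> ((1 / k + \<epsilon>) * n + \<epsilon> * n + \<epsilon> * n) + \<epsilon> * n"
      using kn km \<beta>(3) n by (intro add_mono mult_right_mono order_refl) auto
    finally show ?thesis by (simp add: n_def algebra_simps)
  qed
  show ?thesis
    by (rule exI[of _ \<delta>], intro conjI \<delta> exI[of _ N0] allI impI) (rule main; assumption)
qed

section \<open>Edge density\<close>

text \<open>\<open>G\<close> is at least \<eta> times its threshold indicator, and a clique weight
  has one such factor for each pair.\<close>

lemma clique_sum_threshold:
  assumes V: "finite V" and I: "finite I" and G: "\<And>u v. 0 \<le> G u v" and "0 < (\<eta>::real)"
  shows "\<eta> ^ card (pairs I) * clique_sum V (\<lambda>u v. of_bool (\<eta> \<le> G u v)) I \<le> clique_sum V G I"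
proof -
  have "\<eta> ^ card (pairs I) * clique_weight (\<lambda>u v. of_bool (\<eta> \<le> G u v)) I x \<le> clique_weight G I x" for x
  proof -
    have "\<eta> ^ card (pairs I) * clique_weight (\<lambda>u v. of_bool (\<eta> \<le> G u v)) I x
      = (\<Prod>(i, j)\<in>pairs I. \<eta> * of_bool (\<eta> \<le> G (x i) (x j)))"
      unfolding clique_weight_def by (simp add: prod.distrib split_def)
    also have "\<dots> \<le> clique_weight G I x"
      unfolding clique_weight_def using assms(4) G by (intro prod_mono) auto
    finally show ?thesis .
  qed
  then show ?thesis
    unfolding clique_sum_def sum_distrib_left by (intro sum_mono)
qed

text \<open>Either t \<le> \<xi> or (t/\<xi>)^k \<ge> 1. This converts a small higher moment into a
  small first moment.\<close>

lemma le_power_interpolation: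
  fixes t \<xi> :: real
  assumes "0 \<le> t" "0 < \<xi>"
  shows "t \<le> \<xi> + t ^ Suc k / \<xi> ^ k"
proof (cases "t \<le> \<xi>")
  case True
  then show ?thesis using assms by (simp add: add_increasing2)
next
  case False
  then have "1 \<le> (t / \<xi>) ^ k" using assms by (intro one_le_power) auto
  then have "t * 1 \<le> t * (t / \<xi>) ^ k" using assms by (intro mult_left_mono)
  also have "\<dots> = t ^ Suc k / \<xi> ^ k" by (simp add: power_divide)
  finally show ?thesis using assms by simp
qed

lemma dense_if_moment_le:
  fixes \<epsilon>' :: real
  assumes k: "2 \<le> k" and "0 < \<epsilon>'"
  shows "\<exists>\<epsilon>::real. 0 < \<epsilon> \<and> (\<forall>(V::'a set) G. finite V \<longrightarrow> V \<noteq> {} \<longrightarrow> (\<forall>u v. G u v = G v u) \<longrightarrow>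
    (\<forall>u v. 0 \<le> G u v \<and> G u v \<le> 1) \<longrightarrow>
    (\<Sum>u\<in>V. \<Sum>v\<in>V. (1 - G u v) ^ k) \<le> (1 / k + \<epsilon>) * (card V)\<^sup>2 \<longrightarrow>
    clique_sum V G {..<Suc k} \<le> \<epsilon> * card V ^ Suc k \<longrightarrow>
    (1 - 1 / k - \<epsilon>') * (card V)\<^sup>2 \<le> (\<Sum>u\<in>V. \<Sum>v\<in>V. G u v))"
proof -
  obtain k' where k': "k = Suc k'" using k by (cases k) auto
  \<comment> \<open>The losses add up to 6 \<xi>: at most 2 \<sigma> \<le> 2 \<xi> from
    \<open>A\<close>, \<xi> from the interpolation and 3 \<xi> from \<open>S\<close>.\<close>
  define \<xi> where "\<xi> = min \<epsilon>' 1 / 6"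
  have \<xi>: "0 < \<xi>" "\<xi> \<le> 1" "6 * \<xi> \<le> \<epsilon>'" using assms by (auto simp: \<xi>_def)
  \<comment> \<open>Chosen so that \<xi> is still left after the division by \<xi>^(k-1) in the
    interpolation.\<close>
  define \<sigma> where "\<sigma> = \<xi> ^ k"
  have \<sigma>: "0 < \<sigma>" "\<sigma> \<le> \<xi>" "\<sigma> / \<xi> ^ k' = \<xi>"
    using \<xi> power_le_one[of \<xi> k'] by (auto simp: \<sigma>_def k' mult_left_le)
  \<comment> \<open>By Bernoulli (1 - \<eta>)^k \<ge> 1 - k \<eta> = 1 - \<sigma>, so a pair below
    the threshold \<eta> takes up almost a full unit of the moment.\<close>
  define \<eta> where "\<eta> = \<sigma> / k"
  have \<eta>: "0 < \<eta>" "k * \<eta> = \<sigma>" "\<eta> \<le> 1" using \<sigma> \<xi> k by (auto simp: \<eta>_def field_simps)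
  define c where "c = \<eta> ^ card (pairs {..<Suc k})"
  have c: "0 < c" using \<eta> by (simp add: c_def)
  \<comment> \<open>The second bound lies strictly below the (k+1)-clique density of
    \<open>G\<close> that supersaturation would produce if the density of \<open>h\<close> reached 1
    - 1/k + \<sigma>.\<close>
  define \<epsilon> where "\<epsilon> = min \<sigma> (c * (k * \<sigma>) ^ Suc k / 2)"
  have kpos: "0 < real k" using k by simp
  have \<epsilon>: "0 < \<epsilon>" "\<epsilon> \<le> \<sigma>" "\<epsilon> < c * (k * \<sigma>) ^ Suc k"
  proof -
    have "0 < c * (k * \<sigma>) ^ Suc k" using c \<sigma>(1) kpos by (intro mult_pos_pos zero_less_power)
    then show "0 < \<epsilon>" "\<epsilon> \<le> \<sigma>" "\<epsilon> < c * (k * \<sigma>) ^ Suc k" using \<sigma>(1) unfolding \<epsilon>_def by linarith+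
  qed
  have main: "(1 - 1 / k - \<epsilon>') * (card V)\<^sup>2 \<le> (\<Sum>u\<in>V. \<Sum>v\<in>V. G u v)"
    if V: "finite V" "V \<noteq> {}" and sym: "\<forall>u v. G u v = G v u" and G': "\<forall>u v. 0 \<le> G u v \<and> G u v \<le> 1"
      and moment: "(\<Sum>u\<in>V. \<Sum>v\<in>V. (1 - G u v) ^ k) \<le> (1 / k + \<epsilon>) * (card V)\<^sup>2"
      and sparse: "clique_sum V G {..<Suc k} \<le> \<epsilon> * card V ^ Suc k" for V :: "'a set" and G
  proof -
    have G: "0 \<le> G u v" "G u v \<le> 1" for u v using G' by auto
    define n where "n = real (card V)"
    have n: "0 < n" using V by (simp add: n_def card_gt_0_iff)
    \<comment> \<open>Moon--Moser is available for 0/1 weights, so \<open>G\<close> is cut off at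
      \<eta>. Then \<open>A\<close> counts the pairs below the threshold, and \<open>S\<close> is
      the part of the moment above it.\<close>
    define h where "h = (\<lambda>u v. of_bool (\<eta> \<le> G u v) :: real)"
    define A where "A = (\<Sum>u\<in>V. \<Sum>v\<in>V. 1 - h u v)"
    define S where "S = (\<Sum>u\<in>V. \<Sum>v\<in>V. h u v * (1 - G u v) ^ k)"
    have A_le: "A \<le> n\<^sup>2"
    proof -
      have "A \<le> (\<Sum>u\<in>V. \<Sum>v\<in>V. 1)" unfolding A_def h_def by (intro sum_mono) simp
      then show ?thesis by (simp add: n_def power2_eq_square)
    qed
    have A_ge: "(1 / k - \<sigma>) * n\<^sup>2 \<le> A"
    proof (rule ccontr)
      assume neg: "\<not> ?thesis"
      \<comment> \<open>Since \<open>A\<close> is nonnegative, failure of the claim rules out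
        \<sigma> \<ge> 1/k; so the deficiency 1/k - \<sigma> passed to supersaturation is
        nonnegative.\<close>
      have "0 \<le> A" unfolding A_def h_def by (intro sum_nonneg) simp
      with neg have "0 < (1 / k - \<sigma>) * n\<^sup>2" by linarith
      then have a: "0 \<le> 1 / k - \<sigma>" using n by (simp add: zero_less_mult_iff)
      have "A = n\<^sup>2 - (\<Sum>u\<in>V. \<Sum>v\<in>V. h u v)"
        unfolding A_def by (simp add: sum_subtractf n_def power2_eq_square)
      then have dense: "(1 - (1 / k - \<sigma>)) * (card V)\<^sup>2 \<le> (\<Sum>u\<in>V. \<Sum>v\<in>V. h u v)"
        using neg by (simp add: n_def algebra_simps)
      have ka: "1 - k * (1 / k - \<sigma>) = k * \<sigma>" using kpos by (simp add: algebra_simps)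
      have "((1 - k * (1 / k - \<sigma>)) * card V) ^ Suc k \<le> clique_sum V h {..<Suc k}"
      proof (rule clique_sum_lower_power[OF V _ _ dense a])
        show "h u v = h v u" for u v using sym by (simp add: h_def)
        show "h u v \<in> {0, 1}" for u v by (simp add: h_def)
        show "k * (1 / k - \<sigma>) < 1" using ka \<sigma>(1) kpos by (smt (verit) mult_pos_pos)
      qed simp
      then have "c * (k * \<sigma> * n) ^ Suc k \<le> c * clique_sum V h {..<Suc k}"
        using c unfolding ka n_def by (intro mult_left_mono) auto
      also have "\<dots> \<le> clique_sum V G {..<Suc k}"
        unfolding c_def h_def by (intro clique_sum_threshold V G \<eta>) simp
      also have "\<dots> \<le> \<epsilon> * n ^ Suc k" using sparse by (simp add: n_def)
      also have "\<dots> < (c * (k * \<sigma>) ^ Suc k) * n ^ Suc k"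
        using \<epsilon>(3) n by (intro mult_strict_right_mono) auto
      also have "\<dots> = c * (k * \<sigma> * n) ^ Suc k" by (simp only: power_mult_distrib mult.assoc)
      finally show False by simp
    qed
    have 1: "(1 - \<sigma>) * A + S \<le> (1 / k + \<epsilon>) * n\<^sup>2"
    proof -
      have "(1 - \<sigma>) * A + S = (\<Sum>u\<in>V. \<Sum>v\<in>V. (1 - \<sigma>) * (1 - h u v) + h u v * (1 - G u v) ^ k)"
        unfolding A_def S_def by (simp only: sum.distrib sum_distrib_left)
      also have "\<dots> \<le> (\<Sum>u\<in>V. \<Sum>v\<in>V. (1 - G u v) ^ k)"
      proof (intro sum_mono)
        fix u v
        show "(1 - \<sigma>) * (1 - h u v) + h u v * (1 - G u v) ^ k \<le> (1 - G u v) ^ k"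
        proof (cases "\<eta> \<le> G u v")
          case False
          have "1 - \<sigma> = 1 + real k * (- \<eta>)" using \<eta>(2) by simp
          also have "\<dots> \<le> (1 + (- \<eta>)) ^ k" using \<eta> by (intro Bernoulli_inequality) simp
          also have "\<dots> \<le> (1 - G u v) ^ k" using False \<eta> by (intro power_mono) auto
          finally show ?thesis using False by (simp add: h_def)
        qed (simp add: h_def)
      qed
      also have "\<dots> \<le> (1 / k + \<epsilon>) * n\<^sup>2" using moment by (simp add: n_def)
      finally show ?thesis .
    qed
    have 2: "(\<Sum>u\<in>V. \<Sum>v\<in>V. 1 - G u v) \<le> A + \<xi> * n\<^sup>2 + S / \<xi> ^ k'"
    proof -
      have "(\<Sum>u\<in>V. \<Sum>v\<in>V. 1 - G u v) \<le> (\<Sum>u\<in>V. \<Sum>v\<in>V. (1 - h u v) + \<xi> + h u v * (1 - G u v) ^ k / \<xi> ^ k')"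
      proof (intro sum_mono)
        fix u v
        show "1 - G u v \<le> (1 - h u v) + \<xi> + h u v * (1 - G u v) ^ k / \<xi> ^ k'"
          using le_power_interpolation[of "1 - G u v" \<xi> k'] G[of u v] \<xi> by (auto simp: h_def k')
      qed
      also have "\<dots> = A + (\<Sum>u\<in>V. \<Sum>v\<in>V. \<xi>) + S / \<xi> ^ k'"
        unfolding A_def S_def by (simp only: sum.distrib sum_divide_distrib)
      also have "(\<Sum>u\<in>V. \<Sum>v\<in>V. \<xi>) = \<xi> * n\<^sup>2" by (simp add: n_def power2_eq_square)
      finally show ?thesis .
    qed
    have n2: "0 \<le> n\<^sup>2" by simp
    have \<sigma>A: "\<sigma> * A \<le> \<sigma> * n\<^sup>2" using A_le \<sigma> by simp
    have \<epsilon>n: "\<epsilon> * n\<^sup>2 \<le> \<sigma> * n\<^sup>2" using \<epsilon> by (intro mult_right_mono) auto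
    have S0: "0 \<le> S" unfolding S_def h_def using G by (intro sum_nonneg) auto
    have moment': "A - \<sigma> * A + S \<le> 1 / k * n\<^sup>2 + \<epsilon> * n\<^sup>2" using 1 by (simp only: distrib_right left_diff_distrib mult_1)
    have A_ge': "1 / k * n\<^sup>2 - \<sigma> * n\<^sup>2 \<le> A" using A_ge by (simp only: left_diff_distrib)
    have S_le: "S \<le> 3 * (\<sigma> * n\<^sup>2)" using moment' A_ge' \<sigma>A \<epsilon>n by linarith
    have A_le': "A \<le> 1 / k * n\<^sup>2 + 2 * (\<sigma> * n\<^sup>2)" using moment' S0 \<sigma>A \<epsilon>n by linarith
    have "S / \<xi> ^ k' \<le> 3 * (\<sigma> * n\<^sup>2) / \<xi> ^ k'" using S_le \<xi> by (intro divide_right_mono) auto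
    also have "\<dots> = 3 * ((\<sigma> / \<xi> ^ k') * n\<^sup>2)" by simp
    also have "\<dots> = 3 * (\<xi> * n\<^sup>2)" by (simp only: \<sigma>(3))
    finally have "S / \<xi> ^ k' \<le> 3 * (\<xi> * n\<^sup>2)" .
    moreover have "\<sigma> * n\<^sup>2 \<le> \<xi> * n\<^sup>2" using \<sigma> by (intro mult_right_mono) auto
    moreover have "6 * \<xi> * n\<^sup>2 \<le> \<epsilon>' * n\<^sup>2" using \<xi> by (intro mult_right_mono) auto
    moreover have "(\<Sum>u\<in>V. \<Sum>v\<in>V. 1 - G u v) = n\<^sup>2 - (\<Sum>u\<in>V. \<Sum>v\<in>V. G u v)"
      by (simp add: sum_subtractf n_def power2_eq_square)
    ultimately have "n\<^sup>2 - 1 / k * n\<^sup>2 - \<epsilon>' * n\<^sup>2 \<le> (\<Sum>u\<in>V. \<Sum>v\<in>V. G u v)"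
      using 2 A_le' by linarith
    then show ?thesis by (simp add: n_def left_diff_distrib)
  qed
  show ?thesis
    by (rule exI[of _ \<epsilon>], intro conjI \<epsilon> allI impI) (rule main; assumption)
qed

text \<open>A map of nonzero weight is injective because \<open>E\<close> is irreflexive, and its
  image is a red clique; s^s is the number of all maps into a given s-set.\<close>

lemma clique_sum_le_red_cliques:
  assumes V: "finite V" and irrefl: "\<And>x. \<not> E x x" and sym: "\<And>x y. E x y = E y x"
  shows "clique_sum V (\<lambda>u v. of_bool (E u v)) {..<s} \<le> real (s ^ s) * card (red_cliques V E s)"
proof -
  let ?h = "\<lambda>u v. of_bool (E u v) :: real"
  define X where "X = {x \<in> PiE {..<s} (\<lambda>_. V). clique_weight ?h {..<s} x \<noteq> 0}"
  have fin: "finite (PiE {..<s} (\<lambda>_. V))" using V by (simp add: finite_PiE)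
  have finR: "finite (red_cliques V E s)"
    unfolding red_cliques_def using finite_imp_finite_nsets[OF V] by simp
  have "X \<subseteq> (\<Union>Q\<in>red_cliques V E s. PiE {..<s} (\<lambda>_. Q))"
  proof
    fix x assume "x \<in> X"
    then have x: "x \<in> PiE {..<s} (\<lambda>_. V)" and w: "clique_weight ?h {..<s} x \<noteq> 0"
      by (auto simp: X_def)
    have "E (x i) (x j)" if "i < j" "j < s" for i j
    proof (rule ccontr)
      assume "\<not> E (x i) (x j)"
      then have "clique_weight ?h {..<s} x = 0"
        unfolding clique_weight_def using that
        by (intro prod_zero[OF finite_pairs] bexI[of _ "(i, j)"]) (auto simp: pairs_def)
      with w show False ..
    qed
    then have E: "E (x i) (x j)" if "i \<noteq> j" "i < s" "j < s" for i j
      using that sym by (metis linorder_neqE_nat)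
    have "inj_on x {..<s}"
      by (rule inj_onI) (use E irrefl in \<open>metis lessThan_iff\<close>)
    then have "x ` {..<s} \<in> red_cliques V E s"
      using x E by (auto simp: red_cliques_def nsets_def card_image) metis
    moreover have "x \<in> PiE {..<s} (\<lambda>_. x ` {..<s})" using x by (auto simp: PiE_iff)
    ultimately show "x \<in> (\<Union>Q\<in>red_cliques V E s. PiE {..<s} (\<lambda>_. Q))" by blast
  qed
  then have "card X \<le> card (\<Union>Q\<in>red_cliques V E s. PiE {..<s} (\<lambda>_. Q))"
    using finR by (intro card_mono finite_UN_I finite_PiE) (auto simp: red_cliques_def nsets_def)
  also have "\<dots> \<le> (\<Sum>Q\<in>red_cliques V E s. card (PiE {..<s} (\<lambda>_. Q)))"
    by (rule card_UN_le[OF finR])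
  also have "\<dots> = (\<Sum>Q\<in>red_cliques V E s. s ^ s)"
    by (intro sum.cong refl) (auto simp: card_PiE red_cliques_def nsets_def)
  finally have X: "card X \<le> s ^ s * card (red_cliques V E s)" by (simp add: mult.commute)
  have "clique_sum V ?h {..<s} \<le> (\<Sum>x\<in>PiE {..<s} (\<lambda>_. V). of_bool (clique_weight ?h {..<s} x \<noteq> 0))"
    unfolding clique_sum_def
  proof (rule sum_mono)
    fix x
    show "clique_weight ?h {..<s} x \<le> of_bool (clique_weight ?h {..<s} x \<noteq> 0)"
      using clique_weight_01[of ?h "{..<s}" x] by auto
  qed
  also have "\<dots> = card X" using fin by (simp add: X_def Int_def)
  also have "\<dots> \<le> real (s ^ s) * card (red_cliques V E s)"
    using X by (metis of_nat_le_iff of_nat_mult)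
  finally show ?thesis .
qed

lemma rich_indep_sets_antimono: "b \<le> b' \<Longrightarrow> rich_indep_sets V E k b' \<subseteq> rich_indep_sets V E k b"
  by (auto simp: rich_indep_sets_def)

text \<open>Serves to discard the vertices whose class is too small for the packing bound; \<phi>
  has at most m classes on \<open>V\<close>.\<close>

lemma card_small_classes_le:
  fixes \<alpha> :: real
  assumes V: "finite V" and \<phi>: "\<phi> ` V \<subseteq> {..<m::nat}"
    and small: "\<And>x. x \<in> S \<Longrightarrow> x \<in> V \<and> card {y\<in>V. \<phi> y = \<phi> x} \<le> \<alpha>" and "0 \<le> \<alpha>"
  shows "card S \<le> m * \<alpha>"
proof -
  have S: "S \<subseteq> V" using small by auto
  have "S \<subseteq> (\<Union>j\<in>{..<m}. {x\<in>S. \<phi> x = j})" using S \<phi> by auto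
  then have "card S \<le> card (\<Union>j\<in>{..<m}. {x\<in>S. \<phi> x = j})"
    using finite_subset[OF S V] by (intro card_mono) auto
  also have "\<dots> \<le> (\<Sum>j<m. card {x\<in>S. \<phi> x = j})" by (rule card_UN_le) simp
  finally have "real (card S) \<le> (\<Sum>j<m. real (card {x\<in>S. \<phi> x = j}))" by (simp flip: of_nat_sum)
  also have "\<dots> \<le> (\<Sum>j<m. \<alpha>)"
  proof (rule sum_mono)
    fix j
    show "real (card {x\<in>S. \<phi> x = j}) \<le> \<alpha>"
    proof (cases "{x\<in>S. \<phi> x = j} = {}")
      case True
      then show ?thesis using assms(4) by (simp only: card.empty)
    next
      case False
      then obtain x where x: "x \<in> S" "\<phi> x = j" by auto
      have "card {x\<in>S. \<phi> x = j} \<le> card {y\<in>V. \<phi> y = \<phi> x}"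
        using S x V by (intro card_mono) auto
      then show ?thesis using small[OF x(1)] by linarith
    qed
  qed
  finally show ?thesis by simp
qed

lemma dense_if_local_bounds:
  fixes \<epsilon>' :: real
  assumes k: "2 \<le> k" and "0 < \<epsilon>'"
  shows "\<exists>\<delta>::real. 0 < \<delta> \<and> (\<exists>N0. \<forall>(V::'a set) E. finite V \<longrightarrow> V \<noteq> {} \<longrightarrow> (\<forall>x y. E x y = E y x) \<longrightarrow>
    (\<forall>x. \<not> E x x) \<longrightarrow> N0 \<le> card V \<longrightarrow>
    card (red_cliques V E (Suc k)) \<le> \<delta> * card V ^ Suc k \<longrightarrow>
    card (rich_indep_sets V E k ((1 / k + \<delta>) * card V)) \<le> \<delta> * card V ^ k \<longrightarrow>
    (1 - 1 / k - \<epsilon>') * (card V)\<^sup>2 \<le> (\<Sum>u\<in>V. \<Sum>v\<in>V. of_bool (E u v)))"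
proof -
  obtain \<epsilon> :: real where \<epsilon>: "0 < \<epsilon>" and dense: "\<forall>(V::'a set) G. finite V \<longrightarrow> V \<noteq> {} \<longrightarrow> (\<forall>u v. G u v = G v u) \<longrightarrow>
    (\<forall>u v. 0 \<le> G u v \<and> G u v \<le> 1) \<longrightarrow>
    (\<Sum>u\<in>V. \<Sum>v\<in>V. (1 - G u v) ^ k) \<le> (1 / k + \<epsilon>) * (card V)\<^sup>2 \<longrightarrow>
    clique_sum V G {..<Suc k} \<le> \<epsilon> * card V ^ Suc k \<longrightarrow>
    (1 - 1 / k - \<epsilon>') * (card V)\<^sup>2 \<le> (\<Sum>u\<in>V. \<Sum>v\<in>V. G u v)"
    using dense_if_moment_le[where 'a = 'a, OF assms] by (elim exE conjE) (rule that; assumption)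
  \<comment> \<open>The error in counting (k+1)-cliques becomes \<epsilon>/2; the other half of
    \<epsilon> is reserved for the red cliques themselves.\<close>
  define \<epsilon>1 where "\<epsilon>1 = \<epsilon> / (2 * (Suc k)\<^sup>2)"
  have \<epsilon>1: "0 < \<epsilon>1" "(Suc k)\<^sup>2 * \<epsilon>1 = \<epsilon> / 2" using \<epsilon> by (auto simp: \<epsilon>1_def)
  obtain m :: nat where reg: "\<forall>(V :: 'a set) R. finite V \<longrightarrow> (\<forall>x u. 0 \<le> R x u \<and> R x u \<le> 1) \<longrightarrow>
    (\<exists>\<phi>. \<phi> ` V \<subseteq> {..<m} \<and> cut_close V \<epsilon>1 R (class_avg V \<phi> R))"
    using weak_regularity[where 'a = 'a, OF \<epsilon>1(1)] by (elim exE) (rule that; assumption)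
  \<comment> \<open>Classes of fewer than \<alpha> n vertices contain at most m \<alpha> n \<le>
    (\<epsilon>/2) n vertices altogether, few enough for the trivial bound on their share of the
    moment.\<close>
  define \<alpha> where "\<alpha> = \<epsilon> / (2 * Suc m)"
  have \<alpha>: "0 < \<alpha>" "m * \<alpha> \<le> \<epsilon> / 2" using \<epsilon> by (auto simp: \<alpha>_def field_simps)
  have \<epsilon>8: "0 < \<epsilon> / 8" "1 \<le> k" using \<epsilon> k by auto
  obtain \<delta>1 :: real and N0 where \<delta>1: "0 < \<delta>1" and nonnbr: "\<forall>(V::'a set) E. finite V \<longrightarrow> (\<forall>x y. E x y = E y x) \<longrightarrow> N0 \<le> card V \<longrightarrow>
    card (red_cliques V E (Suc k)) \<le> \<delta>1 * card V ^ Suc k \<longrightarrow>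
    card (rich_indep_sets V E k ((1 / k + \<epsilon> / 8) * card V)) \<le> \<delta>1 * card V ^ k \<longrightarrow>
    (\<forall>A\<subseteq>V. \<alpha> * card V \<le> card A \<longrightarrow>
      (\<Sum>u\<in>V. (card {x\<in>A. \<not> E x u} / card A) ^ k) \<le> (1 / k + 4 * (\<epsilon> / 8)) * card V)"
    using nonnbr_density_bound[where 'a = 'a, OF \<alpha>(1) \<epsilon>8] by (elim exE conjE) (rule that; assumption)
  define s where "s = real (Suc k ^ Suc k)"
  have s: "0 < s" unfolding s_def of_nat_0_less_iff by (rule zero_less_power) simp
  \<comment> \<open>The bound \<epsilon>/8 keeps the extension threshold 1/k + \<delta> below the
    one in \<open>nonnbr\<close>, and \<epsilon>/(2 s) absorbs the factor s between red cliques and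
    the maps onto them.\<close>
  define \<delta> where "\<delta> = min \<delta>1 (min (\<epsilon> / 8) (\<epsilon> / (2 * s)))"
  have \<delta>: "0 < \<delta>" "\<delta> \<le> \<delta>1" "\<delta> \<le> \<epsilon> / 8" "\<delta> \<le> \<epsilon> / (2 * s)"
    using \<delta>1 \<epsilon> s by (auto simp: \<delta>_def)
  have main: "(1 - 1 / k - \<epsilon>') * (card V)\<^sup>2 \<le> (\<Sum>u\<in>V. \<Sum>v\<in>V. of_bool (E u v))"
    if V: "finite V" "V \<noteq> {}" and sym: "\<forall>x y. E x y = E y x" and irrefl: "\<forall>x. \<not> E x x" and N: "N0 \<le> card V"
      and red: "card (red_cliques V E (Suc k)) \<le> \<delta> * card V ^ Suc k"
      and rich: "card (rich_indep_sets V E k ((1 / k + \<delta>) * card V)) \<le> \<delta> * card V ^ k"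
    for V :: "'a set" and E
  proof -
    define n where "n = real (card V)"
    have n: "0 < n" using V by (simp add: n_def card_gt_0_iff)
    define R where "R = (\<lambda>u v. of_bool (E u v) :: real)"
    have R: "0 \<le> R u v" "R u v \<le> 1" for u v by (auto simp: R_def)
    have R_sym: "R u v = R v u" for u v using sym by (simp add: R_def)
    obtain \<phi> where \<phi>: "\<phi> ` V \<subseteq> {..<m}" "cut_close V \<epsilon>1 R (class_avg V \<phi> R)"
      using reg[THEN spec, THEN spec, THEN mp, THEN mp, OF V(1), of R] R by blast
    define D where "D = class_avg V \<phi> R"
    have D: "0 \<le> D u v" "D u v \<le> 1" for u v unfolding D_def by (rule class_avg_bounds[OF R])+
    define G where "G = (\<lambda>u v. (D u v + D v u) / 2)"
    have G: "0 \<le> G u v" "G u v \<le> 1" for u v using D[of u v] D[of v u] by (auto simp: G_def)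
    have close: "cut_close V \<epsilon>1 R G"
      unfolding G_def using \<phi>(2) R_sym unfolding D_def by (rule cut_close_symmetrize)
    have sparse: "clique_sum V G {..<Suc k} \<le> \<epsilon> * n ^ Suc k"
    proof -
      have "clique_sum V R {..<Suc k} \<le> s * card (red_cliques V E (Suc k))"
        unfolding R_def s_def using irrefl sym V by (intro clique_sum_le_red_cliques) auto
      also have "\<dots> \<le> s * (\<delta> * n ^ Suc k)"
        using red s by (intro mult_left_mono) (auto simp: n_def)
      also have "\<dots> \<le> s * (\<epsilon> / (2 * s) * n ^ Suc k)"
        using \<delta>(4) s n by (intro mult_left_mono mult_right_mono) auto
      also have "\<dots> = \<epsilon> / 2 * n ^ Suc k" using s by simp
      finally have "clique_sum V R {..<Suc k} \<le> \<epsilon> / 2 * n ^ Suc k" .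
      moreover have "\<bar>clique_sum V R {..<Suc k} - clique_sum V G {..<Suc k}\<bar> \<le> \<epsilon> / 2 * n ^ Suc k"
      proof -
        have "\<bar>clique_sum V R {..<Suc k} - clique_sum V G {..<Suc k}\<bar>
          \<le> (card {..<Suc k})\<^sup>2 * \<epsilon>1 * card V ^ card {..<Suc k}"
          using \<epsilon>1(1) by (intro clique_sum_cut_close V(1) finite_lessThan R G close) simp
        also have "\<dots> = ((Suc k)\<^sup>2 * \<epsilon>1) * n ^ Suc k"
          by (simp only: card_lessThan n_def of_nat_power)
        finally show ?thesis unfolding \<epsilon>1(2) .
      qed
      ultimately show ?thesis by linarith
    qed
    have big: "(\<Sum>u\<in>V. (1 - D x u) ^ k) \<le> (1 / k + \<epsilon> / 2) * n"
      if x: "x \<in> V" "\<alpha> * n \<le> card {y\<in>V. \<phi> y = \<phi> x}" for x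
    proof -
      let ?A = "{y\<in>V. \<phi> y = \<phi> x}"
      have A0: "0 < real (card ?A)" using x V by (auto simp: card_gt_0_iff)
      have "1 - D x u = card {y\<in>?A. \<not> E y u} / card ?A" for u
      proof -
        have "card {y\<in>?A. \<not> E y u} = (\<Sum>y\<in>?A. 1 - R y u)"
          using V(1) by (simp add: R_def of_bool_not_iff[symmetric] del: of_bool_not_iff) (simp add: Int_def)
        also have "\<dots> = card ?A - (\<Sum>y\<in>?A. R y u)" by (simp add: sum_subtractf)
        finally show ?thesis using A0 by (simp add: D_def class_avg_def diff_divide_distrib)
      qed
      moreover have "(\<Sum>u\<in>V. (card {y\<in>?A. \<not> E y u} / card ?A) ^ k) \<le> (1 / k + 4 * (\<epsilon> / 8)) * card V"
      proof -
        have red1: "card (red_cliques V E (Suc k)) \<le> \<delta>1 * card V ^ Suc k"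
          using red \<delta>(2) by (meson mult_right_mono of_nat_0_le_iff order_trans)
        have "rich_indep_sets V E k ((1 / k + \<epsilon> / 8) * card V) \<subseteq> rich_indep_sets V E k ((1 / k + \<delta>) * card V)"
          using \<delta>(3) by (intro rich_indep_sets_antimono mult_right_mono) auto
        then have "card (rich_indep_sets V E k ((1 / k + \<epsilon> / 8) * card V)) \<le> card (rich_indep_sets V E k ((1 / k + \<delta>) * card V))"
          using finite_imp_finite_nsets[OF V(1), of k] by (intro card_mono) (auto simp: rich_indep_sets_def)
        then have "card (rich_indep_sets V E k ((1 / k + \<epsilon> / 8) * card V)) \<le> \<delta> * card V ^ k"
          using rich by linarith
        also have "\<dots> \<le> \<delta>1 * card V ^ k" using \<delta>(2) by (intro mult_right_mono) auto
        finally have rich1: "card (rich_indep_sets V E k ((1 / k + \<epsilon> / 8) * card V)) \<le> \<delta>1 * card V ^ k" .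
        have "?A \<subseteq> V" by auto
        moreover have "\<alpha> * card V \<le> card ?A" using x by (simp add: n_def)
        ultimately show ?thesis
          by (rule nonnbr[THEN spec, THEN spec, THEN mp, THEN mp, THEN mp, THEN mp, THEN mp, THEN spec, THEN mp, THEN mp, OF V(1) sym N red1 rich1])
      qed
      ultimately show ?thesis by (simp add: n_def)
    qed
    define S where "S = {x\<in>V. card {y\<in>V. \<phi> y = \<phi> x} < \<alpha> * n}"
    have S: "S \<subseteq> V" by (auto simp: S_def)
    have card_S: "card S \<le> \<epsilon> / 2 * n"
    proof -
      have "card S \<le> m * (\<alpha> * n)"
        using \<alpha> n by (intro card_small_classes_le[OF V(1) \<phi>(1)]) (auto simp: S_def)
      also have "\<dots> = (m * \<alpha>) * n" by (simp only: mult.assoc)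
      also have "\<dots> \<le> \<epsilon> / 2 * n" using \<alpha> n by (intro mult_right_mono) auto
      finally show ?thesis .
    qed
    have momentD: "(\<Sum>x\<in>V. \<Sum>u\<in>V. (1 - D x u) ^ k) \<le> (1 / k + \<epsilon>) * n\<^sup>2"
    proof -
      have "(\<Sum>x\<in>V. \<Sum>u\<in>V. (1 - D x u) ^ k) \<le> (\<Sum>x\<in>V. (1 / k + \<epsilon> / 2) * n + of_bool (x \<in> S) * n)"
      proof (rule sum_mono)
        fix x assume x: "x \<in> V"
        show "(\<Sum>u\<in>V. (1 - D x u) ^ k) \<le> (1 / k + \<epsilon> / 2) * n + of_bool (x \<in> S) * n"
        proof (cases "x \<in> S")
          case False
          then show ?thesis using big[OF x] x by (simp add: S_def)
        next
          case True
          have "(\<Sum>u\<in>V. (1 - D x u) ^ k) \<le> (\<Sum>u\<in>V. 1)"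
            using D by (intro sum_mono power_le_one) auto
          moreover have "0 \<le> (1 / k + \<epsilon> / 2) * n" using \<epsilon> n by simp
          ultimately show ?thesis using True by (simp add: n_def)
        qed
      qed
      also have "\<dots> = (1 / k + \<epsilon> / 2) * n * n + card S * n"
        using V(1) S by (simp add: sum.distrib n_def sum_distrib_right[symmetric] Int_absorb1)
      also have "\<dots> \<le> (1 / k + \<epsilon> / 2) * n * n + \<epsilon> / 2 * n * n"
        using card_S n by simp
      finally show ?thesis by (simp add: power2_eq_square algebra_simps)
    qed
    \<comment> \<open>\<open>G\<close> is the mean of \<open>D\<close> and its transpose, so
      convexity of the k-th power preserves the moment bound.\<close>
    have momentG: "(\<Sum>u\<in>V. \<Sum>v\<in>V. (1 - G u v) ^ k) \<le> (1 / k + \<epsilon>) * n\<^sup>2"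
    proof -
      have "(\<Sum>u\<in>V. \<Sum>v\<in>V. (1 - G u v) ^ k) \<le> (\<Sum>u\<in>V. \<Sum>v\<in>V. (1 - D u v) ^ k / 2 + (1 - D v u) ^ k / 2)"
      proof (intro sum_mono)
        fix u v
        have "1 - G u v = (1 - 1 / 2) *\<^sub>R (1 - D u v) + (1 / 2) *\<^sub>R (1 - D v u)"
          by (simp add: G_def field_simps)
        also have "\<dots> ^ k \<le> (1 - 1 / 2) * (1 - D u v) ^ k + 1 / 2 * (1 - D v u) ^ k"
          using D by (intro convex_onD[OF convex_power_nonneg]) auto
        finally show "(1 - G u v) ^ k \<le> (1 - D u v) ^ k / 2 + (1 - D v u) ^ k / 2"
          by simp
      qed
      also have "\<dots> = (\<Sum>u\<in>V. \<Sum>v\<in>V. (1 - D u v) ^ k / 2) + (\<Sum>u\<in>V. \<Sum>v\<in>V. (1 - D v u) ^ k / 2)"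
        by (simp only: sum.distrib)
      also have "(\<Sum>u\<in>V. \<Sum>v\<in>V. (1 - D v u) ^ k / 2) = (\<Sum>v\<in>V. \<Sum>u\<in>V. (1 - D v u) ^ k / 2)"
        by (rule sum.swap)
      finally show ?thesis using momentD by (simp add: sum_divide_distrib[symmetric])
    qed
    have "(1 - 1 / k - \<epsilon>') * (card V)\<^sup>2 \<le> (\<Sum>u\<in>V. \<Sum>v\<in>V. G u v)"
    proof (rule dense[THEN spec, THEN spec, THEN mp, THEN mp, THEN mp, THEN mp, THEN mp, THEN mp, OF V])
      show "\<forall>u v. G u v = G v u" by (simp add: G_def add.commute)
      show "\<forall>u v. 0 \<le> G u v \<and> G u v \<le> 1" using G by blast
    qed (use momentG sparse in \<open>simp_all add: n_def\<close>)
    \<comment> \<open>Averaging over classes preserves the total weight exactly, so the density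
      bound passes from \<open>G\<close> to the red graph with no error in cut norm.\<close>
    also have "(\<Sum>u\<in>V. \<Sum>v\<in>V. G u v) = (\<Sum>u\<in>V. \<Sum>v\<in>V. R u v)"
    proof -
      have eq: "(\<Sum>v\<in>V. \<Sum>u\<in>V. D u v) = (\<Sum>v\<in>V. \<Sum>u\<in>V. R u v)"
        using sum_class_avg[OF V(1), of \<phi> "\<lambda>_. 1" R] by (simp add: D_def)
      have "(\<Sum>u\<in>V. \<Sum>v\<in>V. G u v) = (\<Sum>u\<in>V. \<Sum>v\<in>V. D u v) / 2 + (\<Sum>u\<in>V. \<Sum>v\<in>V. D v u) / 2"
        unfolding G_def by (simp add: add_divide_distrib sum.distrib sum_divide_distrib)
      also have "(\<Sum>u\<in>V. \<Sum>v\<in>V. D u v) = (\<Sum>v\<in>V. \<Sum>u\<in>V. D u v)" by (rule sum.swap)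
      also have "\<dots> / 2 + (\<Sum>u\<in>V. \<Sum>v\<in>V. D v u) / 2 = (\<Sum>v\<in>V. \<Sum>u\<in>V. R u v)"
        unfolding eq by simp
      also have "\<dots> = (\<Sum>u\<in>V. \<Sum>v\<in>V. R u v)" by (rule sum.swap)
      finally show ?thesis .
    qed
    finally show ?thesis by (simp add: R_def)
  qed
  show ?thesis
    by (rule exI[of _ \<delta>], intro conjI \<delta> exI[of _ N0] allI impI) (rule main; assumption)
qed

section \<open>Balancing\<close>

text \<open>\<open>g'\<close> is \<open>g\<close> composed with a permutation of \<open>V\<close>,
  hence has the fibre sizes of \<open>g\<close>. For each i the permutation carries as many vertices
  of \<open>f\<close>-label i as possible, the minimum of the two fibre sizes, into the i-th fibre
  of \<open>g\<close>. Only the other vertices, which are matched arbitrarily, may change their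
  label.\<close>

lemma relabel_with_fibres:
  fixes f g :: "'a \<Rightarrow> nat"
  assumes V: "finite V" and f: "f ` V \<subseteq> {..<k}" and g: "g ` V \<subseteq> {..<k}"
  shows "\<exists>g'. g' ` V \<subseteq> {..<k} \<and> (\<forall>i. card {v\<in>V. g' v = i} = card {v\<in>V. g v = i}) \<and>
    real (card {v\<in>V. g' v \<noteq> f v}) \<le> (\<Sum>i<k. \<bar>real (card {v\<in>V. f v = i}) - card {v\<in>V. g v = i}\<bar>)"
proof -
  define F where "F = (\<lambda>i. {v\<in>V. f v = i})"
  define H where "H = (\<lambda>i. {v\<in>V. g v = i})"
  define m where "m = (\<lambda>i. min (card (F i)) (card (H i)))"
  have fin: "finite (F i)" "finite (H i)" for i using V by (auto simp: F_def H_def)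
  have "m i \<le> card (F i)" "m i \<le> card (H i)" for i by (simp_all add: m_def)
  then have "\<forall>i. \<exists>A. A \<subseteq> F i \<and> card A = m i" "\<forall>i. \<exists>B. B \<subseteq> H i \<and> card B = m i"
    by (meson obtain_subset_with_card_n)+
  then obtain A B where A': "\<forall>i. A i \<subseteq> F i \<and> card (A i) = m i" and B': "\<forall>i. B i \<subseteq> H i \<and> card (B i) = m i"
    by (auto dest!: choice)
  then have A: "A i \<subseteq> F i" "card (A i) = m i" and B: "B i \<subseteq> H i" "card (B i) = m i" for i
    by auto
  have finAB: "finite (A i)" "finite (B i)" for i
    by (rule finite_subset[OF A(1) fin(1)], rule finite_subset[OF B(1) fin(2)])
  have "\<exists>\<beta>. bij_betw \<beta> (A i) (B i)" for i
    using finite_same_card_bij[OF finAB(1) finAB(2)] A(2) B(2) by simp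
  then obtain \<beta> where \<beta>: "\<And>i. bij_betw (\<beta> i) (A i) (B i)" by metis
  define UA where "UA = (\<Union>i<k. A i)"
  define UB where "UB = (\<Union>i<k. B i)"
  have sub: "UA \<subseteq> V" "UB \<subseteq> V" using A(1) B(1) by (auto simp: UA_def UB_def F_def H_def)
  have fA: "f v = i" if "v \<in> A i" for v i using A(1) that by (auto simp: F_def)
  have gB: "g v = i" if "v \<in> B i" for v i using B(1) that by (auto simp: H_def)
  have card_UA: "card UA = (\<Sum>i<k. m i)"
    unfolding UA_def A(2)[symmetric] by (rule card_UN_disjoint) (use finAB fA in blast)+
  have card_UB: "card UB = (\<Sum>i<k. m i)"
    unfolding UB_def B(2)[symmetric] by (rule card_UN_disjoint) (use finAB gB in blast)+
  have "card (V - UA) = card (V - UB)"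
    using card_UA card_UB finite_subset[OF sub(1) V] finite_subset[OF sub(2) V] sub
    by (simp add: card_Diff_subset)
  then obtain \<rho> where \<rho>: "bij_betw \<rho> (V - UA) (V - UB)"
    using finite_same_card_bij[of "V - UA" "V - UB"] V by auto
  define \<pi> where "\<pi> = (\<lambda>v. if v \<in> UA then \<beta> (f v) v else \<rho> v)"
  have \<pi>A: "bij_betw \<pi> (A i) (B i)" if "i < k" for i
  proof -
    have "\<pi> v = \<beta> i v" if "v \<in> A i" for v
      using that \<open>i < k\<close> fA by (auto simp: \<pi>_def UA_def)
    then show ?thesis using \<beta>[of i] bij_betw_cong[of "A i" \<pi> "\<beta> i" "B i"] by simp
  qed
  have "bij_betw \<pi> UA UB"
    unfolding UA_def UB_def
  proof (rule bij_betw_UNION_disjoint)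
    show "disjoint_family_on B {..<k}" using gB by (auto simp: disjoint_family_on_def)
  qed (use \<pi>A in auto)
  moreover have "bij_betw \<pi> (V - UA) (V - UB)"
    using \<rho> bij_betw_cong[of "V - UA" \<pi> \<rho>] by (auto simp: \<pi>_def)
  ultimately have "bij_betw \<pi> (UA \<union> (V - UA)) (UB \<union> (V - UB))"
    by (rule bij_betw_combine) auto
  then have \<pi>: "bij_betw \<pi> V V" using sub by (simp add: Un_absorb1)
  have 1: "(\<lambda>v. g (\<pi> v)) ` V \<subseteq> {..<k}" using g \<pi> by (auto simp: bij_betw_def)
  have 2: "card {v\<in>V. g (\<pi> v) = i} = card {v\<in>V. g v = i}" for i
  proof -
    have "\<pi> ` {v\<in>V. g (\<pi> v) = i} = {v\<in>V. g v = i}"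
      using \<pi> by (force simp: bij_betw_def)
    moreover have "inj_on \<pi> {v\<in>V. g (\<pi> v) = i}"
      using \<pi> by (auto simp: bij_betw_def inj_on_def)
    ultimately show ?thesis using card_image[of \<pi> "{v\<in>V. g (\<pi> v) = i}"] by simp
  qed
  have "card {v\<in>V. g (\<pi> v) \<noteq> f v} \<le> card (V - UA)"
  proof (rule card_mono)
    show "{v\<in>V. g (\<pi> v) \<noteq> f v} \<subseteq> V - UA"
    proof clarsimp
      fix v assume v: "g (\<pi> v) \<noteq> f v" "v \<in> UA"
      then obtain i where "i < k" "v \<in> A i" by (auto simp: UA_def)
      then have "\<pi> v \<in> B i" using \<pi>A[of i] by (auto simp: bij_betw_def)
      then show False using v(1) gB fA \<open>v \<in> A i\<close> by metis
    qed
  qed (use V in simp)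
  moreover have "card (V - UA) + card UA = card V"
    using card_Diff_subset[OF finite_subset[OF sub(1) V] sub(1)] card_mono[OF V sub(1)] by simp
  moreover have "card V = (\<Sum>i<k. card (F i))"
  proof -
    have "V = (\<Union>i<k. F i)" using f by (auto simp: F_def)
    then have "card V = card (\<Union>i<k. F i)" by simp
    also have "\<dots> = (\<Sum>i<k. card (F i))" using fin by (intro card_UN_disjoint) (auto simp: F_def)
    finally show ?thesis .
  qed
  ultimately have "real (card {v\<in>V. g (\<pi> v) \<noteq> f v}) \<le> (\<Sum>i<k. real (card (F i))) - (\<Sum>i<k. real (m i))"
    using card_UA by (simp flip: of_nat_sum)
  also have "\<dots> = (\<Sum>i<k. real (card (F i)) - m i)" by (simp only: sum_subtractf)
  also have "\<dots> \<le> (\<Sum>i<k. \<bar>real (card (F i)) - card (H i)\<bar>)"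
    by (intro sum_mono) (auto simp: m_def min_def)
  finally have 3: "real (card {v\<in>V. g (\<pi> v) \<noteq> f v}) \<le> (\<Sum>i<k. \<bar>real (card (F i)) - card (H i)\<bar>)" .
  show ?thesis
    using 1 2 3 unfolding F_def H_def by (intro exI[of _ "\<lambda>v. g (\<pi> v)"] conjI allI)
qed

text \<open>Going back one period and changing the residue, v is sent to v + j - (i + k). This
  injects the class of i without its least member i into the class of j.\<close>

lemma card_residue_class_le:
  fixes k :: nat
  assumes "i < k" "j < k"
  shows "card {v\<in>{..<N}. v mod k = i} \<le> card {v\<in>{..<N}. v mod k = j} + 1"
proof -
  let ?A = "\<lambda>i. {v\<in>{..<N}. v mod k = i}"
  have form: "\<exists>q. v = i + k * Suc q" if "v \<in> ?A i - {i}" for v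
  proof -
    have v: "v = i + k * (v div k)" and "v \<noteq> i" using that by auto
    then have "v div k \<noteq> 0" by (cases "v div k = 0") simp_all
    then obtain q where "v div k = Suc q" using not0_implies_Suc by blast
    with v show ?thesis by auto
  qed
  have "card (?A i - {i}) \<le> card (?A j)"
  proof (rule card_inj_on_le[where f = "\<lambda>v. v + j - (i + k)"])
    show "inj_on (\<lambda>v. v + j - (i + k)) (?A i - {i})"
    proof (rule inj_onI)
      fix v w assume vw: "v \<in> ?A i - {i}" "w \<in> ?A i - {i}" "v + j - (i + k) = w + j - (i + k)"
      obtain p q where "v = i + k * Suc p" "w = i + k * Suc q" using form vw(1,2) by meson
      then show "v = w" using vw(3) by simp
    qed
    show "(\<lambda>v. v + j - (i + k)) ` (?A i - {i}) \<subseteq> ?A j"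
    proof
      fix w assume "w \<in> (\<lambda>v. v + j - (i + k)) ` (?A i - {i})"
      then obtain v where v: "v \<in> ?A i - {i}" and w: "w = v + j - (i + k)" by blast
      obtain q where q: "v = i + k * Suc q" using form[OF v] by blast
      then have "v + j - (i + k) = j + k * q" by simp
      moreover have "j + k * q < N"
      proof -
        have "j + k * q < k + k * q" using assms by simp
        also have "\<dots> \<le> v" using q by simp
        also have "\<dots> < N" using v by simp
        finally show ?thesis .
      qed
      ultimately show "w \<in> ?A j" using assms w by simp
    qed
  qed simp
  moreover have "card (?A i) \<le> card (?A i - {i}) + 1"
    by (simp add: card_Diff_singleton_if) arith
  ultimately show ?thesis by linarith
qed

lemma card_residue_class_near:
  assumes "i < (k::nat)"
  shows "\<bar>real (card {v\<in>{..<N}. v mod k = i}) - real N / k\<bar> \<le> 1"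
proof -
  let ?d = "\<lambda>i. real (card {v\<in>{..<N}. v mod k = i})"
  have k: "0 < real k" using assms by simp
  have "{..<N} = (\<Union>j<k. {v\<in>{..<N}. v mod k = j})" using assms by auto
  then have "card {..<N} = card (\<Union>j<k. {v\<in>{..<N}. v mod k = j})" by simp
  also have "\<dots> = (\<Sum>j<k. card {v\<in>{..<N}. v mod k = j})"
    by (intro card_UN_disjoint) auto
  finally have N: "real N = (\<Sum>j<k. ?d j)" by (simp flip: of_nat_sum)
  have le: "?d j \<le> ?d i + 1" "?d i - 1 \<le> ?d j" if "j < k" for j
    using card_residue_class_le[OF that assms, of N] card_residue_class_le[OF assms that, of N] by linarith+
  have "real N \<le> (\<Sum>j<k. ?d i + 1)" unfolding N using le(1) by (intro sum_mono) auto
  moreover have "(\<Sum>j<k. ?d i - 1) \<le> real N" unfolding N using le(2) by (intro sum_mono) auto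
  ultimately have "real N \<le> k * (?d i + 1)" "k * (?d i - 1) \<le> real N" by simp_all
  then have "real N / k \<le> ?d i + 1" "?d i - 1 \<le> real N / k"
    using k by (simp_all add: field_simps)
  then show ?thesis by linarith
qed

lemma sum_same_label:
  assumes V: "finite V" and f: "f ` V \<subseteq> {..<k::nat}"
  shows "(\<Sum>u\<in>V. \<Sum>v\<in>V. of_bool (f u = f v)) = (\<Sum>i<k. (real (card {v\<in>V. f v = i}))\<^sup>2)"
proof -
  have "(\<Sum>u\<in>V. \<Sum>v\<in>V. of_bool (f u = f v)) = (\<Sum>u\<in>V. real (card {v\<in>V. f v = f u}))"
    using V by (intro sum.cong refl) (simp add: Int_def eq_commute)
  also have "\<dots> = (\<Sum>i<k. \<Sum>u\<in>{u\<in>V. f u = i}. real (card {v\<in>V. f v = f u}))"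
    using sum.group[OF V finite_lessThan f, of "\<lambda>u. real (card {v\<in>V. f v = f u})"] by simp
  also have "\<dots> = (\<Sum>i<k. (real (card {v\<in>V. f v = i}))\<^sup>2)"
    by (intro sum.cong refl) (simp add: power2_eq_square)
  finally show ?thesis .
qed

text \<open>A near-extremal edge density forces the label classes to have nearly equal sizes, because
  the number of pairs inside classes is \<open>\<Sum> n\<^sub>i\<^sup>2\<close>.\<close>

lemma balanced_labelling:
  fixes \<rho> \<theta> :: real and k N :: nat and f :: "nat \<Rightarrow> nat" and E :: "nat \<Rightarrow> nat \<Rightarrow> bool"
  assumes k: "0 < k" and f: "f ` {..<N} \<subseteq> {..<k}"
    and inside: "(\<Sum>u<N. \<Sum>v<N. of_bool (f u = f v) * of_bool (E u v)) \<le> \<rho> / 2 * (real N)\<^sup>2"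
    and dense: "(1 - 1 / k - \<rho> / 2) * (real N)\<^sup>2 \<le> (\<Sum>u<N. \<Sum>v<N. of_bool (E u v))"
    and \<rho>: "8 * \<rho> \<le> \<theta>" "64 * (k * \<rho>) \<le> \<theta>\<^sup>2" "0 \<le> \<rho>" and \<theta>: "0 < \<theta>" and N: "4 * k \<le> \<theta> * N"
  shows "\<exists>g. g ` {..<N} \<subseteq> {..<k} \<and>
     (\<forall>i<k. \<forall>j<k. card {v\<in>{..<N}. g v = i} \<le> card {v\<in>{..<N}. g v = j} + 1) \<and>
     (\<Sum>u<N. \<Sum>v<N. of_bool (E u v = (g u = g v))) \<le> \<theta> * (real N)\<^sup>2"
proof -
  define n where "n = real N"
  define c where "c = (\<lambda>i. real (card {v\<in>{..<N}. f v = i}))"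
  define Q where "Q = (\<Sum>i<k. (c i)\<^sup>2)"
  define S where "S = (\<lambda>F. \<Sum>u<N. \<Sum>v<N. (F u v :: real))"
  have S_add: "S (\<lambda>u v. F u v + G u v) = S F + S G" for F G
    by (simp add: S_def sum.distrib)
  have S_mono: "S F \<le> S G" if "\<And>u v. F u v \<le> G u v" for F G
    unfolding S_def by (intro sum_mono that)
  have S_1: "S (\<lambda>u v. 1) = n\<^sup>2" by (simp add: S_def n_def power2_eq_square)
  have S_Q: "S (\<lambda>u v. of_bool (f u = f v)) = Q"
    unfolding S_def Q_def c_def by (rule sum_same_label[OF finite_lessThan f])
  define in_E where "in_E = S (\<lambda>u v. of_bool (f u = f v) * of_bool (E u v))"
  define out_E where "out_E = S (\<lambda>u v. of_bool (f u \<noteq> f v) * of_bool (E u v))"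
  define out_N where "out_N = S (\<lambda>u v. of_bool (f u \<noteq> f v) * of_bool (\<not> E u v))"
  have "in_E + out_E = S (\<lambda>u v. of_bool (E u v))"
    unfolding in_E_def out_E_def S_add[symmetric] by (rule arg_cong[where f = S]) (auto simp: fun_eq_iff)
  then have d: "(1 - 1 / k - \<rho> / 2) * n\<^sup>2 \<le> in_E + out_E" using dense by (simp add: S_def n_def)
  have i: "in_E \<le> \<rho> / 2 * n\<^sup>2" using inside by (simp add: in_E_def S_def n_def)
  have "Q + out_E + out_N = S (\<lambda>u v. 1)"
    unfolding S_Q[symmetric] out_E_def out_N_def S_add[symmetric] by (rule arg_cong[where f = S]) (auto simp: fun_eq_iff)
  then have q: "Q + out_E + out_N = n\<^sup>2" using S_1 by simp
  have out_N: "0 \<le> out_N" unfolding out_N_def S_def by (intro sum_nonneg) auto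
  have sum_c: "(\<Sum>i<k. c i) = n"
  proof -
    have "n = (\<Sum>v<N. 1)" by (simp add: n_def)
    also have "\<dots> = (\<Sum>i<k. \<Sum>v\<in>{v\<in>{..<N}. f v = i}. 1)"
      using f by (intro sum.group[symmetric]) auto
    finally show ?thesis by (simp add: c_def)
  qed
  have d': "n\<^sup>2 - n\<^sup>2 / k - \<rho> / 2 * n\<^sup>2 \<le> in_E + out_E" using d by (simp add: algebra_simps)
  \<comment> \<open>At least (1 - 1/k - \<rho>) n^2 edges run between classes, and these pairs are
    lost to \<open>Q\<close>.\<close>
  have Q_le: "Q \<le> n\<^sup>2 / k + \<rho> * n\<^sup>2" using d' i q out_N by linarith
  have kpos: "0 < real k" using k by simp
  have Q_ge: "n\<^sup>2 / k \<le> Q"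
    using sum_squared_le_sum_of_squares[of c "{..<k}"] sum_c kpos by (simp add: Q_def field_simps)
  \<comment> \<open>As Q \<ge> n^2/k, the non-edges between classes satisfy \<open>out_N\<close>
    \<le> \<open>in_E\<close> + (\<rho>/2) n^2.\<close>
  have wrong_f: "in_E + out_N \<le> 2 * \<rho> * n\<^sup>2" using d' i q Q_ge mult_nonneg_nonneg[OF \<rho>(3) zero_le_power2[of n]] by linarith
  define M where "M = (\<Sum>i<k. \<bar>c i - n / k\<bar>)"
  \<comment> \<open>Q - n^2/k is the sum of the squared deviations of the class sizes from n/k;
    Cauchy--Schwarz turns it into a bound on the absolute deviations.\<close>
  have "M\<^sup>2 \<le> (\<Sum>i<k. \<bar>c i - n / k\<bar>\<^sup>2) * k"
    using sum_squared_le_sum_of_squares[of "\<lambda>i. \<bar>c i - n / k\<bar>" "{..<k}"] by (simp add: M_def)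
  also have "(\<Sum>i<k. \<bar>c i - n / k\<bar>\<^sup>2) = (\<Sum>i<k. (c i)\<^sup>2 - 2 * (n / k) * c i + (n / k)\<^sup>2)"
    by (intro sum.cong refl) (simp add: power2_eq_square algebra_simps)
  also have "\<dots> = Q - 2 * (n / k) * (\<Sum>i<k. c i) + k * (n / k)\<^sup>2"
    by (simp add: sum.distrib sum_subtractf sum_distrib_left Q_def)
  also have "\<dots> = Q - n\<^sup>2 / k" unfolding sum_c using kpos by (simp add: power2_eq_square field_simps)
  also have "(Q - n\<^sup>2 / k) * k \<le> (\<rho> * n\<^sup>2) * k" using Q_le by (intro mult_right_mono) auto
  also have "\<dots> = (k * \<rho>) * n\<^sup>2" by simp
  also have "\<dots> \<le> (\<theta>\<^sup>2 / 64) * n\<^sup>2" using \<rho>(2) by (intro mult_right_mono) auto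
  also have "\<dots> = (\<theta> / 8 * n)\<^sup>2" by (simp add: power2_eq_square)
  finally have M: "M \<le> \<theta> / 8 * n" using \<theta> by (intro power2_le_imp_le[of M]) (auto simp: n_def)
  \<comment> \<open>Residues mod k only provide balanced class sizes; the vertices are then
    rearranged to agree with \<open>f\<close> as far as possible.\<close>
  have gmod: "(\<lambda>v. v mod k) ` {..<N} \<subseteq> {..<k}" using k by auto
  obtain g where g: "g ` {..<N} \<subseteq> {..<k}" "\<And>i. card {v\<in>{..<N}. g v = i} = card {v\<in>{..<N}. v mod k = i}"
    and moved: "real (card {v\<in>{..<N}. g v \<noteq> f v}) \<le> (\<Sum>i<k. \<bar>c i - card {v\<in>{..<N}. v mod k = i}\<bar>)"
    using relabel_with_fibres[OF finite_lessThan f gmod] unfolding c_def by blast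
  define b where "b = real (card {v\<in>{..<N}. g v \<noteq> f v})"
  have "b \<le> (\<Sum>i<k. \<bar>c i - n / k\<bar> + 1)"
    unfolding b_def
  proof (rule order_trans[OF moved sum_mono])
    fix i assume "i \<in> {..<k}"
    then show "\<bar>c i - card {v\<in>{..<N}. v mod k = i}\<bar> \<le> \<bar>c i - n / k\<bar> + 1"
      using card_residue_class_near[of i k N] unfolding n_def by auto
  qed
  then have b: "b \<le> \<theta> / 8 * n + k" using M by (simp add: M_def sum.distrib)
  \<comment> \<open>A pair is wrong for \<open>g\<close> only if it is wrong for \<open>f\<close> or
    one of its ends has been relabelled.\<close>
  have "S (\<lambda>u v. of_bool (E u v = (g u = g v))) \<le> S (\<lambda>u v. (of_bool (f u = f v) * of_bool (E u v) + of_bool (f u \<noteq> f v) * of_bool (\<not> E u v))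
      + (of_bool (g u \<noteq> f u) + of_bool (g v \<noteq> f v)))"
    by (rule S_mono) auto
  also have "\<dots> = in_E + out_N + (S (\<lambda>u v. of_bool (g u \<noteq> f u)) + S (\<lambda>u v. of_bool (g v \<noteq> f v)))"
    unfolding S_add in_E_def out_N_def ..
  also have "S (\<lambda>u v. of_bool (g u \<noteq> f u)) = n * b"
    by (simp add: S_def b_def n_def sum_distrib_left[symmetric] Int_def)
  also have "S (\<lambda>u v. of_bool (g v \<noteq> f v)) = n * b"
    by (simp add: S_def b_def n_def Int_def)
  also have "in_E + out_N + (n * b + n * b) \<le> 2 * \<rho> * n\<^sup>2 + 2 * (n * (\<theta> / 8 * n + k))"
  proof -
    have "n * b \<le> n * (\<theta> / 8 * n + k)" using b by (intro mult_left_mono) (auto simp: n_def)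
    then show ?thesis using wrong_f by linarith
  qed
  also have "\<dots> \<le> \<theta> / 4 * n\<^sup>2 + \<theta> / 4 * n\<^sup>2 + \<theta> / 2 * n\<^sup>2"
  proof -
    have "2 * \<rho> * n\<^sup>2 \<le> \<theta> / 4 * n\<^sup>2" using \<rho>(1) by (intro mult_right_mono) auto
    moreover have "n * (4 * k) \<le> n * (\<theta> * n)" using N by (intro mult_left_mono) (auto simp: n_def)
    ultimately show ?thesis by (simp add: power2_eq_square algebra_simps)
  qed
  finally have "S (\<lambda>u v. of_bool (E u v = (g u = g v))) \<le> \<theta> * n\<^sup>2" by simp
  moreover have "card {v\<in>{..<N}. g v = i} \<le> card {v\<in>{..<N}. g v = j} + 1" if "i < k" "j < k" for i j
    using card_residue_class_le[OF that] g(2) by simp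
  ultimately show ?thesis
    using g(1) by (intro exI[of _ g]) (auto simp: S_def n_def)
qed

section \<open>Colorings\<close>

lemma card_mono_cliques_le: "real (card (mono_cliques N \<chi> a k)) \<le> real N ^ k"
proof -
  have "card (mono_cliques N \<chi> a k) \<le> card ([{..<N}]\<^bsup>k\<^esup>)"
    by (intro card_mono finite_imp_finite_nsets) (auto simp: mono_cliques_def)
  also have "\<dots> = N choose k" by (simp add: card_nsets)
  also have "\<dots> \<le> N ^ k"
    by (cases "k \<le> N") (auto simp: binomial_le_pow binomial_eq_0)
  finally show ?thesis by (simp flip: of_nat_power)
qed

lemma color_graph_pair: "{u, v} \<in> color_graph N \<chi> a \<longleftrightarrow> u < N \<and> v < N \<and> u \<noteq> v \<and> \<chi> {u, v} = a"
  by (auto simp: color_graph_def)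

lemma mono_cliques_iff:
  "Q \<in> mono_cliques N \<chi> a k \<longleftrightarrow> Q \<in> [{..<N}]\<^bsup>k\<^esup> \<and> (\<forall>x\<in>Q. \<forall>y\<in>Q. x \<noteq> y \<longrightarrow> {x, y} \<in> color_graph N \<chi> a)"
proof -
  have "[Q]\<^bsup>2\<^esup> \<subseteq> X \<longleftrightarrow> (\<forall>x\<in>Q. \<forall>y\<in>Q. x \<noteq> y \<longrightarrow> {x, y} \<in> X)" for X
    by (simp add: nsets_2_eq UN_subset_iff) fast
  then show ?thesis by (simp add: mono_cliques_def)
qed

lemma red_cliques_eq_mono_cliques:
  "red_cliques {..<N} (\<lambda>x y. {x, y} \<in> color_graph N \<chi> Red) s = mono_cliques N \<chi> Red s"
  unfolding red_cliques_def by (auto simp: mono_cliques_iff)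

lemma rich_indep_sets_subset:
  "rich_indep_sets {..<N} (\<lambda>x y. {x, y} \<in> color_graph N \<chi> Red) k b
    \<subseteq> {Q \<in> mono_cliques N \<chi> Blue k. b \<le> real (card (extensions N \<chi> Blue Q))}"
proof
  fix Q assume Q: "Q \<in> rich_indep_sets {..<N} (\<lambda>x y. {x, y} \<in> color_graph N \<chi> Red) k b"
  have blue: "{x, y} \<in> color_graph N \<chi> Blue \<longleftrightarrow> {x, y} \<notin> color_graph N \<chi> Red" if "x < N" "y < N" "x \<noteq> y" for x y
    using that by (cases "\<chi> {x, y}") (simp_all add: color_graph_pair)
  have QN: "Q \<in> [{..<N}]\<^bsup>k\<^esup>" "Q \<subseteq> {..<N}"
    using Q by (auto simp: rich_indep_sets_def nsets_def)
  have "{x, y} \<in> color_graph N \<chi> Blue" if "x \<in> Q" "y \<in> Q" "x \<noteq> y" for x y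
  proof -
    have "{x, y} \<notin> color_graph N \<chi> Red"
      using Q that unfolding rich_indep_sets_def by blast
    moreover have "x < N" "y < N" using that QN(2) by auto
    ultimately show ?thesis using blue[of x y] that by simp
  qed
  then have "Q \<in> mono_cliques N \<chi> Blue k"
    using QN(1) by (simp add: mono_cliques_iff)
  moreover have "{u \<in> {..<N} - Q. \<forall>x\<in>Q. {x, u} \<notin> color_graph N \<chi> Red} = extensions N \<chi> Blue Q"
    unfolding extensions_def
  proof (rule Collect_cong, rule conj_cong[OF refl], rule ball_cong[OF refl])
    fix u x assume "u \<in> {..<N} - Q" "x \<in> Q"
    then show "{x, u} \<notin> color_graph N \<chi> Red \<longleftrightarrow> {u, x} \<in> color_graph N \<chi> Blue"
      using blue[of u x] QN(2) by (auto simp: insert_commute[of x u])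
  qed
  ultimately show "Q \<in> {Q \<in> mono_cliques N \<chi> Blue k. b \<le> real (card (extensions N \<chi> Blue Q))}"
    using Q by (simp add: rich_indep_sets_def)
qed

lemma finite_extensions: "finite (extensions N \<chi> a Q)" and card_extensions_le: "card (extensions N \<chi> a Q) \<le> N"
proof -
  have "extensions N \<chi> a Q \<subseteq> {..<N}" by (auto simp: extensions_def)
  then show "finite (extensions N \<chi> a Q)" "card (extensions N \<chi> a Q) \<le> N"
    using finite_subset card_mono[of "{..<N}"] by fastforce+
qed

text \<open>Every (k+1)-clique is a k-clique with an extension. The at most \<gamma> N^k cliques
  with many extensions contribute at most N each, all others at most b N each. With b = c/k +
  \<gamma> this is where the smallness of c enters.\<close>

lemma card_mono_cliques_Suc_le:
  fixes b \<gamma> :: real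
  assumes few: "real (card {Q \<in> mono_cliques N \<chi> a k. b * real N \<le> real (card (extensions N \<chi> a Q))}) \<le> \<gamma> * real N ^ k"
    and "0 \<le> b"
  shows "real (card (mono_cliques N \<chi> a (Suc k))) \<le> (\<gamma> + b) * real N ^ Suc k"
proof -
  let ?M = "mono_cliques N \<chi> a k" and ?e = "\<lambda>Q. extensions N \<chi> a Q"
  define X where "X = {Q \<in> ?M. b * real N \<le> real (card (?e Q))}"
  have fin: "finite ?M"
    using finite_imp_finite_nsets[of "{..<N}" k] by (simp add: mono_cliques_def)
  have "mono_cliques N \<chi> a (Suc k) \<subseteq> (\<Union>Q\<in>?M. (\<lambda>u. insert u Q) ` ?e Q)"
  proof
    fix K assume K: "K \<in> mono_cliques N \<chi> a (Suc k)"
    then have "finite K" "card K = Suc k" "K \<subseteq> {..<N}"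
      by (auto simp: mono_cliques_iff nsets_def)
    then obtain u where u: "u \<in> K" by fastforce
    have "K - {u} \<in> ?M"
      using K u by (auto simp: mono_cliques_iff nsets_def)
    moreover have "u \<in> ?e (K - {u})"
      using K u \<open>K \<subseteq> {..<N}\<close> by (auto simp: extensions_def mono_cliques_iff)
    moreover have "K = insert u (K - {u})" using u by auto
    ultimately show "K \<in> (\<Union>Q\<in>?M. (\<lambda>u. insert u Q) ` ?e Q)" by blast
  qed
  then have "card (mono_cliques N \<chi> a (Suc k)) \<le> card (\<Union>Q\<in>?M. (\<lambda>u. insert u Q) ` ?e Q)"
    using fin finite_extensions by (intro card_mono) auto
  also have "\<dots> \<le> (\<Sum>Q\<in>?M. card ((\<lambda>u. insert u Q) ` ?e Q))" by (rule card_UN_le[OF fin])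
  also have "\<dots> \<le> (\<Sum>Q\<in>?M. card (?e Q))" by (intro sum_mono card_image_le finite_extensions)
  finally have "real (card (mono_cliques N \<chi> a (Suc k))) \<le> (\<Sum>Q\<in>?M. real (card (?e Q)))"
    by (simp flip: of_nat_sum)
  also have "\<dots> \<le> (\<Sum>Q\<in>?M. of_bool (Q \<in> X) * real N + b * real N)"
  proof (rule sum_mono)
    fix Q assume "Q \<in> ?M"
    then show "real (card (?e Q)) \<le> of_bool (Q \<in> X) * real N + b * real N"
      using card_extensions_le[of N \<chi> a Q] \<open>0 \<le> b\<close> by (cases "Q \<in> X") (auto simp: X_def add_increasing2)
  qed
  also have "\<dots> = card X * real N + card ?M * (b * real N)"
  proof -
    have "X \<subseteq> ?M" by (auto simp: X_def)
    then have "(\<Sum>Q\<in>?M. of_bool (Q \<in> X) * real N) = card X * real N"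
      using fin by (simp add: sum_distrib_right[symmetric] Int_absorb1)
    then show ?thesis by (simp add: sum.distrib)
  qed
  also have "\<dots> \<le> (\<gamma> * real N ^ k) * real N + real N ^ k * (b * real N)"
    using few card_mono_cliques_le[of N \<chi> a k] \<open>0 \<le> b\<close> unfolding X_def
    by (intro add_mono mult_right_mono) auto
  finally show ?thesis by (simp add: algebra_simps)
qed

text \<open>The new coloring is red exactly across the label classes, so an edge changes color
  precisely when it is red inside a class or blue between classes. The sum counts such an edge in
  both orders.\<close>

lemma recolor_to_balanced:
  fixes g :: "nat \<Rightarrow> nat"
  assumes g: "g ` {..<N} \<subseteq> {..<k}"
    and bal: "\<forall>i<k. \<forall>j<k. card {v\<in>{..<N}. g v = i} \<le> card {v\<in>{..<N}. g v = j} + 1"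
  shows "\<exists>\<chi>'. real (card (recolored_edges N \<chi> \<chi>'))
      \<le> (\<Sum>u<N. \<Sum>v<N. of_bool (({u, v} \<in> color_graph N \<chi> Red) = (g u = g v))) \<and>
    balanced_complete_partite k {..<N} (color_graph N \<chi>' Red)"
proof -
  define \<chi>' where "\<chi>' = (\<lambda>e. if \<exists>u v. e = {u, v} \<and> g u \<noteq> g v then Red else Blue)"
  have \<chi>': "\<chi>' {u, v} = Red \<longleftrightarrow> g u \<noteq> g v" for u v
    by (auto simp: \<chi>'_def doubleton_eq_iff)
  define W where "W = {p \<in> {..<N} \<times> {..<N}. ({fst p, snd p} \<in> color_graph N \<chi> Red) = (g (fst p) = g (snd p))}"
  have finW: "finite W" by (simp add: W_def)
  have "recolored_edges N \<chi> \<chi>' \<subseteq> (\<lambda>p. {fst p, snd p}) ` W"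
  proof
    fix e assume e: "e \<in> recolored_edges N \<chi> \<chi>'"
    then obtain u v where uv: "e = {u, v}" "u < N" "v < N" "u \<noteq> v" "\<chi> e \<noteq> \<chi>' e"
      by (auto simp: recolored_edges_def nsets_2_eq)
    have "(\<chi> {u, v} = Red) = (g u = g v)"
      using uv(1,5) \<chi>'[of u v] by (metis color.exhaust)
    then have "(u, v) \<in> W" using uv by (simp add: W_def color_graph_pair)
    then show "e \<in> (\<lambda>p. {fst p, snd p}) ` W" using uv(1) by force
  qed
  then have "card (recolored_edges N \<chi> \<chi>') \<le> card W"
    using finW by (meson card_image_le card_mono finite_imageI le_trans)
  then have "real (card (recolored_edges N \<chi> \<chi>')) \<le> real (card W)" by simp
  also have "real (card W) = (\<Sum>u<N. \<Sum>v<N. of_bool (({u, v} \<in> color_graph N \<chi> Red) = (g u = g v)))"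
  proof -
    have "W = (SIGMA u:{..<N}. {v\<in>{..<N}. ({u, v} \<in> color_graph N \<chi> Red) = (g u = g v)})"
      by (auto simp: W_def)
    then show ?thesis by (simp add: Int_def)
  qed
  finally have 1: "real (card (recolored_edges N \<chi> \<chi>'))
      \<le> (\<Sum>u<N. \<Sum>v<N. of_bool (({u, v} \<in> color_graph N \<chi> Red) = (g u = g v)))" .
  have "color_graph N \<chi>' Red = {{u, v} | u v. \<exists>i<k. \<exists>j<k. i \<noteq> j \<and> u \<in> {v\<in>{..<N}. g v = i} \<and> v \<in> {v\<in>{..<N}. g v = j}}"
  proof (intro equalityI subsetI)
    fix e assume "e \<in> color_graph N \<chi>' Red"
    then obtain u v where uv: "e = {u, v}" "u < N" "v < N" "\<chi>' {u, v} = Red"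
      by (auto simp: color_graph_def nsets_2_eq)
    then have "g u \<noteq> g v" "g u < k" "g v < k" using \<chi>' g by auto
    then show "e \<in> {{u, v} | u v. \<exists>i<k. \<exists>j<k. i \<noteq> j \<and> u \<in> {v\<in>{..<N}. g v = i} \<and> v \<in> {v\<in>{..<N}. g v = j}}"
      using uv by blast
  next
    fix e assume "e \<in> {{u, v} | u v. \<exists>i<k. \<exists>j<k. i \<noteq> j \<and> u \<in> {v\<in>{..<N}. g v = i} \<and> v \<in> {v\<in>{..<N}. g v = j}}"
    then obtain u v where uv: "e = {u, v}" "u < N" "v < N" "g u \<noteq> g v" by auto
    then show "e \<in> color_graph N \<chi>' Red" using \<chi>' by (auto simp: color_graph_pair)
  qed
  then have "balanced_complete_partite k {..<N} (color_graph N \<chi>' Red)"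
    unfolding balanced_complete_partite_def using g bal
    by (intro exI[of _ "\<lambda>i. {v\<in>{..<N}. g v = i}"]) (auto simp: disjoint_family_on_def)
  with 1 show ?thesis by blast
qed

theorem theorem1p2:
  fixes k :: nat and \<theta> :: real
  assumes "k \<ge> 2" and "\<theta> > 0"
  shows "\<exists>c \<gamma> :: real. 0 < c \<and> c < 1 \<and> 0 < \<gamma> \<and> \<gamma> < 1 \<and>
    (\<forall>\<^sub>F N in sequentially. \<forall>\<chi> :: nat set \<Rightarrow> color.
      (\<exists>\<chi>'. real (card (recolored_edges N \<chi> \<chi>')) \<le> \<theta> * real N ^ 2 \<and>
             balanced_complete_partite k {..<N} (color_graph N \<chi>' Red)) \<or>
      real (card {Q \<in> mono_cliques N \<chi> Red k.
                    real (card (extensions N \<chi> Red Q)) \<ge> (c / real k + \<gamma>) * real N})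
        \<ge> \<gamma> * real N ^ k \<or>
      real (card {Q \<in> mono_cliques N \<chi> Blue k.
                    real (card (extensions N \<chi> Blue Q)) \<ge> (1 / real k + \<gamma>) * real N})
        \<ge> \<gamma> * real N ^ k)"
proof -
  have k: "2 \<le> real k" "1 \<le> real k" "0 < real k" using assms(1) by auto
  \<comment> \<open>Linear in \<theta> for the wrong pairs, but quadratic for the class sizes, whose
    deviations are controlled only through their squares.\<close>
  define \<rho> where "\<rho> = min (\<theta> / 8) (\<theta>\<^sup>2 / (64 * k))"
  have \<rho>: "0 < \<rho>" "8 * \<rho> \<le> \<theta>" "64 * (k * \<rho>) \<le> \<theta>\<^sup>2"
  proof -
    show "0 < \<rho>" "8 * \<rho> \<le> \<theta>" using assms k by (auto simp: \<rho>_def)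
    have "\<rho> \<le> \<theta>\<^sup>2 / (64 * k)" by (simp add: \<rho>_def)
    then show "64 * (k * \<rho>) \<le> \<theta>\<^sup>2" using k by (simp add: field_simps)
  qed
  \<comment> \<open>The three bounds give, in this order, \<mu> > 0, an edge density of at least 1 -
    1/k - \<rho>/2, and 2 k (k - 1) \<epsilon> \<le> \<rho>/4 in the error of the labelling.\<close>
  define \<epsilon> where "\<epsilon> = min (1 / (2 * k * k)) (min (\<rho> / 2) (\<rho> / (8 * k * k)))"
  have \<epsilon>: "0 < \<epsilon>" "\<epsilon> \<le> 1 / (2 * k * k)" "\<epsilon> \<le> \<rho> / 2" "\<epsilon> \<le> \<rho> / (8 * k * k)"
    using \<rho>(1) k by (auto simp: \<epsilon>_def)
  define \<mu> where "\<mu> = 1 / k - (real k - 1) * \<epsilon>"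
  have \<mu>: "0 < \<mu>"
  proof -
    have "(real k - 1) * \<epsilon> \<le> k * (1 / (2 * k * k))"
      using \<epsilon> k by (intro mult_mono) auto
    also have "\<dots> < 1 / k" using k by (simp add: field_simps)
    finally show ?thesis by (simp add: \<mu>_def)
  qed
  have \<epsilon>\<rho>: "2 * real k * (real k - 1) * \<epsilon> \<le> \<rho> / 4"
  proof -
    have "2 * real k * (real k - 1) * \<epsilon> \<le> 2 * k * k * (\<rho> / (8 * k * k))"
      using \<epsilon> k by (intro mult_mono) auto
    also have "\<dots> = \<rho> / 4" using k by (simp add: field_simps)
    finally show ?thesis .
  qed
  \<comment> \<open>Makes the second term in the error of the labelling equal to \<rho>/4, so that
    the whole error is at most \<rho>/2.\<close>
  define \<tau> where "\<tau> = \<rho> * \<mu> ^ k / (12 * k)"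
  have \<tau>: "0 < \<tau>" "3 * real k * \<tau> / \<mu> ^ k = \<rho> / 4"
    using \<rho>(1) \<mu> k by (auto simp: \<tau>_def field_simps)
  obtain \<delta> :: real and N0 where \<delta>: "0 < \<delta>" and dense: "\<forall>(V::nat set) E. finite V \<longrightarrow> V \<noteq> {} \<longrightarrow> (\<forall>x y. E x y = E y x) \<longrightarrow>
    (\<forall>x. \<not> E x x) \<longrightarrow> N0 \<le> card V \<longrightarrow>
    card (red_cliques V E (Suc k)) \<le> \<delta> * card V ^ Suc k \<longrightarrow>
    card (rich_indep_sets V E k ((1 / k + \<delta>) * card V)) \<le> \<delta> * card V ^ k \<longrightarrow>
    (1 - 1 / k - \<epsilon>) * (card V)\<^sup>2 \<le> (\<Sum>u\<in>V. \<Sum>v\<in>V. of_bool (E u v))"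
    using dense_if_local_bounds[where 'a = nat, OF assms(1) \<epsilon>(1)] by (elim exE conjE) (rule that; assumption)
  define s where "s = real (Suc k ^ Suc k)"
  have s: "0 < s" unfolding s_def of_nat_0_less_iff by (rule zero_less_power) simp
  define \<delta>' where "\<delta>' = min (min \<delta> (\<tau> / s)) 1"
  have \<delta>': "0 < \<delta>'" "\<delta>' \<le> \<delta>" "s * \<delta>' \<le> \<tau>" "\<delta>' \<le> 1"
  proof -
    have "\<delta>' \<le> \<tau> / s" by (simp add: \<delta>'_def)
    then show "s * \<delta>' \<le> \<tau>" using s by (simp add: pos_le_divide_eq mult.commute)
  qed (use \<delta> \<tau> s in \<open>auto simp: \<delta>'_def\<close>)
  \<comment> \<open>With c = \<delta>'/2 below, the red (k+1)-cliques number at most (\<gamma> +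
    (c/k + \<gamma>)) N^(k+1) \<le> \<delta>' N^(k+1).\<close>
  define \<gamma> where "\<gamma> = \<delta>' / 4"
  define c where "c = \<delta>' / 2"
  \<comment> \<open>From N1 on, 4 k \<le> \<theta> N; this absorbs the rounding by at most one
    vertex per class when the classes are balanced.\<close>
  obtain N1 :: nat where N1: "4 * k / \<theta> < N1" using reals_Archimedean2 by blast
  have main: "(\<exists>\<chi>'. real (card (recolored_edges N \<chi> \<chi>')) \<le> \<theta> * real N ^ 2 \<and>
             balanced_complete_partite k {..<N} (color_graph N \<chi>' Red))"
    if N: "max 1 (max N0 N1) \<le> N"
      and red: "\<not> real (card {Q \<in> mono_cliques N \<chi> Red k.
                    real (card (extensions N \<chi> Red Q)) \<ge> (c / real k + \<gamma>) * real N}) \<ge> \<gamma> * real N ^ k"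
      and blue: "\<not> real (card {Q \<in> mono_cliques N \<chi> Blue k.
                    real (card (extensions N \<chi> Blue Q)) \<ge> (1 / real k + \<gamma>) * real N}) \<ge> \<gamma> * real N ^ k"
    for N and \<chi> :: "nat set \<Rightarrow> color"
  proof -
    define E where "E = (\<lambda>x y. {x, y} \<in> color_graph N \<chi> Red)"
    have sym: "\<forall>x y. E x y = E y x" by (simp add: E_def insert_commute)
    have irrefl: "\<forall>x. \<not> E x x" by (simp add: E_def color_graph_def nsets_def)
    have ne: "{..<N} \<noteq> {}" "N0 \<le> card {..<N}" using N by (auto simp: lessThan_empty_iff)
    have "real (card (mono_cliques N \<chi> Red (Suc k))) \<le> (\<gamma> + (c / k + \<gamma>)) * real N ^ Suc k"
      using red \<delta>'(1) by (intro card_mono_cliques_Suc_le) (auto simp: c_def \<gamma>_def not_le less_imp_le)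
    also have "\<dots> \<le> \<delta>' * real N ^ Suc k"
    proof (intro mult_right_mono)
      have "c / k \<le> c / 1" using k \<delta>'(1) by (intro divide_left_mono) (auto simp: c_def)
      then show "\<gamma> + (c / k + \<gamma>) \<le> \<delta>'" by (simp add: c_def \<gamma>_def)
    qed simp
    finally have red_le: "real (card (red_cliques {..<N} E (Suc k))) \<le> \<delta>' * real N ^ Suc k"
      unfolding E_def red_cliques_eq_mono_cliques .
    have "real (card (red_cliques {..<N} E (Suc k))) \<le> \<delta> * real N ^ Suc k"
      using red_le mult_right_mono[OF \<delta>'(2) zero_le_power[OF of_nat_0_le_iff], of N "Suc k"] by linarith
    then have red1: "card (red_cliques {..<N} E (Suc k)) \<le> \<delta> * card {..<N} ^ Suc k" by simp
    have "rich_indep_sets {..<N} E k ((1 / k + \<delta>) * N) \<subseteq> rich_indep_sets {..<N} E k ((1 / k + \<gamma>) * N)"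
      using \<delta>' by (intro rich_indep_sets_antimono mult_right_mono) (auto simp: \<gamma>_def)
    also have "\<dots> \<subseteq> {Q \<in> mono_cliques N \<chi> Blue k. real (card (extensions N \<chi> Blue Q)) \<ge> (1 / k + \<gamma>) * N}"
      unfolding E_def by (rule rich_indep_sets_subset)
    finally have "card (rich_indep_sets {..<N} E k ((1 / k + \<delta>) * N))
        \<le> card {Q \<in> mono_cliques N \<chi> Blue k. real (card (extensions N \<chi> Blue Q)) \<ge> (1 / k + \<gamma>) * N}"
      using finite_imp_finite_nsets[of "{..<N}" k] by (intro card_mono) (auto simp: mono_cliques_def)
    then have "real (card (rich_indep_sets {..<N} E k ((1 / k + \<delta>) * N))) \<le> \<gamma> * real N ^ k"
      using blue by linarith
    also have "\<dots> \<le> \<delta> * real N ^ k"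
      using \<delta>' by (intro mult_right_mono) (auto simp: \<gamma>_def)
    finally have rich1: "card (rich_indep_sets {..<N} E k ((1 / k + \<delta>) * card {..<N})) \<le> \<delta> * card {..<N} ^ k"
      by simp
    have dense_E: "(1 - 1 / k - \<epsilon>) * (card {..<N})\<^sup>2 \<le> (\<Sum>u<N. \<Sum>v<N. of_bool (E u v))"
      by (rule dense[THEN spec, THEN spec, THEN mp, THEN mp, THEN mp, THEN mp, THEN mp, THEN mp, THEN mp,
            OF finite_lessThan ne(1) sym irrefl ne(2) red1 rich1])
    have "clique_sum {..<N} (\<lambda>u v. of_bool (E u v)) {..<Suc k} \<le> s * card (red_cliques {..<N} E (Suc k))"
      unfolding s_def using irrefl sym by (intro clique_sum_le_red_cliques) auto
    also have "\<dots> \<le> s * (\<delta>' * real N ^ Suc k)"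
      using red_le s by (intro mult_left_mono) auto
    also have "\<dots> = (s * \<delta>') * real N ^ Suc k" by simp
    also have "\<dots> \<le> \<tau> * real N ^ Suc k" using \<delta>'(3) by (intro mult_right_mono) auto
    finally have sparse_E: "clique_sum {..<N} (\<lambda>u v. of_bool (E u v)) {..<Suc k} \<le> \<tau> * card {..<N} ^ Suc k"
      by simp
    have sym': "of_bool (E u v) = (of_bool (E v u) :: real)" for u v using sym by simp
    obtain f where f: "f ` {..<N} \<subseteq> {..<k}"
      and inside: "(\<Sum>u<N. \<Sum>v<N. of_bool (f u = f v) * of_bool (E u v))
        \<le> (2 * real k * (real k - 1) * \<epsilon> + 3 * real k * \<tau> / \<mu> ^ k) * (card {..<N})\<^sup>2"
    proof -
      have "\<exists>f. f ` {..<N} \<subseteq> {..<k} \<and> (\<Sum>u<N. \<Sum>v<N. of_bool (f u = f v) * of_bool (E u v))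
        \<le> (2 * real k * (real k - 1) * \<epsilon> + 3 * real k * \<tau> / \<mu> ^ k) * (card {..<N})\<^sup>2"
        by (rule stability_labelling[where h = "\<lambda>u v. of_bool (E u v)",
              OF finite_lessThan ne(1) sym' _ assms(1) less_imp_le[OF \<epsilon>(1)] dense_E sparse_E \<mu>_def \<mu>]) simp
      then show ?thesis using that by blast
    qed
    have "\<exists>g. g ` {..<N} \<subseteq> {..<k} \<and>
      (\<forall>i<k. \<forall>j<k. card {v\<in>{..<N}. g v = i} \<le> card {v\<in>{..<N}. g v = j} + 1) \<and>
      (\<Sum>u<N. \<Sum>v<N. of_bool (E u v = (g u = g v))) \<le> \<theta> * (real N)\<^sup>2"
    proof (rule balanced_labelling[OF _ f])
      have "2 * real k * (real k - 1) * \<epsilon> + 3 * real k * \<tau> / \<mu> ^ k \<le> \<rho> / 2"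
        by (rule order_trans[OF add_mono[OF \<epsilon>\<rho> eq_refl[OF \<tau>(2)]]]) simp
      then have "(2 * real k * (real k - 1) * \<epsilon> + 3 * real k * \<tau> / \<mu> ^ k) * (card {..<N})\<^sup>2 \<le> \<rho> / 2 * (card {..<N})\<^sup>2"
        by (intro mult_right_mono) auto
      with inside show "(\<Sum>u<N. \<Sum>v<N. of_bool (f u = f v) * of_bool (E u v)) \<le> \<rho> / 2 * (real N)\<^sup>2"
        by simp
      have "(1 - 1 / k - \<rho> / 2) * (card {..<N})\<^sup>2 \<le> (1 - 1 / k - \<epsilon>) * (card {..<N})\<^sup>2"
        using \<epsilon>(3) by (intro mult_right_mono) auto
      with dense_E show "(1 - 1 / k - \<rho> / 2) * (real N)\<^sup>2 \<le> (\<Sum>u<N. \<Sum>v<N. of_bool (E u v))"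
        by simp
      have "4 * k < \<theta> * N1" using N1 assms(2) by (simp add: pos_divide_less_eq mult.commute)
      also have "\<dots> \<le> \<theta> * N" using N assms(2) by (intro mult_left_mono) auto
      finally show "4 * k \<le> \<theta> * N" by simp
    qed (use \<rho> assms in auto)
    then obtain g where g: "g ` {..<N} \<subseteq> {..<k}" "\<forall>i<k. \<forall>j<k. card {v\<in>{..<N}. g v = i} \<le> card {v\<in>{..<N}. g v = j} + 1"
      and wrong: "(\<Sum>u<N. \<Sum>v<N. of_bool (E u v = (g u = g v))) \<le> \<theta> * (real N)\<^sup>2"
      by blast
    obtain \<chi>' where "real (card (recolored_edges N \<chi> \<chi>')) \<le> (\<Sum>u<N. \<Sum>v<N. of_bool (E u v = (g u = g v)))"
      "balanced_complete_partite k {..<N} (color_graph N \<chi>' Red)"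
      using recolor_to_balanced[OF g, of \<chi>] unfolding E_def by blast
    with wrong show ?thesis by (intro exI[of _ \<chi>']) simp
  qed
  have "0 < c" "c < 1" "0 < \<gamma>" "\<gamma> < 1" using \<delta>' by (auto simp: c_def \<gamma>_def)
  moreover have "\<forall>\<^sub>F N in sequentially. \<forall>\<chi> :: nat set \<Rightarrow> color.
      (\<exists>\<chi>'. real (card (recolored_edges N \<chi> \<chi>')) \<le> \<theta> * real N ^ 2 \<and>
             balanced_complete_partite k {..<N} (color_graph N \<chi>' Red)) \<or>
      real (card {Q \<in> mono_cliques N \<chi> Red k.
                    real (card (extensions N \<chi> Red Q)) \<ge> (c / real k + \<gamma>) * real N})
        \<ge> \<gamma> * real N ^ k \<or>
      real (card {Q \<in> mono_cliques N \<chi> Blue k.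
                    real (card (extensions N \<chi> Blue Q)) \<ge> (1 / real k + \<gamma>) * real N})
        \<ge> \<gamma> * real N ^ k"
    using eventually_ge_at_top[of "max 1 (max N0 N1)"]
  proof eventually_elim
    case (elim N)
    then show ?case using main[of N] by blast
  qed
  ultimately show ?thesis by blast
qed

end
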